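(* For $k\ge1$ let $\gamma_1=(k+1,1^k)\vdash n_1=2k+1$ and $\gamma_2=(k+1,2,1^{k-1})\vdash n_2=2k+2$ (both self-conjugate). For $i=1,2$ let $A_i=\{\lambda\in P(n_i)\mid g(\gamma_i,\gamma_i,\lambda)>0\}$ and $B_i=\{\lambda\in P(n_i)\mid\chi^{\lambda}(\hat\gamma_i)\neq0\}$. Then, for $i=1,2$, $\frac{|B_i|}{|A_i|}\to0$ as $k\to\infty$.
   Context: $P(n)$ is the set of partitions of $n$. $\chi^\lambda$ is the irreducible character of $S_n$ indexed by $\lambda\vdash n$, $\chi^\lambda(\mu)$ its value on the class of cycle type $\mu$, and $g(\lambda,\mu,\nu)=\langle\chi^\lambda,\chi^\mu\otimes\chi^\nu\rangle$ is the Kronecker coefficient. For a partition $\lambda$ whose largest contained square is $(s^s)$, $\hat\lambda=(|h_{1,1}|,\ldots,|h_{s,s}|)$ is the principal hook partition, where $|h_{i,i}|$ is the hooklength of the diagonal box $(i,i)$. *)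

theory Defs
  imports
    Complex_Main
    "HOL-Library.Multiset"
    "HOL-Library.Function_Algebras"
    "HOL-Library.Complex_Order"
    "HOL-Combinatorics.Permutations"
    "HOL-Combinatorics.Orbits"
begin

section \<open>Partitions, diagrams and hooks\<close>

definition partitions_of :: "nat \<Rightarrow> nat list set" where
  "partitions_of n = {xs. sorted_wrt (\<ge>) xs \<and> 0 \<notin> set xs \<and> sum_list xs = n}"

text \<open>Boxes are pairs (row, column) counted from 0, so the box written \<open>(i, j)\<close> on paper is
  \<open>(i - 1, j - 1)\<close> here.\<close>

definition diagram :: "nat list \<Rightarrow> (nat \<times> nat) set" where
  "diagram xs = {(r, c). r < length xs \<and> c < xs ! r}"

definition self_conjugate :: "nat list \<Rightarrow> bool" where
  "self_conjugate xs \<longleftrightarrow> (\<forall>r c. (r, c) \<in> diagram xs \<longleftrightarrow> (c, r) \<in> diagram xs)"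

definition hook :: "nat list \<Rightarrow> nat \<Rightarrow> nat \<Rightarrow> (nat \<times> nat) set" where
  "hook xs i j = {(r, c) \<in> diagram xs. (r = i \<and> j \<le> c) \<or> (c = j \<and> i \<le> r)}"

definition durfee :: "nat list \<Rightarrow> nat" where
  "durfee xs = (GREATEST s. {..<s} \<times> {..<s} \<subseteq> diagram xs)"

definition principal_hooks :: "nat list \<Rightarrow> nat list" where
  "principal_hooks xs = map (\<lambda>i. card (hook xs i i)) [0..<durfee xs]"


section \<open>Irreducible characters of the symmetric group\<close>

abbreviation Sym :: "nat \<Rightarrow> (nat \<Rightarrow> nat) set" where
  "Sym n \<equiv> {w. w permutes {..<n}}"

text \<open>The group algebra \<open>\<complex>[S\<^sub>n]\<close> consists of the complex functions on permutations that vanish outside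
  \<open>Sym n\<close>; the function \<open>f\<close> stands for the formal sum of the \<open>f w \<cdot> w\<close>, and
  multiplication is convolution. Addition of functions is pointwise.\<close>

definition group_algebra :: "nat \<Rightarrow> ((nat \<Rightarrow> nat) \<Rightarrow> complex) set" where
  "group_algebra n = {f. \<forall>w. w \<notin> Sym n \<longrightarrow> f w = 0}"

definition conv :: "nat \<Rightarrow> ((nat \<Rightarrow> nat) \<Rightarrow> complex) \<Rightarrow> ((nat \<Rightarrow> nat) \<Rightarrow> complex)
    \<Rightarrow> (nat \<Rightarrow> nat) \<Rightarrow> complex" where
  "conv n f g = (\<lambda>w. \<Sum>u\<in>Sym n. f u * g (inv u \<circ> w))"

definition fscale :: "complex \<Rightarrow> ((nat \<Rightarrow> nat) \<Rightarrow> complex) \<Rightarrow> (nat \<Rightarrow> nat) \<Rightarrow> complex" where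
  "fscale a f = (\<lambda>w. a * f w)"

global_interpretation fspace: vector_space fscale
  by unfold_locales (auto simp: fscale_def fun_eq_iff algebra_simps)

text \<open>The row-reading tableau: the boxes are filled with \<open>0, \<dots>, n - 1\<close> row by row. The row and column
  groups consist of the permutations preserving every row, respectively every column.\<close>

definition tableau :: "nat list \<Rightarrow> nat \<times> nat \<Rightarrow> nat" where
  "tableau xs = (\<lambda>(r, c). sum_list (take r xs) + c)"

definition row_group :: "nat list \<Rightarrow> (nat \<Rightarrow> nat) set" where
  "row_group xs = {w \<in> Sym (sum_list xs).
     \<forall>r. w ` (tableau xs ` {b \<in> diagram xs. fst b = r}) = tableau xs ` {b \<in> diagram xs. fst b = r}}"

definition column_group :: "nat list \<Rightarrow> (nat \<Rightarrow> nat) set" where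
  "column_group xs = {w \<in> Sym (sum_list xs).
     \<forall>c. w ` (tableau xs ` {b \<in> diagram xs. snd b = c}) = tableau xs ` {b \<in> diagram xs. snd b = c}}"

definition row_symmetrizer :: "nat list \<Rightarrow> (nat \<Rightarrow> nat) \<Rightarrow> complex" where
  "row_symmetrizer xs = (\<lambda>w. if w \<in> row_group xs then 1 else 0)"

definition column_antisymmetrizer :: "nat list \<Rightarrow> (nat \<Rightarrow> nat) \<Rightarrow> complex" where
  "column_antisymmetrizer xs = (\<lambda>w. if w \<in> column_group xs then of_int (sign w) else 0)"

definition young_symmetrizer :: "nat list \<Rightarrow> (nat \<Rightarrow> nat) \<Rightarrow> complex" where
  "young_symmetrizer xs = conv (sum_list xs) (row_symmetrizer xs) (column_antisymmetrizer xs)"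

text \<open>The irreducible \<open>S\<^sub>n\<close>-module indexed by a partition is the left ideal generated by its Young
  symmetrizer. With this convention the one-row partition gives the trivial module, and the
  one-column partition the sign module.\<close>

definition specht :: "nat list \<Rightarrow> ((nat \<Rightarrow> nat) \<Rightarrow> complex) set" where
  "specht xs = (\<lambda>f. conv (sum_list xs) f (young_symmetrizer xs)) ` group_algebra (sum_list xs)"

text \<open>Left multiplication by a group element.\<close>

definition act :: "(nat \<Rightarrow> nat) \<Rightarrow> ((nat \<Rightarrow> nat) \<Rightarrow> complex) \<Rightarrow> (nat \<Rightarrow> nat) \<Rightarrow> complex" where
  "act w f = (\<lambda>u. f (inv w \<circ> u))"

text \<open>The trace of \<open>T\<close> on a finite-dimensional \<open>T\<close>-invariant subspace \<open>V\<close>, computed in some basis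
  of \<open>V\<close>.\<close>

definition trace_on :: "((nat \<Rightarrow> nat) \<Rightarrow> complex) set
    \<Rightarrow> (((nat \<Rightarrow> nat) \<Rightarrow> complex) \<Rightarrow> ((nat \<Rightarrow> nat) \<Rightarrow> complex)) \<Rightarrow> complex" where
  "trace_on V T =
     (let B = (SOME B. fspace.independent B \<and> fspace.span B = V)
      in \<Sum>b\<in>B. fspace.representation B (T b) b)"

definition irr_char :: "nat list \<Rightarrow> (nat \<Rightarrow> nat) \<Rightarrow> complex" where
  "irr_char xs w = trace_on (specht xs) (act w)"

definition cycle_type :: "nat \<Rightarrow> (nat \<Rightarrow> nat) \<Rightarrow> nat multiset" where
  "cycle_type n w = image_mset card (mset_set (orbit w ` {..<n}))"

definition irr_char_at :: "nat list \<Rightarrow> nat list \<Rightarrow> complex" where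
  "irr_char_at xs ys =
     irr_char xs (SOME w. w \<in> Sym (sum_list xs) \<and> cycle_type (sum_list xs) w = mset ys)"


section \<open>Kronecker coefficients\<close>

definition char_inner :: "nat \<Rightarrow> ((nat \<Rightarrow> nat) \<Rightarrow> complex) \<Rightarrow> ((nat \<Rightarrow> nat) \<Rightarrow> complex) \<Rightarrow> complex" where
  "char_inner n \<phi> \<psi> = (\<Sum>w\<in>Sym n. \<phi> w * cnj (\<psi> w)) / fact n"

text \<open>As a complex number; \<open>0 < z\<close> on \<^typ>\<open>complex\<close> means that \<open>z\<close> is real and positive.\<close>

definition kronecker :: "nat list \<Rightarrow> nat list \<Rightarrow> nat list \<Rightarrow> complex" where
  "kronecker xs ys zs =
     char_inner (sum_list xs) (irr_char xs) (\<lambda>w. irr_char ys w * irr_char zs w)"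


section \<open>The two families of partitions\<close>

definition gamma1 :: "nat \<Rightarrow> nat list" where
  "gamma1 k = (k + 1) # replicate k 1"

text \<open>Meaningful for \<open>k \<ge> 1\<close> only.\<close>

definition gamma2 :: "nat \<Rightarrow> nat list" where
  "gamma2 k = (k + 1) # 2 # replicate (k - 1) 1"

lemma gamma1_partition: "gamma1 k \<in> partitions_of (2 * k + 1)"
  by (auto simp: gamma1_def partitions_of_def sum_list_replicate sorted_wrt_iff_nth_less nth_Cons'
      simp flip: One_nat_def)

lemma gamma2_partition: "1 \<le> k \<Longrightarrow> gamma2 k \<in> partitions_of (2 * k + 2)"
  by (auto simp: gamma2_def partitions_of_def sum_list_replicate sorted_wrt_iff_nth_less nth_Cons'
      simp flip: One_nat_def)

lemma diagram_gamma1: "diagram (gamma1 k) = {0} \<times> {..k} \<union> {..k} \<times> {0}"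
  by (auto simp: diagram_def gamma1_def nth_Cons' split: if_splits)

lemma diagram_gamma2:
  "1 \<le> k \<Longrightarrow> diagram (gamma2 k) = insert (1, 1) ({0} \<times> {..k} \<union> {..k} \<times> {0})"
  by (auto simp: diagram_def gamma2_def nth_Cons' split: if_splits)

lemma self_conjugate_gamma1: "self_conjugate (gamma1 k)"
  by (auto simp: self_conjugate_def diagram_gamma1)

lemma self_conjugate_gamma2: "1 \<le> k \<Longrightarrow> self_conjugate (gamma2 k)"
  by (auto simp: self_conjugate_def diagram_gamma2)

lemma principal_hooks_gamma1:
  assumes "1 \<le> k"
  shows "principal_hooks (gamma1 k) = [2 * k + 1]"
proof -
  have sub: "{..<s} \<times> {..<s} \<subseteq> diagram (gamma1 k) \<longleftrightarrow> s \<le> 1" for s :: nat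
  proof
    assume "{..<s} \<times> {..<s} \<subseteq> diagram (gamma1 k)"
    moreover have "(1, 1) \<notin> diagram (gamma1 k)"
      by (simp add: diagram_gamma1)
    ultimately have "(1, 1) \<notin> {..<s} \<times> {..<s}"
      by blast
    then show "s \<le> 1"
      by auto
  qed (auto simp: diagram_gamma1)
  have d: "durfee (gamma1 k) = 1"
    unfolding durfee_def sub by (rule Greatest_equality) auto
  have "hook (gamma1 k) 0 0 = Pair 0 ` {..k} \<union> (\<lambda>r. (r, 0)) ` {1..k}"
    by (auto simp: hook_def diagram_gamma1 image_iff)
  moreover have "card \<dots> = card (Pair (0::nat) ` {..k}) + card ((\<lambda>r. (r, 0::nat)) ` {1..k})"
    by (rule card_Un_disjoint) auto
  moreover have "\<dots> = 2 * k + 1"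
    by (simp add: card_image inj_on_def)
  ultimately show ?thesis
    by (simp add: principal_hooks_def d)
qed

lemma principal_hooks_gamma2:
  assumes "1 \<le> k"
  shows "principal_hooks (gamma2 k) = [2 * k + 1, 1]"
proof -
  have sub: "{..<s} \<times> {..<s} \<subseteq> diagram (gamma2 k) \<longleftrightarrow> s \<le> 2" for s :: nat
  proof
    assume "{..<s} \<times> {..<s} \<subseteq> diagram (gamma2 k)"
    moreover have "(2, 2) \<notin> diagram (gamma2 k)"
      using assms by (simp add: diagram_gamma2)
    ultimately have "(2, 2) \<notin> {..<s} \<times> {..<s}"
      by blast
    then show "s \<le> 2"
      by auto
  qed (use assms in \<open>auto simp: diagram_gamma2\<close>)
  have d: "durfee (gamma2 k) = 2"
    unfolding durfee_def sub by (rule Greatest_equality) auto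
  have "hook (gamma2 k) 0 0 = Pair 0 ` {..k} \<union> (\<lambda>r. (r, 0)) ` {1..k}"
    using assms by (auto simp: hook_def diagram_gamma2 image_iff)
  moreover have "card \<dots> = card (Pair (0::nat) ` {..k}) + card ((\<lambda>r. (r, 0::nat)) ` {1..k})"
    by (rule card_Un_disjoint) auto
  moreover have "\<dots> = 2 * k + 1"
    by (simp add: card_image inj_on_def)
  moreover have "hook (gamma2 k) 1 1 = {(1, 1)}"
    using assms by (auto simp: hook_def diagram_gamma2)
  ultimately show ?thesis
    by (simp add: principal_hooks_def d numeral_2_eq_2)
qed

end

theory Submission
  imports Defs
begin

text \<open>The upper bound on \<open>|B\<^sub>i|\<close> is a Bessel inequality: the irreducible characters are orthonormal and
  integral, so at most as many of them are nonzero at \<open>w\<close> as the centralizer of \<open>w\<close> has elements, and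
  the centralizer of a permutation of \<open>n\<close> points that contains a cycle of length at least \<open>n - 1\<close> has
  at most \<open>n\<close> elements.

  The lower bound on \<open>|A\<^sub>i|\<close> is quadratic in \<open>k\<close>. Restricted to the permutations of the \<open>2 k\<close> boxes of
  the arm and the leg of \<open>\<gamma>\<^sub>i\<close>, its Young symmetrizer is a matrix coefficient of the \<open>k\<close>-th exterior power
  of \<open>\<complex>\<^sup>2\<^sup>k\<close>. A product of two such coefficients belongs to a pair of \<open>k\<close>-subsets. For suitable pairs it
  has nonzero pairing with \<open>S T\<close>, where \<open>S\<close> is the symmetrizer of one set partition and \<open>T\<close> the
  antisymmetrizer of another one, because only permutations that fix both subsets contribute, and all
  of them with the same sign. By completeness of the characters, \<open>S T\<close> is nonzero on some constituent
  of the Kronecker square of \<open>\<gamma>\<^sub>i\<close>. Such a constituent has first row and first column bounded below by the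
  largest block of \<open>S\<close> and of \<open>T\<close>, and bounded above by the number of blocks of \<open>T\<close> and of \<open>S\<close>. Choosing the
  set partitions so that these bounds nearly agree prescribes row and column up to an additive
  constant, and quadratically many choices are possible.\<close>

section \<open>Convolution on the symmetric group\<close>

text \<open>Two different \<open>k\<close>-subsets are paired because each makes its coefficient
  alternating. A sign on their intersection enters twice and a sign on the complement of their union
  never, but on the symmetric difference a sign enters once. So a large symmetric block must avoid
  the symmetric difference, and a large alternating block can fill it. The obstacle is that a large
  block bounds a row or a column only from below. The two-element blocks merge the leftover points,
  so that each set partition has about as many blocks as the large block of the other one has
  points. They also enlarge both groups, and it has to be shown that no term of opposite sign arises
  from this.

  The representation theory is carried by Young symmetrizers: traces on Specht modules are
  identified with the normalized conjugation averages \<open>chi\<close>, and orthogonality,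
  positivity and nonvanishing become statements about convolution. Integrality is where bases of
  Specht modules return.\<close>

lemma Sym_id: "id \<in> Sym n"
  by (simp add: permutes_id)

lemma Sym_comp: "u \<in> Sym n \<Longrightarrow> v \<in> Sym n \<Longrightarrow> u \<circ> v \<in> Sym n"
  by (simp add: permutes_compose)

lemma Sym_inv: "u \<in> Sym n \<Longrightarrow> inv u \<in> Sym n"
  by (simp add: permutes_inv)

lemma finite_Sym: "finite (Sym n)"
  by (simp add: finite_permutations)

lemma Sym_inv_comp: "u \<in> Sym n \<Longrightarrow> v \<in> Sym n \<Longrightarrow> inv (u \<circ> v) = inv v \<circ> inv u"
  by (simp add: o_inv_distrib permutes_bij)

lemma Sym_inv_inv: "u \<in> Sym n \<Longrightarrow> inv (inv u) = u"
  by (simp add: permutes_inv_inv)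

lemma Sym_cancel:
  assumes "u \<in> Sym n"
  shows "inv u \<circ> u = id" "u \<circ> inv u = id"
    "inv u \<circ> (u \<circ> w) = w" "u \<circ> (inv u \<circ> w) = w"
    "w \<circ> u \<circ> inv u = w" "w \<circ> inv u \<circ> u = w"
    "inv u (u i) = i" "u (inv u i) = i"
  using assms permutes_inv_o[of u "{..<n}"] by (auto simp: fun_eq_iff permutes_inverses)

lemma Sym_comp_iff:
  assumes "u \<in> Sym n"
  shows "u \<circ> w \<in> Sym n \<longleftrightarrow> w \<in> Sym n" "w \<circ> u \<in> Sym n \<longleftrightarrow> w \<in> Sym n"
  using Sym_comp[OF Sym_inv[OF assms], of "u \<circ> w"] Sym_comp[OF _ Sym_inv[OF assms], of "w \<circ> u"]
    Sym_comp[OF assms, of w] Sym_comp[OF _ assms, of w] Sym_cancel[OF assms] by metis+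

lemma sum_Sym_inv: "(\<Sum>u\<in>Sym n. f (inv u)) = (\<Sum>u\<in>Sym n. f u)"
  by (rule sum_permutations_inverse[symmetric])

lemma sum_Sym_left: "a \<in> Sym n \<Longrightarrow> (\<Sum>u\<in>Sym n. f (a \<circ> u)) = (\<Sum>u\<in>Sym n. f u)"
  by (rule setum_permutations_compose_left[symmetric]) simp

lemma sum_Sym_right: "a \<in> Sym n \<Longrightarrow> (\<Sum>u\<in>Sym n. f (u \<circ> a)) = (\<Sum>u\<in>Sym n. f u)"
  by (rule sum_permutations_compose_right[symmetric]) simp

lemma conv_in_GA: "g \<in> group_algebra n \<Longrightarrow> conv n f g \<in> group_algebra n"
  by (auto simp: group_algebra_def conv_def Sym_comp_iff[OF Sym_inv, simplified]
      intro!: sum.neutral)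

lemma conv_assoc: "conv n (conv n f g) h = conv n f (conv n g h)"
proof
  fix w
  have "conv n (conv n f g) h w = (\<Sum>v\<in>Sym n. \<Sum>u\<in>Sym n. f v * g (inv v \<circ> u) * h (inv u \<circ> w))"
    unfolding conv_def by (subst sum.swap) (simp add: sum_distrib_right)
  also have "\<dots> = (\<Sum>v\<in>Sym n. \<Sum>u\<in>Sym n. f v * g u * h (inv u \<circ> (inv v \<circ> w)))"
  proof (rule sum.cong[OF refl])
    fix v assume v: "v \<in> Sym n"
    show "(\<Sum>u\<in>Sym n. f v * g (inv v \<circ> u) * h (inv u \<circ> w))
        = (\<Sum>u\<in>Sym n. f v * g u * h (inv u \<circ> (inv v \<circ> w)))"
      by (subst sum_Sym_left[OF v, symmetric], rule sum.cong[OF refl])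
        (simp add: Sym_cancel[OF v] Sym_inv_comp[OF v] o_assoc)
  qed
  also have "\<dots> = conv n f (conv n g h) w"
    by (simp add: conv_def sum_distrib_left mult.assoc)
  finally show "conv n (conv n f g) h w = conv n f (conv n g h) w" .
qed

lemma conv_alt: "w \<in> Sym n \<Longrightarrow> conv n f g w = (\<Sum>u\<in>Sym n. f (w \<circ> inv u) * g u)"
proof -
  assume w: "w \<in> Sym n"
  have "conv n f g w = (\<Sum>u\<in>Sym n. f (w \<circ> u) * g (inv (w \<circ> u) \<circ> w))"
    unfolding conv_def by (rule sum_Sym_left[OF w, symmetric])
  also have "\<dots> = (\<Sum>u\<in>Sym n. f (w \<circ> u) * g (inv u))"
    by (rule sum.cong[OF refl]) (simp add: Sym_inv_comp[OF w] Sym_cancel[OF w])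
  also have "\<dots> = (\<Sum>u\<in>Sym n. f (w \<circ> inv u) * g (inv (inv u)))"
    by (rule sum_Sym_inv[symmetric])
  finally show ?thesis
    by (simp add: Sym_inv_inv)
qed

lemma conv_id_commute: "conv n f g id = conv n g f id"
  by (subst conv_alt[OF Sym_id]) (simp add: conv_def mult.commute)

lemma conv_sum_right: "finite I \<Longrightarrow> conv n g (\<lambda>w. \<Sum>i\<in>I. f i w) w = (\<Sum>i\<in>I. conv n g (f i) w)"
  unfolding conv_def by (subst sum.swap) (simp add: sum_distrib_left)

lemma conv_scale_left: "conv n (\<lambda>w. a * f w) g w = a * conv n f g w"
  by (simp add: conv_def sum_distrib_left mult.assoc)

lemma conv_scale_right: "conv n g (\<lambda>w. a * f w) w = a * conv n g f w"
  by (simp add: conv_def sum_distrib_left mult.left_commute)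

lemma conv_zero_left: "conv n (\<lambda>w. 0) g = (\<lambda>w. 0)"
  by (simp add: conv_def fun_eq_iff)

lemma conv_zero_right: "conv n g (\<lambda>w. 0) = (\<lambda>w. 0)"
  by (simp add: conv_def fun_eq_iff)

definition single :: "(nat \<Rightarrow> nat) \<Rightarrow> (nat \<Rightarrow> nat) \<Rightarrow> complex" where
  "single u = (\<lambda>w. if w = u then 1 else 0)"

lemma single_in_GA: "u \<in> Sym n \<Longrightarrow> single u \<in> group_algebra n"
  by (auto simp: single_def group_algebra_def)

lemma conv_single_left:
  assumes "u \<in> Sym n"
  shows "conv n (single u) f w = f (inv u \<circ> w)"
proof -
  have "conv n (single u) f w = (\<Sum>v\<in>Sym n. if v = u then f (inv u \<circ> w) else 0)"
    unfolding conv_def single_def by (rule sum.cong) auto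
  then show ?thesis
    using assms finite_Sym by (simp add: sum.delta)
qed

lemma conv_single_right:
  assumes "u \<in> Sym n" "f \<in> group_algebra n"
  shows "conv n f (single u) w = f (w \<circ> inv u)"
proof (cases "w \<in> Sym n")
  case True
  have "conv n f (single u) w = (\<Sum>v\<in>Sym n. if v = u then f (w \<circ> inv u) else 0)"
    unfolding conv_alt[OF True] single_def by (rule sum.cong) auto
  then show ?thesis
    using assms finite_Sym by (simp add: sum.delta)
next
  case False
  then have "w \<circ> inv u \<notin> Sym n"
    using Sym_comp_iff(2)[OF Sym_inv[OF assms(1)]] by simp
  moreover have "conv n f (single u) w = 0"
    using conv_in_GA[OF single_in_GA[OF assms(1)], of f] False by (auto simp: group_algebra_def)
  ultimately show ?thesis
    using assms(2) by (auto simp: group_algebra_def)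
qed

lemma GA_expand: "x \<in> group_algebra n \<Longrightarrow> x w = (\<Sum>u\<in>Sym n. x u * single u w)"
  using finite_Sym by (auto simp: single_def group_algebra_def if_distrib sum.delta' cong: if_cong)

section \<open>Conjugation averages and class functions\<close>

definition average :: "nat \<Rightarrow> ((nat \<Rightarrow> nat) \<Rightarrow> complex) \<Rightarrow> (nat \<Rightarrow> nat) \<Rightarrow> complex" where
  "average n f w = (\<Sum>g\<in>Sym n. f (inv g \<circ> w \<circ> g))"

definition class_fun :: "nat \<Rightarrow> ((nat \<Rightarrow> nat) \<Rightarrow> complex) \<Rightarrow> bool" where
  "class_fun n f \<longleftrightarrow> f \<in> group_algebra n \<and> (\<forall>g\<in>Sym n. \<forall>w. f (inv g \<circ> w \<circ> g) = f w)"

lemma class_funD: "class_fun n f \<Longrightarrow> g \<in> Sym n \<Longrightarrow> f (inv g \<circ> w \<circ> g) = f w"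
  by (simp add: class_fun_def)

lemma class_fun_rotate:
  assumes "class_fun n f" "g \<in> Sym n"
  shows "f (w \<circ> g) = f (g \<circ> w)"
  using class_funD[OF assms, of "g \<circ> w"] by (simp add: o_assoc Sym_cancel[OF assms(2)])

lemma class_fun_average:
  assumes "f \<in> group_algebra n"
  shows "class_fun n (average n f)"
  unfolding class_fun_def
proof (intro conjI ballI allI)
  have "f (inv g \<circ> w \<circ> g) = 0" if "w \<notin> Sym n" "g \<in> Sym n" for w g
    using that assms Sym_comp_iff(1)[OF Sym_inv[OF that(2)], of w] Sym_comp_iff(2)[OF that(2), of "inv g \<circ> w"]
    by (auto simp: group_algebra_def)
  then show "average n f \<in> group_algebra n"
    unfolding group_algebra_def average_def by (blast intro: sum.neutral)
next
  fix g w assume g: "g \<in> Sym n"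
  have "average n f (inv g \<circ> w \<circ> g) = (\<Sum>h\<in>Sym n. f (inv (g \<circ> h) \<circ> w \<circ> (g \<circ> h)))"
    unfolding average_def by (rule sum.cong[OF refl]) (simp add: Sym_inv_comp[OF g] o_assoc)
  also have "\<dots> = average n f w"
    unfolding average_def by (rule sum_Sym_left[OF g])
  finally show "average n f (inv g \<circ> w \<circ> g) = average n f w" .
qed

text \<open>The trace property: replacing the conjugator h by \<open>h \<circ> u\<close>, for each
  fixed u, moves the last factor to the front. It allows row and column factors to be exchanged
  inside \<open>chi\<close>.\<close>

lemma average_conv_commute:
  assumes "f \<in> group_algebra n" "g \<in> group_algebra n"
  shows "average n (conv n f g) = average n (conv n g f)"
proof
  fix w
  show "average n (conv n f g) w = average n (conv n g f) w"
  proof (cases "w \<in> Sym n")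
    case w: True
    have "average n (conv n f g) w = (\<Sum>h\<in>Sym n. \<Sum>u\<in>Sym n. f (inv h \<circ> w \<circ> h \<circ> inv u) * g u)"
      unfolding average_def
      by (rule sum.cong[OF refl], rule conv_alt) (intro Sym_comp Sym_inv w)
    also have "\<dots> = (\<Sum>u\<in>Sym n. \<Sum>h\<in>Sym n. f (inv h \<circ> w \<circ> h \<circ> inv u) * g u)"
      by (rule sum.swap)
    also have "\<dots> = (\<Sum>u\<in>Sym n. \<Sum>h\<in>Sym n. f (inv u \<circ> (inv h \<circ> w \<circ> h)) * g u)"
    proof (rule sum.cong[OF refl])
      fix u assume u: "u \<in> Sym n"
      show "(\<Sum>h\<in>Sym n. f (inv h \<circ> w \<circ> h \<circ> inv u) * g u) = (\<Sum>h\<in>Sym n. f (inv u \<circ> (inv h \<circ> w \<circ> h)) * g u)"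
        by (subst sum_Sym_right[OF u, symmetric], rule sum.cong[OF refl])
          (simp add: Sym_inv_comp[OF _ u] o_assoc Sym_cancel[OF u])
    qed
    also have "\<dots> = average n (conv n g f) w"
      unfolding average_def conv_def by (subst sum.swap) (simp add: mult.commute)
    finally show ?thesis .
  next
    case False
    then show ?thesis
      using class_fun_average[OF conv_in_GA[OF assms(1)]] class_fun_average[OF conv_in_GA[OF assms(2)]]
      unfolding class_fun_def group_algebra_def by (metis (mono_tags, lifting) mem_Collect_eq)
  qed
qed

lemma class_fun_conv_commute:
  assumes "class_fun n f" "h \<in> group_algebra n"
  shows "conv n f h = conv n h f"
proof
  fix w
  have f: "f \<in> group_algebra n"
    using assms(1) by (simp add: class_fun_def)
  show "conv n f h w = conv n h f w"
  proof (cases "w \<in> Sym n")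
    case True
    show ?thesis
      unfolding conv_alt[OF True, of f] conv_def[of n h]
      by (rule sum.cong[OF refl]) (simp only: class_fun_rotate[OF assms(1) Sym_inv] mult.commute)
  next
    case False
    then show ?thesis
      using conv_in_GA[OF f, of h] conv_in_GA[OF assms(2), of f] by (simp add: group_algebra_def)
  qed
qed

lemma conv_average:
  assumes "class_fun n h"
  shows "conv n h (average n f) = average n (conv n h f)"
proof
  fix w
  have "conv n h (average n f) w = (\<Sum>g\<in>Sym n. \<Sum>u\<in>Sym n. h u * f (inv g \<circ> (inv u \<circ> w) \<circ> g))"
    unfolding conv_def average_def by (subst sum.swap) (simp add: sum_distrib_left)
  also have "\<dots> = (\<Sum>g\<in>Sym n. \<Sum>u\<in>Sym n. h u * f (inv u \<circ> (inv g \<circ> w \<circ> g)))"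
  proof (rule sum.cong[OF refl])
    fix g assume g: "g \<in> Sym n"
    have "(\<Sum>u\<in>Sym n. h u * f (inv g \<circ> (inv u \<circ> w) \<circ> g))
        = (\<Sum>u\<in>Sym n. h (g \<circ> u \<circ> inv g) * f (inv g \<circ> (inv (g \<circ> u \<circ> inv g) \<circ> w) \<circ> g))"
      by (subst sum_Sym_right[OF Sym_inv[OF g], symmetric], subst sum_Sym_left[OF g, symmetric]) (simp add: o_assoc)
    also have "\<dots> = (\<Sum>u\<in>Sym n. h u * f (inv u \<circ> (inv g \<circ> w \<circ> g)))"
    proof (rule sum.cong[OF refl])
      fix u assume u: "u \<in> Sym n"
      have "h (g \<circ> u \<circ> inv g) = h u"
        using class_funD[OF assms Sym_inv[OF g], of u] by (simp add: Sym_inv_inv[OF g])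
      moreover have "inv (g \<circ> u \<circ> inv g) = g \<circ> inv u \<circ> inv g"
        by (simp add: Sym_inv_comp[OF Sym_comp[OF g u] Sym_inv[OF g]] Sym_inv_comp[OF g u] Sym_inv_inv[OF g] o_assoc)
      ultimately show "h (g \<circ> u \<circ> inv g) * f (inv g \<circ> (inv (g \<circ> u \<circ> inv g) \<circ> w) \<circ> g)
          = h u * f (inv u \<circ> (inv g \<circ> w \<circ> g))"
        by (simp add: o_assoc Sym_cancel[OF g])
    qed
    finally show "(\<Sum>u\<in>Sym n. h u * f (inv g \<circ> (inv u \<circ> w) \<circ> g))
      = (\<Sum>u\<in>Sym n. h u * f (inv u \<circ> (inv g \<circ> w \<circ> g)))" .
  qed
  also have "\<dots> = average n (conv n h f) w"
    by (simp add: conv_def average_def)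
  finally show "conv n h (average n f) w = average n (conv n h f) w" .
qed

text \<open>The product as a sum of g f g^-1 h over all g. Orthogonality makes every summand vanish;
  the row and column bounds extract a nonvanishing one.\<close>

lemma conv_average_left:
  "conv n (average n f) h w = (\<Sum>g\<in>Sym n. conv n f (conv n (single (inv g)) h) (inv g \<circ> w))"
proof -
  have "conv n (average n f) h w = (\<Sum>g\<in>Sym n. \<Sum>u\<in>Sym n. f (inv g \<circ> u \<circ> g) * h (inv u \<circ> w))"
    unfolding conv_def average_def by (subst sum.swap) (simp add: sum_distrib_right)
  also have "\<dots> = (\<Sum>g\<in>Sym n. conv n f (conv n (single (inv g)) h) (inv g \<circ> w))"
  proof (rule sum.cong[OF refl])
    fix g assume g: "g \<in> Sym n"
    have "(\<Sum>u\<in>Sym n. f (inv g \<circ> u \<circ> g) * h (inv u \<circ> w))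
        = (\<Sum>u\<in>Sym n. f (inv g \<circ> (g \<circ> u \<circ> inv g) \<circ> g) * h (inv (g \<circ> u \<circ> inv g) \<circ> w))"
      by (subst sum_Sym_right[OF Sym_inv[OF g], symmetric], subst sum_Sym_left[OF g, symmetric]) (simp add: o_assoc)
    also have "\<dots> = (\<Sum>u\<in>Sym n. f u * h (inv (inv g) \<circ> (inv u \<circ> (inv g \<circ> w))))"
    proof (rule sum.cong[OF refl])
      fix u assume u: "u \<in> Sym n"
      have "inv (g \<circ> u \<circ> inv g) = g \<circ> inv u \<circ> inv g"
        by (simp add: Sym_inv_comp[OF Sym_comp[OF g u] Sym_inv[OF g]] Sym_inv_comp[OF g u] Sym_inv_inv[OF g] o_assoc)
      then show "f (inv g \<circ> (g \<circ> u \<circ> inv g) \<circ> g) * h (inv (g \<circ> u \<circ> inv g) \<circ> w)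
          = f u * h (inv (inv g) \<circ> (inv u \<circ> (inv g \<circ> w)))"
        by (simp add: o_assoc Sym_cancel[OF g] Sym_inv_inv[OF g])
    qed
    also have "\<dots> = conv n f (conv n (single (inv g)) h) (inv g \<circ> w)"
      by (simp add: conv_def[of n f] conv_single_left[OF Sym_inv[OF g]])
    finally show "(\<Sum>u\<in>Sym n. f (inv g \<circ> u \<circ> g) * h (inv u \<circ> w))
        = conv n f (conv n (single (inv g)) h) (inv g \<circ> w)" .
  qed
  finally show ?thesis .
qed

section \<open>Young subgroups\<close>

text \<open>A set partition is encoded by the fibres of a labelling, so that rows, columns and the
  set partitions of the final construction are treated alike.\<close>

definition young :: "nat \<Rightarrow> (nat \<Rightarrow> 'a) \<Rightarrow> (nat \<Rightarrow> nat) set" where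
  "young n f = {w \<in> Sym n. \<forall>i<n. f (w i) = f i}"

definition young_sum :: "nat \<Rightarrow> (nat \<Rightarrow> 'a) \<Rightarrow> (nat \<Rightarrow> nat) \<Rightarrow> complex" where
  "young_sum n f w = (if w \<in> young n f then 1 else 0)"

definition young_alt :: "nat \<Rightarrow> (nat \<Rightarrow> 'a) \<Rightarrow> (nat \<Rightarrow> nat) \<Rightarrow> complex" where
  "young_alt n f w = (if w \<in> young n f then of_int (sign w) else 0)"

lemma Sym_lt: "w \<in> Sym n \<Longrightarrow> w i < n \<longleftrightarrow> i < n"
  using permutes_in_image[of w "{..<n}" i] by simp

lemma young_Sym: "w \<in> young n f \<Longrightarrow> w \<in> Sym n"
  by (simp add: young_def)

lemma young_id: "id \<in> young n f"
  by (simp add: young_def permutes_id)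

lemma young_comp: "u \<in> young n f \<Longrightarrow> v \<in> young n f \<Longrightarrow> u \<circ> v \<in> young n f"
  using Sym_comp[of u n v] Sym_lt[of v n] by (auto simp: young_def)

lemma young_inv: "u \<in> young n f \<Longrightarrow> inv u \<in> young n f"
  using Sym_inv[of u n] Sym_lt[of "inv u" n] Sym_cancel(8)[of u n] unfolding young_def
  by simp metis

lemma young_comp_iff:
  assumes "u \<in> young n f"
  shows "u \<circ> w \<in> young n f \<longleftrightarrow> w \<in> young n f" "w \<circ> u \<in> young n f \<longleftrightarrow> w \<in> young n f"
  using young_comp[OF young_inv[OF assms], of "u \<circ> w"] young_comp[OF _ young_inv[OF assms], of "w \<circ> u"]
    young_comp[OF assms, of w] young_comp[OF _ assms, of w] Sym_cancel[OF young_Sym[OF assms]] by metis+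

lemma young_inv_iff: "u \<in> Sym n \<Longrightarrow> inv u \<in> young n f \<longleftrightarrow> u \<in> young n f"
  using young_inv[of "inv u" n f] young_inv[of u n f] Sym_inv_inv[of u n] by auto

lemma transpose_young: "i < n \<Longrightarrow> j < n \<Longrightarrow> f i = f j \<Longrightarrow> transpose i j \<in> young n f"
  by (auto simp: young_def permutes_swap_id transpose_def)

lemma sign_comp: "u \<in> Sym n \<Longrightarrow> v \<in> Sym n \<Longrightarrow> sign (u \<circ> v) = sign u * sign v"
  by (intro sign_compose permutes_imp_permutation[of "{..<n}"]) auto

lemma sign_inv: "u \<in> Sym n \<Longrightarrow> sign (inv u) = sign u"
  by (intro sign_inverse permutes_imp_permutation[of "{..<n}"]) auto

lemma young_sum_in_GA: "young_sum n f \<in> group_algebra n"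
  by (auto simp: young_sum_def group_algebra_def young_def)

lemma young_alt_in_GA: "young_alt n f \<in> group_algebra n"
  by (auto simp: young_alt_def group_algebra_def young_def)

text \<open>The symmetries of a product with a symmetrizer on the left and an antisymmetrizer on the
  right. For rows and columns they determine the Young symmetrizer up to a scalar.\<close>

definition biinv :: "nat \<Rightarrow> (nat \<Rightarrow> 'a) \<Rightarrow> (nat \<Rightarrow> 'b) \<Rightarrow> ((nat \<Rightarrow> nat) \<Rightarrow> complex) \<Rightarrow> bool" where
  "biinv n f h z \<longleftrightarrow> (\<forall>p\<in>young n f. \<forall>w. z (p \<circ> w) = z w) \<and>
     (\<forall>q\<in>young n h. \<forall>w. z (w \<circ> q) = of_int (sign q) * z w)"

lemma biinv_conv: "biinv n f h (conv n (young_sum n f) (conv n x (young_alt n h)))"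
  unfolding biinv_def
proof (intro conjI ballI allI)
  fix p w assume p: "p \<in> young n f"
  show "conv n (young_sum n f) (conv n x (young_alt n h)) (p \<circ> w) = conv n (young_sum n f) (conv n x (young_alt n h)) w"
    unfolding conv_def[of n "young_sum n f"]
    by (subst sum_Sym_left[OF young_Sym[OF p], symmetric], rule sum.cong[OF refl])
      (simp add: Sym_inv_comp[OF young_Sym[OF p]] young_sum_def young_comp_iff[OF p] o_assoc
        Sym_cancel[OF young_Sym[OF p]])
next
  fix q w assume q: "q \<in> young n h"
  have "young_alt n h (v \<circ> q) = of_int (sign q) * young_alt n h v" for v
    using young_comp_iff(2)[OF q, of v] sign_comp[OF _ young_Sym[OF q], of v] young_Sym[of v n h]
    by (auto simp: young_alt_def)
  then have "conv n y (young_alt n h) (w \<circ> q) = of_int (sign q) * conv n y (young_alt n h) w" for y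
    by (simp add: conv_def o_assoc sum_distrib_left algebra_simps)
  then show "conv n (young_sum n f) (conv n x (young_alt n h)) (w \<circ> q)
      = of_int (sign q) * conv n (young_sum n f) (conv n x (young_alt n h)) w"
    by (simp flip: conv_assoc)
qed

text \<open>Two points in a common block of \<open>f\<close> that \<open>inv y\<close> sends into a common block of \<open>h\<close> yield a
  transposition on which both invariance properties of \<open>z\<close> apply, and they give \<open>z y = - z y\<close>.\<close>

lemma biinv_nonzero_imp_inj:
  assumes z: "biinv n f h z" and y: "y \<in> Sym n" "z y \<noteq> 0"
  shows "inj_on (\<lambda>i. (f i, h (inv y i))) {..<n}"
proof (rule inj_onI, rule ccontr)
  fix i j assume ij: "i \<in> {..<n}" "j \<in> {..<n}" "i \<noteq> j"
    and eq: "(f i, h (inv y i)) = (f j, h (inv y j))"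
  let ?t = "transpose i j" and ?s = "transpose (inv y i) (inv y j)"
  have "?t \<in> young n f" "?s \<in> young n h"
    using ij eq Sym_lt[OF Sym_inv[OF y(1)]] by (auto intro!: transpose_young)
  moreover have "?t \<circ> y = y \<circ> ?s"
  proof
    fix a
    show "(?t \<circ> y) a = (y \<circ> ?s) a"
      using Sym_cancel(7,8)[OF y(1)] by (auto simp: transpose_def)
  qed
  moreover have "inv y i \<noteq> inv y j"
    using ij Sym_cancel(8)[OF y(1)] by metis
  ultimately have "z y = - z y"
    using z unfolding biinv_def by (metis mult_minus1 of_int_1 of_int_minus sign_swap_id)
  then show False
    using y by simp
qed

text \<open>Turns nonvanishing into combinatorics: each block of \<open>f\<close> meets the image
  under y of each block of \<open>h\<close> in at most one point. Orthogonality and the shape bounds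
  start from here.\<close>

lemma conv_sum_alt_nonzero:
  assumes "conv n (young_sum n f) (conv n x (young_alt n h)) \<noteq> (\<lambda>w. 0)"
  obtains y where "y \<in> Sym n" "inj_on (\<lambda>i. (f i, h (inv y i))) {..<n}"
proof -
  obtain y where y: "conv n (young_sum n f) (conv n x (young_alt n h)) y \<noteq> 0"
    using assms by auto
  moreover have "y \<in> Sym n"
    using y conv_in_GA[OF conv_in_GA[OF young_alt_in_GA]] unfolding group_algebra_def by blast
  ultimately show ?thesis
    using that biinv_nonzero_imp_inj[OF biinv_conv] by blast
qed

section \<open>Inversion as an anti-automorphism\<close>

definition flip :: "nat \<Rightarrow> ((nat \<Rightarrow> nat) \<Rightarrow> complex) \<Rightarrow> (nat \<Rightarrow> nat) \<Rightarrow> complex" where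
  "flip n f w = (if w \<in> Sym n then f (inv w) else 0)"

lemma flip_in_GA: "flip n f \<in> group_algebra n"
  by (simp add: flip_def group_algebra_def)

lemma flip_flip: "f \<in> group_algebra n \<Longrightarrow> flip n (flip n f) = f"
  by (auto simp: flip_def group_algebra_def fun_eq_iff permutes_inv permutes_inv_inv)

lemma flip_zero: "flip n (\<lambda>w. 0) = (\<lambda>w. 0)"
  by (simp add: flip_def fun_eq_iff)

lemma flip_young_sum: "flip n (young_sum n f) = young_sum n f"
  using young_inv_iff[of _ n f] young_Sym[of _ n f] by (auto simp: flip_def young_sum_def fun_eq_iff)

lemma flip_young_alt: "flip n (young_alt n f) = young_alt n f"
  using young_inv_iff[of _ n f] young_Sym[of _ n f] sign_inv[of _ n]
  by (auto simp: flip_def young_alt_def fun_eq_iff)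

lemma flip_conv: "flip n (conv n f g) = conv n (flip n g) (flip n f)"
proof
  fix w
  show "flip n (conv n f g) w = conv n (flip n g) (flip n f) w"
  proof (cases "w \<in> Sym n")
    case w: True
    have "conv n f g (inv w) = (\<Sum>u\<in>Sym n. f (inv w \<circ> inv u) * g u)"
      by (rule conv_alt[OF Sym_inv[OF w]])
    also have "\<dots> = (\<Sum>u\<in>Sym n. f (inv w \<circ> u) * g (inv u))"
      by (subst sum_Sym_inv[symmetric]) (simp add: Sym_inv_inv)
    also have "\<dots> = conv n (flip n g) (flip n f) w"
      unfolding conv_def
      by (rule sum.cong[OF refl])
        (use w in \<open>simp add: flip_def Sym_inv_comp[OF Sym_inv w] Sym_inv_inv[simplified]
          Sym_comp[OF Sym_inv w, simplified] Sym_inv[simplified] Sym_inv_comp[OF Sym_inv w, simplified]\<close>)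
    finally show ?thesis
      using w by (simp add: flip_def)
  next
    case False
    then show ?thesis
      using conv_in_GA[OF flip_in_GA, of n "flip n g" f] by (simp add: flip_def group_algebra_def)
  qed
qed

text \<open>Inversion reverses products and fixes \<open>young_sum\<close> and
  \<open>young_alt\<close>, so this order of factors reduces to the other one with
  \<open>flip n x\<close> in the middle.\<close>

lemma conv_alt_sum_nonzero:
  assumes "x \<in> group_algebra n" "conv n (young_alt n h) (conv n x (young_sum n f)) \<noteq> (\<lambda>w. 0)"
  obtains y where "y \<in> Sym n" "inj_on (\<lambda>i. (f i, h (inv y i))) {..<n}"
proof (rule conv_sum_alt_nonzero)
  let ?z = "conv n (young_alt n h) (conv n x (young_sum n f))"
  have z: "?z \<in> group_algebra n"
    by (intro conv_in_GA young_sum_in_GA)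
  have "flip n ?z = conv n (young_sum n f) (conv n (flip n x) (young_alt n h))"
    by (simp add: flip_conv flip_young_sum flip_young_alt conv_assoc)
  moreover have "flip n ?z \<noteq> (\<lambda>w. 0)"
    using flip_flip[OF z] flip_zero assms(2) by metis
  ultimately show "conv n (young_sum n f) (conv n (flip n x) (young_alt n h)) \<noteq> (\<lambda>w. 0)"
    by simp
qed (use that in blast)

section \<open>Rows and columns of the row-reading tableau\<close>

lemma bij_betw_tableau: "bij_betw (tableau xs) (diagram xs) {..<sum_list xs}"
proof (induction xs rule: rev_induct)
  case Nil
  then show ?case by (simp add: diagram_def bij_betw_def)
next
  case (snoc a xs)
  have 1: "bij_betw (tableau (xs @ [a])) (diagram xs) {..<sum_list xs}"
    by (rule iffD1[OF bij_betw_cong snoc.IH]) (auto simp: tableau_def diagram_def)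
  have 2: "bij_betw (tableau (xs @ [a])) ({length xs} \<times> {..<a}) {sum_list xs..<sum_list xs + a}"
    by (rule bij_betw_byWitness[where f' = "\<lambda>i. (length xs, i - sum_list xs)"])
      (auto simp: tableau_def)
  have "diagram (xs @ [a]) = diagram xs \<union> {length xs} \<times> {..<a}"
    by (auto simp: diagram_def nth_append less_Suc_eq split: if_splits)
  moreover have "{..<sum_list (xs @ [a])} = {..<sum_list xs} \<union> {sum_list xs..<sum_list xs + a}"
    by auto
  moreover have "{..<sum_list xs} \<inter> {sum_list xs..<sum_list xs + a} = {}"
    by auto
  ultimately show ?case
    using bij_betw_combine[OF 1 2] by simp
qed

text \<open>Rows and columns are functions of the entries instead of the boxes, which makes them
  labellings for \<open>young\<close>.\<close>

definition row :: "nat list \<Rightarrow> nat \<Rightarrow> nat" where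
  "row xs i = fst (inv_into (diagram xs) (tableau xs) i)"

definition col :: "nat list \<Rightarrow> nat \<Rightarrow> nat" where
  "col xs i = snd (inv_into (diagram xs) (tableau xs) i)"

lemma row_col_tableau: "b \<in> diagram xs \<Longrightarrow> row xs (tableau xs b) = fst b \<and> col xs (tableau xs b) = snd b"
  using bij_betw_tableau[of xs] by (simp add: row_def col_def bij_betw_def)

lemma tableau_lt: "b \<in> diagram xs \<Longrightarrow> tableau xs b < sum_list xs"
  using bij_betw_tableau[of xs] by (auto simp: bij_betw_def)

lemma tableau_row_col:
  assumes "i < sum_list xs"
  shows "(row xs i, col xs i) \<in> diagram xs" "tableau xs (row xs i, col xs i) = i"
  using assms bij_betw_tableau[of xs]
  by (auto simp: row_def col_def bij_betw_def inv_into_into f_inv_into_f)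

lemma row_lt: "i < sum_list xs \<Longrightarrow> row xs i < length xs"
  and col_lt: "i < sum_list xs \<Longrightarrow> col xs i < xs ! row xs i"
  using tableau_row_col(1)[of i xs] by (auto simp: diagram_def)

lemma row_col_inj: "i < sum_list xs \<Longrightarrow> j < sum_list xs \<Longrightarrow> row xs i = row xs j \<Longrightarrow> col xs i = col xs j \<Longrightarrow> i = j"
  using tableau_row_col(2) by metis

lemma card_row_col: "card {i. i < sum_list xs \<and> P (row xs i) (col xs i)} = card {(r, c) \<in> diagram xs. P r c}"
proof -
  have "bij_betw (tableau xs) {(r, c) \<in> diagram xs. P r c} {i. i < sum_list xs \<and> P (row xs i) (col xs i)}"
    by (rule bij_betw_byWitness[where f' = "\<lambda>i. (row xs i, col xs i)"])
      (auto simp: row_col_tableau tableau_row_col tableau_lt)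
  then show ?thesis
    by (simp add: bij_betw_same_card)
qed

lemma card_row_col_less:
  "r < length xs \<Longrightarrow> card {i. i < sum_list xs \<and> row xs i = r \<and> col xs i < c} = min (xs ! r) c"
proof -
  assume r: "r < length xs"
  have "{(r', c') \<in> diagram xs. r' = r \<and> c' < c} = {r} \<times> {..<min (xs ! r) c}"
    using r by (auto simp: diagram_def)
  then show ?thesis
    using card_row_col[of xs "\<lambda>r' c'. r' = r \<and> c' < c"] by simp
qed

lemma row_group_eq: "row_group xs = young (sum_list xs) (row xs)"
  and column_group_eq: "column_group xs = young (sum_list xs) (col xs)"
proof -
  have img: "tableau xs ` {b \<in> diagram xs. P b} = {i. i < sum_list xs \<and> P (row xs i, col xs i)}" for P
    by (auto simp: row_col_tableau tableau_lt)
      (metis (mono_tags, lifting) image_eqI mem_Collect_eq tableau_row_col)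
  have main: "{w \<in> Sym n. \<forall>r. w ` {i. i < n \<and> f i = r} = {i. i < n \<and> f i = r}} = young n f"
    for n and f :: "nat \<Rightarrow> nat"
  proof (intro equalityI subsetI)
    fix w assume "w \<in> {w \<in> Sym n. \<forall>r. w ` {i. i < n \<and> f i = r} = {i. i < n \<and> f i = r}}"
    then show "w \<in> young n f"
      unfolding young_def by blast
  next
    fix w assume w: "w \<in> young n f"
    have "w ` {i. i < n \<and> f i = r} = {i. i < n \<and> f i = r}" for r
    proof (rule endo_inj_surj)
      show "w ` {i. i < n \<and> f i = r} \<subseteq> {i. i < n \<and> f i = r}"
        using w Sym_lt[of w n] by (auto simp: young_def)
      show "inj_on w {i. i < n \<and> f i = r}"
        using w permutes_inj by (auto simp: young_def intro: inj_on_subset)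
    qed simp
    then show "w \<in> {w \<in> Sym n. \<forall>r. w ` {i. i < n \<and> f i = r} = {i. i < n \<and> f i = r}}"
      using w by (simp add: young_def)
  qed
  show "row_group xs = young (sum_list xs) (row xs)"
    "column_group xs = young (sum_list xs) (col xs)"
    unfolding row_group_def column_group_def img fst_conv snd_conv main by simp_all
qed

lemma young_symmetrizer_eq:
  "young_symmetrizer xs = conv (sum_list xs) (young_sum (sum_list xs) (row xs)) (young_alt (sum_list xs) (col xs))"
  unfolding young_symmetrizer_def row_symmetrizer_def column_antisymmetrizer_def
    row_group_eq column_group_eq young_sum_def[abs_def] young_alt_def[abs_def] ..

section \<open>Labellings that are injective along rows, and dominance\<close>

lemma card_fibres:
  assumes "finite A" "finite R" "f ` A \<subseteq> R"
  shows "card A = (\<Sum>r\<in>R. card {i \<in> A. f i = r})"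
  using sum.group[OF assms, of "\<lambda>i. 1::nat"] by simp

lemma card_label_row_le:
  assumes inj: "inj_on (\<lambda>i. (row xs i, g i)) {..<sum_list xs}" and r: "r < length xs"
  shows "card {i. i < sum_list xs \<and> row xs i = r \<and> g i < (c::nat)} \<le> min (xs ! r) c"
proof -
  let ?A = "{i. i < sum_list xs \<and> row xs i = r \<and> g i < c}"
  have "card ?A \<le> card {..<c}"
    by (rule card_inj_on_le[of g]) (use inj in \<open>auto simp: inj_on_def\<close>)
  moreover have "card ?A \<le> card {i. i < sum_list xs \<and> row xs i = r \<and> col xs i < xs ! r}"
    by (rule card_mono) (auto dest: col_lt)
  ultimately show ?thesis
    using card_row_col_less[OF r, of "xs ! r"] by simp
qed

lemma card_label_eq_sum_rows:
  "card {i. i < sum_list xs \<and> g i < c} = (\<Sum>r<length xs. card {i. i < sum_list xs \<and> row xs i = r \<and> g i < c})"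
proof -
  have "row xs ` {i. i < sum_list xs \<and> g i < c} \<subseteq> {..<length xs}"
    by (auto simp: row_lt)
  then show ?thesis
    using card_fibres[of "{i. i < sum_list xs \<and> g i < c}" "{..<length xs}" "row xs"] by (simp add: conj_ac)
qed

text \<open>Labels in one row are distinct, so at most the minimum of c and the row length lie below
  c, and \<open>col\<close> attains this bound in every row. This is the dominance order on
  partitions, in terms of column counts.\<close>

lemma card_label_le:
  assumes "inj_on (\<lambda>i. (row xs i, g i)) {..<sum_list xs}"
  shows "card {i. i < sum_list xs \<and> g i < (c::nat)} \<le> card {i. i < sum_list xs \<and> col xs i < c}"
  unfolding card_label_eq_sum_rows
  by (rule sum_mono) (use card_label_row_le[OF assms] card_row_col_less in simp)

text \<open>In each row at most as many labels as column indices are below \<open>c\<close>, so equality of the totals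
  forces equality in each row.\<close>

lemma label_lt:
  assumes inj: "inj_on (\<lambda>i. (row xs i, g i)) {..<sum_list xs}"
    and eq: "\<And>c. card {i. i < sum_list xs \<and> g i < c} = card {i. i < sum_list xs \<and> col xs i < c}"
    and i: "i < sum_list xs"
  shows "g i < xs ! row xs i"
proof -
  let ?r = "row xs i"
  let ?A = "{i. i < sum_list xs \<and> row xs i = ?r \<and> g i < xs ! ?r}"
  let ?B = "{i. i < sum_list xs \<and> row xs i = ?r}"
  have "?r < length xs"
    by (rule row_lt[OF i])
  have "card {i. i < sum_list xs \<and> row xs i = r \<and> g i < c} = min (xs ! r) c" if "r < length xs" for r c
  proof (rule ccontr)
    assume "card {i. i < sum_list xs \<and> row xs i = r \<and> g i < c} \<noteq> min (xs ! r) c"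
    with card_label_row_le[OF inj that, of c]
    have less: "card {i. i < sum_list xs \<and> row xs i = r \<and> g i < c} < min (xs ! r) c"
      by (rule order.not_eq_order_implies_strict[rotated])
    have "(\<Sum>r<length xs. card {i. i < sum_list xs \<and> row xs i = r \<and> g i < c})
      < (\<Sum>r<length xs. min (xs ! r) c)"
      by (rule sum_strict_mono_ex1) (use card_label_row_le[OF inj] less that in auto)
    then show False
      using eq[of c] card_label_eq_sum_rows[of xs g c] card_label_eq_sum_rows[of xs "col xs" c]
        card_row_col_less by simp
  qed
  then have "card ?A = xs ! ?r"
    using \<open>?r < length xs\<close> by simp
  moreover have "?B = {i. i < sum_list xs \<and> row xs i = ?r \<and> col xs i < xs ! ?r}"
    by (auto dest: col_lt)
  then have "card ?B = xs ! ?r"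
    using card_row_col_less[OF \<open>?r < length xs\<close>, of "xs ! ?r"] by simp
  ultimately have "?A = ?B"
    by (intro card_subset_eq) auto
  then show ?thesis
    using i by blast
qed

lemma card_inv_label:
  assumes "w \<in> Sym n"
  shows "card {i. i < n \<and> P (inv w i)} = card {i. i < n \<and> P i}"
proof (rule bij_betw_same_card)
  show "bij_betw (inv w) {i. i < n \<and> P (inv w i)} {i. i < n \<and> P i}"
    by (rule bij_betw_byWitness[where f' = w])
      (use Sym_cancel(7,8)[OF assms] Sym_lt[OF assms] Sym_lt[OF Sym_inv[OF assms]] in auto)
qed

text \<open>The classical sorting argument: rearranging each row so that every entry reaches the
  column prescribed by \<open>w\<close> leaves only a permutation within columns.\<close>

lemma inj_imp_row_col_product:
  assumes w: "w \<in> Sym (sum_list xs)"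
    and inj: "inj_on (\<lambda>i. (row xs i, col xs (inv w i))) {..<sum_list xs}"
  obtains p q where "p \<in> young (sum_list xs) (row xs)" "q \<in> young (sum_list xs) (col xs)" "w = p \<circ> q"
proof -
  let ?n = "sum_list xs"
  \<comment> \<open>\<open>s\<close> moves i within its row to the column of \<open>inv w i\<close>;
    \<open>label_lt\<close> keeps the target inside the diagram. Hence \<open>s\<close> preserves
    rows and \<open>s \<circ> w\<close> preserves columns.\<close>
  define s where "s i = (if i < ?n then tableau xs (row xs i, col xs (inv w i)) else i)" for i
  have D: "(row xs i, col xs (inv w i)) \<in> diagram xs" if "i < ?n" for i
    using label_lt[OF inj card_inv_label[OF w] that] row_lt[OF that] by (simp add: diagram_def)
  have s: "row xs (s i) = row xs i" "col xs (s i) = col xs (inv w i)" "s i < ?n" if "i < ?n" for i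
    using row_col_tableau[OF D[OF that]] tableau_lt[OF D[OF that]] that by (auto simp: s_def)
  have "inj_on s {..<?n}"
  proof (rule inj_onI)
    fix i j assume "i \<in> {..<?n}" "j \<in> {..<?n}" "s i = s j"
    then show "i = j"
      using s(1,2)[of i] s(1,2)[of j] by (intro inj_onD[OF inj]) auto
  qed
  then have "s permutes {..<?n}"
    by (intro inj_imp_permutes) (use s(3) in \<open>auto simp: s_def\<close>)
  then have S: "s \<in> Sym ?n"
    by simp
  have "s \<in> young ?n (row xs)"
    using S s by (simp add: young_def)
  then have "inv s \<in> young ?n (row xs)"
    by (rule young_inv)
  moreover have "s \<circ> w \<in> young ?n (col xs)"
    using Sym_comp[OF S w] s Sym_lt[OF w] Sym_cancel(7)[OF w] by (auto simp: young_def)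
  moreover have "w = inv s \<circ> (s \<circ> w)"
    by (simp only: Sym_cancel[OF S])
  ultimately show ?thesis
    using that by blast
qed

section \<open>Values of the Young symmetrizer and the sandwich property\<close>

lemma row_col_young_Int: "young (sum_list xs) (row xs) \<inter> young (sum_list xs) (col xs) = {id}"
proof -
  have "w = id" if "w \<in> young (sum_list xs) (row xs)" "w \<in> young (sum_list xs) (col xs)" for w
  proof
    fix i
    have "w \<in> Sym (sum_list xs)"
      using that(1) by (rule young_Sym)
    then show "w i = id i"
      using that row_col_inj[of "w i" xs i] Sym_lt[of w "sum_list xs" i]
      by (cases "i < sum_list xs") (auto simp: young_def permutes_not_in)
  qed
  then show ?thesis
    using young_id by blast
qed

lemma young_symmetrizer_biinv: "biinv (sum_list xs) (row xs) (col xs) (young_symmetrizer xs)"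
proof -
  have "conv (sum_list xs) (single id) (young_alt (sum_list xs) (col xs)) = young_alt (sum_list xs) (col xs)"
    by (simp add: fun_eq_iff conv_single_left permutes_id)
  then show ?thesis
    using biinv_conv[of "sum_list xs" "row xs" "col xs" "single id"] by (simp add: young_symmetrizer_eq)
qed

lemma young_symmetrizer_in_GA: "young_symmetrizer xs \<in> group_algebra (sum_list xs)"
  unfolding young_symmetrizer_eq by (intro conv_in_GA young_alt_in_GA)

text \<open>Only u = \<open>id\<close> contributes, since a permutation preserving all rows and all
  columns is trivial. Scalars are read off at \<open>id\<close> from now on.\<close>

lemma young_symmetrizer_id: "young_symmetrizer xs id = 1"
proof -
  let ?n = "sum_list xs"
  have "young_symmetrizer xs id = (\<Sum>u\<in>Sym ?n. if u = id then 1 else 0)"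
    unfolding young_symmetrizer_eq conv_def
  proof (rule sum.cong[OF refl])
    fix u assume u: "u \<in> Sym ?n"
    then show "young_sum ?n (row xs) u * young_alt ?n (col xs) (inv u \<circ> id) = (if u = id then 1 else 0)"
      using row_col_young_Int[of xs] young_inv_iff[OF u, of "col xs"] young_id[of ?n "col xs"] young_id[of ?n "row xs"]
      by (auto simp: young_sum_def young_alt_def)
  qed
  then show ?thesis
    using finite_Sym Sym_id by (simp add: sum.delta)
qed

lemma biinv_product:
  assumes "biinv n f h z" "p \<in> young n f" "q \<in> young n h"
  shows "z (p \<circ> q) = of_int (sign q) * z id"
proof -
  have "z (p \<circ> q) = z (id \<circ> q)"
    using assms unfolding biinv_def id_o by blast
  also have "\<dots> = of_int (sign q) * z id"
    using assms unfolding biinv_def by blast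
  finally show ?thesis .
qed

lemma young_symmetrizer_product:
  assumes "p \<in> young (sum_list xs) (row xs)" "q \<in> young (sum_list xs) (col xs)"
  shows "young_symmetrizer xs (p \<circ> q) = of_int (sign q)"
  using biinv_product[OF young_symmetrizer_biinv assms] by (simp add: young_symmetrizer_id)

lemma young_symmetrizer_nonzero_imp:
  assumes "young_symmetrizer xs w \<noteq> 0"
  obtains p q where "p \<in> young (sum_list xs) (row xs)" "q \<in> young (sum_list xs) (col xs)" "w = p \<circ> q"
proof -
  have w: "w \<in> Sym (sum_list xs)"
    using assms young_symmetrizer_in_GA[of xs] unfolding group_algebra_def by blast
  show ?thesis
    by (rule inj_imp_row_col_product[OF w biinv_nonzero_imp_inj[OF young_symmetrizer_biinv w assms]])
      (rule that)
qed

text \<open>On products of row and column permutations the value is determined by the one at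
  \<open>id\<close>; elsewhere a nonzero value would force such a factorization. So these functions
  form a line.\<close>

lemma biinv_eq_young_symmetrizer:
  assumes z: "biinv (sum_list xs) (row xs) (col xs) z" "z \<in> group_algebra (sum_list xs)"
  shows "z = (\<lambda>w. z id * young_symmetrizer xs w)"
proof
  fix w
  show "z w = z id * young_symmetrizer xs w"
  proof (cases "\<exists>p\<in>young (sum_list xs) (row xs). \<exists>q\<in>young (sum_list xs) (col xs). w = p \<circ> q")
    case True
    then show ?thesis
      using biinv_product[OF z(1)] young_symmetrizer_product by auto
  next
    case no: False
    then have "young_symmetrizer xs w = 0"
      by (auto elim: young_symmetrizer_nonzero_imp)
    moreover have "z w = 0"
    proof (rule ccontr)
      assume nz: "z w \<noteq> 0"
      then have w: "w \<in> Sym (sum_list xs)"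
        using z(2) unfolding group_algebra_def by blast
      show False
        by (rule inj_imp_row_col_product[OF w biinv_nonzero_imp_inj[OF z(1) w nz]]) (use no in blast)
    qed
    ultimately show ?thesis
      by simp
  qed
qed

text \<open>Regrouping c x c as row symmetrizer, middle, column antisymmetrizer shows that it lies
  on the line spanned by c. This plays the role of Schur's lemma.\<close>

lemma young_symmetrizer_sandwich:
  fixes xs
  defines "n \<equiv> sum_list xs" and "c \<equiv> young_symmetrizer xs"
  shows "conv n c (conv n x c) = (\<lambda>w. conv n c (conv n x c) id * c w)"
proof -
  have "conv n c (conv n x c) = conv n (young_sum n (row xs)) (conv n (conv n (young_alt n (col xs)) (conv n x (young_sum n (row xs)))) (young_alt n (col xs)))"
    by (simp add: c_def n_def young_symmetrizer_eq conv_assoc)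
  then have "biinv n (row xs) (col xs) (conv n c (conv n x c))"
    by (simp add: biinv_conv)
  moreover have "conv n c (conv n x c) \<in> group_algebra n"
    unfolding n_def c_def by (intro conv_in_GA young_symmetrizer_in_GA)
  ultimately show ?thesis
    using biinv_eq_young_symmetrizer[of xs "conv n c (conv n x c)"] by (simp add: n_def c_def)
qed

section \<open>Characters as averages of Young symmetrizers\<close>

text \<open>The scalar in c c = kappa c. By \<open>chi_id\<close> it is n! divided by the dimension
  of the Specht module.\<close>

definition kappa :: "nat list \<Rightarrow> complex" where
  "kappa xs = conv (sum_list xs) (young_symmetrizer xs) (young_symmetrizer xs) id"

text \<open>The quotient of c by \<open>kappa\<close> is an idempotent generating the Specht module.
  The trace of w on the left ideal of an idempotent e is the sum of e over all conjugates of the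
  inverse of w, which is this formula up to inversion.\<close>

definition chi :: "nat list \<Rightarrow> (nat \<Rightarrow> nat) \<Rightarrow> complex" where
  "chi xs w = average (sum_list xs) (young_symmetrizer xs) w / kappa xs"

lemma conv_single_id: "conv n (single id) f = f"
  by (simp add: fun_eq_iff conv_single_left permutes_id)

lemma conv_young_symmetrizer_self:
  "conv (sum_list xs) (young_symmetrizer xs) (young_symmetrizer xs) = (\<lambda>w. kappa xs * young_symmetrizer xs w)"
  using young_symmetrizer_sandwich[of xs "single id"] by (simp add: conv_single_id kappa_def)

lemma young_sum_Ints: "young_sum n f w \<in> \<int>"
  by (simp add: young_sum_def)

lemma young_alt_Ints: "young_alt n f w \<in> \<int>"
  by (simp add: young_alt_def)

lemma conv_Ints: "(\<And>w. f w \<in> \<int>) \<Longrightarrow> (\<And>w. g w \<in> \<int>) \<Longrightarrow> conv n f g w \<in> \<int>"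
  unfolding conv_def by (intro Ints_sum Ints_mult)

lemma young_symmetrizer_Ints: "young_symmetrizer xs w \<in> \<int>"
  unfolding young_symmetrizer_eq by (intro conv_Ints young_sum_Ints young_alt_Ints)

lemma conv_young_sum_absorb:
  assumes "biinv n f h z"
  shows "conv n (young_sum n f) z = (\<lambda>w. of_nat (card (young n f)) * z w)"
proof
  fix w
  have "conv n (young_sum n f) z w = (\<Sum>u\<in>Sym n. if u \<in> young n f then z w else 0)"
    unfolding conv_def
    by (rule sum.cong[OF refl]) (use assms young_inv[of _ n f] in \<open>auto simp: young_sum_def biinv_def\<close>)
  also have "\<dots> = (\<Sum>u\<in>Sym n \<inter> young n f. z w)"
    by (rule sum.inter_restrict[OF finite_Sym, symmetric])
  also have "Sym n \<inter> young n f = young n f"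
    using young_Sym by blast
  finally show "conv n (young_sum n f) z w = of_nat (card (young n f)) * z w"
    by simp
qed

lemma sum_real_squares:
  fixes a :: "'a \<Rightarrow> complex"
  assumes "\<And>w. a w \<in> \<real>"
  shows "(\<Sum>w\<in>A. a w * a w) = of_real (\<Sum>w\<in>A. (Re (a w))\<^sup>2)"
proof -
  have "a w * a w = of_real ((Re (a w))\<^sup>2)" for w
    using assms[of w] by (metis of_real_Re of_real_power power2_eq_square)
  then show ?thesis
    by simp
qed

lemma card_young_pos: "card (young n f) > 0"
proof -
  have "finite (young n f)"
    by (rule finite_subset[OF _ finite_Sym]) (auto simp: young_def)
  then show ?thesis
    using young_id by (auto simp: card_gt_0_iff)
qed

text \<open>With \<open>R\<close> and \<open>C\<close> the two factors of \<open>c = R C\<close>, the element \<open>R C R\<close> is real and fixed by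
  inversion, so the coefficient of its square at the identity is a positive sum of squares; that
  coefficient is a positive multiple of \<open>kappa\<close>.\<close>

lemma kappa_pos: "kappa xs \<in> \<real>" "Re (kappa xs) > 0"
proof -
  let ?n = "sum_list xs" and ?c = "young_symmetrizer xs"
  let ?R = "young_sum ?n (row xs)" and ?C = "young_alt ?n (col xs)"
  let ?N = "card (young ?n (row xs))"
  define a where "a = conv ?n ?c ?R"
  have int: "a w \<in> \<int>" for w
    unfolding a_def by (intro conv_Ints young_symmetrizer_Ints young_sum_Ints)
  then have real: "a w \<in> \<real>" for w
    by (metis Ints_cases Reals_of_int)
  have fl: "flip ?n a = a"
    by (simp add: a_def young_symmetrizer_eq flip_conv flip_young_sum flip_young_alt conv_assoc)
  have Rc: "conv ?n ?R ?c = (\<lambda>w. of_nat ?N * ?c w)"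
    by (rule conv_young_sum_absorb[OF young_symmetrizer_biinv])
  have a_id: "a id = of_nat ?N"
    unfolding a_def conv_id_commute[of _ ?c] Rc by (simp add: young_symmetrizer_id)
  have "conv ?n a a = conv ?n ?c (conv ?n (conv ?n ?R ?c) ?R)"
    by (simp add: a_def conv_assoc)
  also have "\<dots> = (\<lambda>w. of_nat ?N * conv ?n (conv ?n ?c ?c) ?R w)"
    by (simp add: Rc conv_scale_left[abs_def] conv_scale_right[abs_def] conv_assoc)
  also have "\<dots> = (\<lambda>w. of_nat ?N * kappa xs * a w)"
    by (simp add: conv_young_symmetrizer_self conv_scale_left[abs_def] a_def mult.assoc)
  finally have "conv ?n a a id = of_nat (?N * ?N) * kappa xs"
    by (simp add: a_id)
  moreover have "conv ?n a a id = (\<Sum>w\<in>Sym ?n. a w * a w)"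
    unfolding conv_def by (rule sum.cong[OF refl]) (use fl in \<open>auto simp: flip_def fun_eq_iff split: if_splits\<close>)
  moreover have "(\<Sum>w\<in>Sym ?n. a w * a w) = of_real (\<Sum>w\<in>Sym ?n. (Re (a w))\<^sup>2)"
    by (rule sum_real_squares[OF real])
  ultimately have eq: "of_nat (?N * ?N) * kappa xs = of_real (\<Sum>w\<in>Sym ?n. (Re (a w))\<^sup>2)"
    by simp
  have N: "?N > 0"
    by (rule card_young_pos)
  have "kappa xs = of_real ((\<Sum>w\<in>Sym ?n. (Re (a w))\<^sup>2) / of_nat (?N * ?N))"
    using eq N by (simp add: field_simps)
  moreover have "(\<Sum>w\<in>Sym ?n. (Re (a w))\<^sup>2) > 0"
    by (rule sum_pos2[OF finite_Sym Sym_id]) (use a_id N in auto)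
  ultimately show "kappa xs \<in> \<real>" "Re (kappa xs) > 0"
    using N by (auto simp del: of_nat_mult of_real_sum of_real_divide)
qed

lemma kappa_nonzero: "kappa xs \<noteq> 0"
  using kappa_pos(2)[of xs] by auto

lemma average_young_symmetrizer: "average (sum_list xs) (young_symmetrizer xs) = (\<lambda>w. kappa xs * chi xs w)"
  by (simp add: chi_def kappa_nonzero fun_eq_iff)

lemma chi_class_fun: "class_fun (sum_list xs) (chi xs)"
  using class_fun_average[OF young_symmetrizer_in_GA[of xs]]
  by (simp add: class_fun_def chi_def group_algebra_def)

lemma chi_Reals: "chi xs w \<in> \<real>"
proof -
  have "young_symmetrizer xs u \<in> \<real>" for u
    using young_symmetrizer_Ints[of xs u] by (metis Ints_cases Reals_of_int)
  then show ?thesis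
    unfolding chi_def average_def by (intro Reals_divide sum_in_Reals kappa_pos(1))
qed

lemma flip_average:
  assumes "f \<in> group_algebra n"
  shows "flip n (average n f) = average n (flip n f)"
proof
  fix w
  show "flip n (average n f) w = average n (flip n f) w"
  proof (cases "w \<in> Sym n")
    case w: True
    have "inv g \<circ> inv w \<circ> g = inv (inv g \<circ> w \<circ> g)" "inv g \<circ> w \<circ> g \<in> Sym n" if g: "g \<in> Sym n" for g
      using Sym_inv_comp[OF Sym_comp[OF Sym_inv[OF g] w] g] Sym_inv_comp[OF Sym_inv[OF g] w]
        Sym_comp[OF Sym_comp[OF Sym_inv[OF g] w] g]
      by (simp_all add: Sym_inv_inv[OF g] o_assoc)
    then show ?thesis
      using w by (simp add: average_def flip_def)
  next
    case False
    then show ?thesis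
      using class_fun_average[OF flip_in_GA[of n f]] by (simp add: flip_def class_fun_def group_algebra_def)
  qed
qed

text \<open>Inversion swaps the row and column factors of the Young symmetrizer, and the average
  does not depend on their order.\<close>

lemma flip_chi: "flip (sum_list xs) (chi xs) = chi xs"
proof -
  let ?n = "sum_list xs"
  have "flip ?n (average ?n (young_symmetrizer xs)) = average ?n (young_symmetrizer xs)"
    unfolding flip_average[OF young_symmetrizer_in_GA] unfolding young_symmetrizer_eq
    by (simp add: flip_conv flip_young_sum flip_young_alt
        average_conv_commute[OF young_sum_in_GA young_alt_in_GA])
  from fun_cong[OF this] show ?thesis
    by (intro ext) (simp add: chi_def flip_def split: if_splits, metis div_0)
qed

lemma chi_inv: "w \<in> Sym (sum_list xs) \<Longrightarrow> chi xs (inv w) = chi xs w"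
  using fun_cong[OF flip_chi, of xs w] by (simp add: flip_def)

text \<open>The central element K multiplies c by a scalar, by the sandwich property. At
  \<open>id\<close> each conjugator g contributes kappa c(g^-1) c(g), and these products sum to
  kappa once more.\<close>

lemma conv_chi_young_symmetrizer:
  "conv (sum_list xs) (chi xs) (young_symmetrizer xs) = (\<lambda>w. kappa xs * young_symmetrizer xs w)"
proof -
  let ?n = "sum_list xs" and ?c = "young_symmetrizer xs"
  let ?K = "average ?n ?c"
  have cent: "conv ?n ?K ?c = conv ?n ?c ?K"
    by (rule class_fun_conv_commute[OF class_fun_average]) (rule young_symmetrizer_in_GA)+
  \<comment> \<open>The left side is the coefficient of c g c at g. By the sandwich property c g c
    is a multiple of c, with scalar kappa c(g^-1).\<close>
  have twist: "(\<Sum>w\<in>Sym ?n. ?c w * ?c (inv g \<circ> inv w \<circ> g)) = kappa xs * (?c (inv g) * ?c g)"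
    if g: "g \<in> Sym ?n" for g
  proof -
    have "conv ?n ?c (conv ?n (single g) ?c) id = conv ?n (single g) (conv ?n ?c ?c) id"
      by (subst conv_id_commute) (simp add: conv_assoc)
    also have "\<dots> = kappa xs * ?c (inv g)"
      by (simp add: conv_single_left[OF g] conv_young_symmetrizer_self)
    finally have "conv ?n ?c (conv ?n (single g) ?c) = (\<lambda>w. kappa xs * ?c (inv g) * ?c w)"
      by (subst young_symmetrizer_sandwich) simp
    from fun_cong[OF this, of g] show ?thesis
      by (simp add: conv_def[of ?n ?c] conv_single_left[OF g] o_assoc mult.assoc)
  qed
  have "conv ?n ?K ?c id = conv ?n ?c ?K id"
    by (rule conv_id_commute)
  also have "\<dots> = (\<Sum>g\<in>Sym ?n. \<Sum>w\<in>Sym ?n. ?c w * ?c (inv g \<circ> inv w \<circ> g))"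
    unfolding conv_def average_def by (subst sum.swap) (simp add: sum_distrib_left)
  also have "\<dots> = kappa xs * conv ?n ?c ?c id"
    by (simp add: twist conv_def sum_distrib_left mult.commute)
  finally have id: "conv ?n ?K ?c id = kappa xs * kappa xs"
    by (simp add: kappa_def)
  \<comment> \<open>An additional factor c is created from c c = kappa c, so that centrality of K
    yields a product of the form c y c.\<close>
  have "(\<lambda>w. kappa xs * conv ?n ?K ?c w) = conv ?n ?K (conv ?n ?c ?c)"
    by (simp add: conv_young_symmetrizer_self conv_scale_right[abs_def])
  also have "\<dots> = conv ?n ?c (conv ?n ?K ?c)"
    by (subst conv_assoc[symmetric], subst cent, rule conv_assoc)
  also have "\<dots> = (\<lambda>w. conv ?n ?c (conv ?n ?K ?c) id * ?c w)"
    by (rule young_symmetrizer_sandwich)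
  also have "conv ?n ?c (conv ?n ?K ?c) id = kappa xs * conv ?n ?K ?c id"
    by (subst conv_id_commute) (simp add: conv_assoc conv_young_symmetrizer_self conv_scale_right)
  finally have "conv ?n ?K ?c w = kappa xs * kappa xs * ?c w" for w
    using kappa_nonzero[of xs] id by (simp add: fun_eq_iff)
  then show ?thesis
    by (simp add: average_young_symmetrizer conv_scale_left kappa_nonzero fun_eq_iff)
qed

lemma conv_chi_self: "conv (sum_list xs) (chi xs) (chi xs) = (\<lambda>w. kappa xs * chi xs w)"
proof -
  let ?n = "sum_list xs"
  have "(\<lambda>w. kappa xs * conv ?n (chi xs) (chi xs) w) = conv ?n (chi xs) (average ?n (young_symmetrizer xs))"
    by (simp add: average_young_symmetrizer conv_scale_right[abs_def])
  also have "\<dots> = average ?n (\<lambda>w. kappa xs * young_symmetrizer xs w)"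
    by (simp add: conv_average[OF chi_class_fun] conv_chi_young_symmetrizer)
  also have "\<dots> = (\<lambda>w. kappa xs * (kappa xs * chi xs w))"
    by (simp add: average_def[abs_def] average_young_symmetrizer[unfolded average_def[abs_def], THEN fun_cong]
        flip: sum_distrib_left)
  finally show ?thesis
    by (simp add: kappa_nonzero fun_eq_iff)
qed

section \<open>Orthogonality\<close>

lemma card_col: "card {i. i < sum_list xs \<and> col xs i = c} = length (filter (\<lambda>a. c < a) xs)"
proof -
  have "{(r, c') \<in> diagram xs. c' = c} = {i. i < length xs \<and> c < xs ! i} \<times> {c}"
    by (auto simp: diagram_def)
  then show ?thesis
    using card_row_col[of xs "\<lambda>r c'. c' = c"] by (simp add: length_filter_conv_card card_cartesian_product)
qed

lemma card_col_Suc: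
  "card {i. i < sum_list xs \<and> col xs i < Suc c} =
   card {i. i < sum_list xs \<and> col xs i < c} + length (filter (\<lambda>a. c < a) xs)"
proof -
  have "{i. i < sum_list xs \<and> col xs i < Suc c}
      = {i. i < sum_list xs \<and> col xs i < c} \<union> {i. i < sum_list xs \<and> col xs i = c}"
    by auto
  then show ?thesis
    unfolding card_col[symmetric] by (simp add: card_Un_disjoint disjoint_iff)
qed

text \<open>Differences of consecutive counts are the column lengths, and differences of consecutive
  column lengths are the multiplicities of the parts.\<close>

lemma partition_eqI:
  assumes xs: "xs \<in> partitions_of n" and ys: "ys \<in> partitions_of n"
    and eq: "\<And>c. card {i. i < n \<and> col xs i < c} = card {i. i < n \<and> col ys i < c}"
  shows "xs = ys"
proof -
  have n: "sum_list xs = n" "sum_list ys = n"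
    using xs ys by (auto simp: partitions_of_def)
  have len: "length (filter (\<lambda>a. c < a) xs) = length (filter (\<lambda>a. c < a) ys)" for c
    using eq[of c] eq[of "Suc c"] card_col_Suc[of xs c] card_col_Suc[of ys c] by (simp add: n)
  have cnt: "length (filter (\<lambda>a. c < a) zs) = length (filter (\<lambda>a. Suc c < a) zs) + count (mset zs) (Suc c)"
    for c zs
    by (induction zs) (auto simp: Suc_lessI)
  have "mset xs = mset ys"
  proof (rule multiset_eqI)
    fix a
    show "count (mset xs) a = count (mset ys) a"
    proof (cases a)
      case 0
      then show ?thesis
        using xs ys by (simp add: partitions_of_def count_mset_0_iff[THEN iffD2])
    next
      case (Suc c)
      then show ?thesis
        using cnt[of c xs] cnt[of c ys] len[of c] len[of "Suc c"] by simp
    qed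
  qed
  moreover have "sorted (rev xs)" "sorted (rev ys)"
    using xs ys by (simp_all add: partitions_of_def sorted_wrt_rev)
  ultimately have "rev xs = rev ys"
    by (metis mset_rev properties_for_sort)
  then show ?thesis
    by simp
qed

text \<open>A nonzero product yields one dominance relation from its outer factors and the opposite
  one from its inner factors.\<close>

lemma young_symmetrizer_orthogonal:
  assumes xs: "xs \<in> partitions_of n" and ys: "ys \<in> partitions_of n" and "xs \<noteq> ys"
    and x: "x \<in> group_algebra n"
  shows "conv n (young_symmetrizer xs) (conv n x (young_symmetrizer ys)) = (\<lambda>w. 0)"
proof (rule ccontr)
  have n: "sum_list xs = n" "sum_list ys = n"
    using xs ys by (auto simp: partitions_of_def)
  let ?y = "conv n (young_alt n (col xs)) (conv n x (young_sum n (row ys)))"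
  assume "\<not> ?thesis"
  then have nz: "conv n (young_sum n (row xs)) (conv n ?y (young_alt n (col ys))) \<noteq> (\<lambda>w. 0)"
    by (simp add: young_symmetrizer_eq n conv_assoc)
  then obtain u where u: "u \<in> Sym n" "inj_on (\<lambda>i. (row xs i, col ys (inv u i))) {..<n}"
    by (rule conv_sum_alt_nonzero)
  have le1: "card {i. i < n \<and> col ys i < c} \<le> card {i. i < n \<and> col xs i < c}" for c
    using card_label_le[of xs "\<lambda>i. col ys (inv u i)" c] u card_inv_label[OF u(1), of "\<lambda>i. col ys i < c"]
    by (simp add: n)
  have "?y \<noteq> (\<lambda>w. 0)"
    using nz by (auto simp: conv_zero_left conv_zero_right)
  then obtain v where v: "v \<in> Sym n" "inj_on (\<lambda>i. (row ys i, col xs (inv v i))) {..<n}"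
    using conv_alt_sum_nonzero[OF x] by blast
  have "card {i. i < n \<and> col xs i < c} \<le> card {i. i < n \<and> col ys i < c}" for c
    using card_label_le[of ys "\<lambda>i. col xs (inv v i)" c] v card_inv_label[OF v(1), of "\<lambda>i. col xs i < c"]
    by (simp add: n)
  then show False
    using partition_eqI[OF xs ys] le1 \<open>xs \<noteq> ys\<close> by (simp add: order.antisym)
qed

lemma conv_chi_orthogonal:
  assumes xs: "xs \<in> partitions_of n" and ys: "ys \<in> partitions_of n" and "xs \<noteq> ys"
  shows "conv n (chi xs) (chi ys) = (\<lambda>w. 0)"
proof -
  have n: "sum_list xs = n" "sum_list ys = n"
    using xs ys by (auto simp: partitions_of_def)
  let ?c = "young_symmetrizer xs" and ?d = "young_symmetrizer ys"
  have "conv n (average n ?c) ?d w = 0" for w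
  proof -
    show ?thesis
      unfolding conv_average_left
      by (simp add: young_symmetrizer_orthogonal[OF xs ys \<open>xs \<noteq> ys\<close> single_in_GA[OF Sym_inv]])
  qed
  then have 0: "conv n (chi xs) ?d = (\<lambda>w. 0)"
    using average_young_symmetrizer[of xs] kappa_nonzero[of xs] by (intro ext) (simp add: n conv_scale_left)
  have "(\<lambda>w. kappa ys * conv n (chi xs) (chi ys) w) = conv n (chi xs) (average n ?d)"
    using average_young_symmetrizer[of ys] by (simp add: n conv_scale_right[abs_def])
  also have "\<dots> = (\<lambda>w. 0)"
    using conv_average[OF chi_class_fun[of xs], of ?d] 0 by (simp add: n average_def[abs_def])
  finally show ?thesis
    by (simp add: kappa_nonzero fun_eq_iff)
qed

lemma chi_id: "kappa xs * chi xs id = fact (sum_list xs)"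
proof -
  have "average (sum_list xs) (young_symmetrizer xs) id = (\<Sum>g\<in>Sym (sum_list xs). 1)"
    unfolding average_def
    by (rule sum.cong[OF refl]) (simp only: o_id Sym_cancel young_symmetrizer_id)
  then show ?thesis
    by (simp add: average_young_symmetrizer card_permutations)
qed

lemma conv_id_chi: "sum_list xs = n \<Longrightarrow> conv n f (chi xs) id = (\<Sum>w\<in>Sym n. f w * chi xs w)"
  unfolding conv_def by (rule sum.cong[OF refl]) (simp add: chi_inv)

lemma chi_orthonormal:
  assumes xs: "xs \<in> partitions_of n" and ys: "ys \<in> partitions_of n"
  shows "(\<Sum>w\<in>Sym n. chi xs w * chi ys w) = (if xs = ys then fact n else 0)"
proof -
  have n: "sum_list xs = n" "sum_list ys = n"
    using xs ys by (auto simp: partitions_of_def)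
  show ?thesis
    using conv_chi_orthogonal[OF xs ys] conv_chi_self[of xs] chi_id[of xs]
    by (auto simp: n fun_eq_iff simp flip: conv_id_chi[OF n(2)])
qed

section \<open>Traces on Specht modules\<close>

lemma sum_apply: "(\<Sum>i\<in>I. f i) x = (\<Sum>i\<in>I. (f i x :: 'b :: comm_monoid_add))"
  by (induction I rule: infinite_finite_induct) auto

text \<open>The right side is the trace of f -> sum of f(g) y_g in the basis of point functions.
  Since all y_g lie in the span of \<open>B\<close>, the trace on that subspace is the same.\<close>

lemma trace_formula:
  assumes B: "fspace.independent B" "finite B"
    and y: "\<And>g. g \<in> G \<Longrightarrow> y g \<in> fspace.span B"
    and T: "\<And>b. b \<in> B \<Longrightarrow> T b = (\<Sum>g\<in>G. fscale (b g) (y g))"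
  shows "(\<Sum>b\<in>B. fspace.representation B (T b) b) = (\<Sum>g\<in>G. y g g)"
proof -
  have "(\<Sum>b\<in>B. fspace.representation B (T b) b) = (\<Sum>b\<in>B. \<Sum>g\<in>G. b g * fspace.representation B (y g) b)"
  proof (rule sum.cong[OF refl])
    fix b assume b: "b \<in> B"
    show "fspace.representation B (T b) b = (\<Sum>g\<in>G. b g * fspace.representation B (y g) b)"
      unfolding T[OF b]
      by (subst fspace.representation_sum[OF B(1)])
        (auto intro!: fspace.span_scale y simp: fspace.representation_scale[OF B(1) y])
  qed
  also have "\<dots> = (\<Sum>g\<in>G. (\<Sum>b\<in>B. fscale (fspace.representation B (y g) b) b) g)"
    by (subst sum.swap) (simp add: sum_apply fscale_def mult.commute)
  also have "\<dots> = (\<Sum>g\<in>G. y g g)"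
    by (rule sum.cong[OF refl], subst fspace.sum_representation_eq[OF B(1)]) (use B y in auto)
  finally show ?thesis .
qed

lemma GA_subset_span: "group_algebra n \<subseteq> fspace.span (single ` Sym n)"
proof
  fix x assume x: "x \<in> group_algebra n"
  have "x = (\<Sum>u\<in>Sym n. fscale (x u) (single u))"
    by (rule ext) (simp add: sum_apply fscale_def flip: GA_expand[OF x])
  also have "\<dots> \<in> fspace.span (single ` Sym n)"
    by (intro fspace.span_sum fspace.span_scale fspace.span_base imageI)
  finally show "x \<in> fspace.span (single ` Sym n)" .
qed

lemma finite_basis_GA: "fspace.independent B \<Longrightarrow> B \<subseteq> group_algebra n \<Longrightarrow> finite B"
  using fspace.independent_span_bound[of "single ` Sym n" B] GA_subset_span[of n] finite_Sym
  by blast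

lemma specht_subset_GA: "specht xs \<subseteq> group_algebra (sum_list xs)"
  unfolding specht_def using conv_in_GA[OF young_symmetrizer_in_GA] by blast

lemma subspace_GA: "fspace.subspace (group_algebra n)"
  unfolding fspace.subspace_def by (auto simp: group_algebra_def fscale_def)

lemma conv_in_specht: "x \<in> group_algebra (sum_list xs) \<Longrightarrow> conv (sum_list xs) x (young_symmetrizer xs) \<in> specht xs"
  unfolding specht_def by blast

lemma specht_absorb:
  assumes "x \<in> specht xs"
  shows "conv (sum_list xs) x (young_symmetrizer xs) = (\<lambda>w. kappa xs * x w)"
  using assms unfolding specht_def
  by (auto simp: conv_assoc conv_young_symmetrizer_self conv_scale_right)

text \<open>The ideal is the eigenspace of right multiplication by the Young symmetrizer for the
  eigenvalue \<open>kappa xs\<close>, which is nonzero. Closure properties become immediate.\<close>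

lemma specht_iff:
  "x \<in> specht xs \<longleftrightarrow> x \<in> group_algebra (sum_list xs) \<and>
     conv (sum_list xs) x (young_symmetrizer xs) = (\<lambda>w. kappa xs * x w)"
proof
  assume x: "x \<in> group_algebra (sum_list xs) \<and>
     conv (sum_list xs) x (young_symmetrizer xs) = (\<lambda>w. kappa xs * x w)"
  then have "x = conv (sum_list xs) (\<lambda>w. inverse (kappa xs) * x w) (young_symmetrizer xs)"
    by (simp add: conv_scale_left kappa_nonzero fun_eq_iff)
  also have "\<dots> \<in> specht xs"
    by (rule conv_in_specht) (use x in \<open>auto simp: group_algebra_def\<close>)
  finally show "x \<in> specht xs" .
qed (use specht_absorb specht_subset_GA in blast)

lemma conv_add_left: "conv n (\<lambda>w. f w + g w) h = (\<lambda>w. conv n f h w + conv n g h w)"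
  by (simp add: conv_def sum.distrib algebra_simps)

lemma subspace_specht: "fspace.subspace (specht xs)"
  unfolding fspace.subspace_def
proof (intro conjI ballI allI)
  show "0 \<in> specht xs"
    using fspace.subspace_0[OF subspace_GA] by (simp add: specht_iff zero_fun_def conv_zero_left)
next
  fix x y assume "x \<in> specht xs" "y \<in> specht xs"
  then show "x + y \<in> specht xs"
    using fspace.subspace_add[OF subspace_GA, of x _ y]
    by (simp add: specht_iff plus_fun_def conv_add_left distrib_left)
next
  fix a x assume "x \<in> specht xs"
  then show "fscale a x \<in> specht xs"
    using fspace.subspace_scale[OF subspace_GA, of x _ a]
    by (simp add: specht_iff fscale_def conv_scale_left[abs_def] mult.left_commute)
qed

text \<open>On the Specht module w b = w b c / kappa, so the action expands with coefficients b(g)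
  in the translates of c / kappa by \<open>w \<circ> g\<close>, as \<open>trace_formula\<close>
  requires.\<close>

lemma trace_act_eq_chi:
  assumes B: "fspace.independent B" "fspace.span B = specht xs" and w: "w \<in> Sym (sum_list xs)"
  shows "(\<Sum>b\<in>B. fspace.representation B (act w b) b) = chi xs w"
proof -
  let ?n = "sum_list xs"
  define y where "y g = (\<lambda>u. young_symmetrizer xs (inv g \<circ> inv w \<circ> u) / kappa xs)" for g
  have BV: "B \<subseteq> specht xs"
    using B(2) fspace.span_superset by blast
  have fin: "finite B"
    by (rule finite_basis_GA[OF B(1)]) (use BV specht_subset_GA in blast)
  have yV: "y g \<in> fspace.span B" if g: "g \<in> Sym ?n" for g
  proof -
    have "(\<lambda>u. young_symmetrizer xs (inv g \<circ> inv w \<circ> u)) = conv ?n (single (w \<circ> g)) (young_symmetrizer xs)"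
      by (simp add: fun_eq_iff conv_single_left[OF Sym_comp[OF w g]] Sym_inv_comp[OF w g])
    also have "\<dots> \<in> specht xs"
      by (intro conv_in_specht single_in_GA Sym_comp w g)
    finally have "fscale (inverse (kappa xs)) (\<lambda>u. young_symmetrizer xs (inv g \<circ> inv w \<circ> u)) \<in> specht xs"
      by (intro fspace.subspace_scale[OF subspace_specht])
    then show ?thesis
      by (simp add: B(2) y_def fscale_def divide_inverse mult.commute)
  qed
  have "act w b = (\<Sum>g\<in>Sym ?n. fscale (b g) (y g))" if b: "b \<in> B" for b
  proof
    fix u
    have "act w b u = conv ?n b (young_symmetrizer xs) (inv w \<circ> u) / kappa xs"
      using specht_absorb[of b xs] b BV kappa_nonzero[of xs] by (auto simp: act_def)
    then show "act w b u = (\<Sum>g\<in>Sym ?n. fscale (b g) (y g)) u"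
      by (simp add: sum_apply conv_def fscale_def y_def sum_divide_distrib o_assoc)
  qed
  then have "(\<Sum>b\<in>B. fspace.representation B (act w b) b) = (\<Sum>g\<in>Sym ?n. y g g)"
    by (intro trace_formula B fin yV)
  also have "\<dots> = chi xs (inv w)"
    by (simp add: y_def chi_def average_def sum_divide_distrib)
  finally show ?thesis
    using chi_inv[OF w] by simp
qed

lemma irr_char_eq_chi:
  assumes "w \<in> Sym (sum_list xs)"
  shows "irr_char xs w = chi xs w"
proof -
  obtain B where "fspace.independent B" "fspace.span B = specht xs"
    using fspace.maximal_independent_subset[of "specht xs"] fspace.span_eq_iff[of "specht xs"]
      subspace_specht[of xs] fspace.span_mono by (metis subset_antisym)
  then have "\<exists>B. fspace.independent B \<and> fspace.span B = specht xs"
    by blast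
  from someI_ex[OF this] show ?thesis
    unfolding irr_char_def trace_on_def Let_def by (intro trace_act_eq_chi assms) auto
qed

section \<open>Cycle types and completeness of the characters\<close>

lemma orbit_funpow_bij:
  assumes "permutation w"
  shows "bij_betw (\<lambda>k. (w ^^ k) a) {..<card (orbit w a)} (orbit w a)" "(w ^^ card (orbit w a)) a = a"
proof -
  let ?m = "funpow_dist1 w a a"
  have a: "a \<in> orbit w a"
    by (rule permutation_self_in_orbit[OF assms])
  have "bij_betw (\<lambda>k. (w ^^ k) a) {0..<?m} (orbit w a)"
    using inj_on_funpow_dist1[OF a] orbit_conv_funpow_dist1[OF a] unfolding bij_betw_def by metis
  moreover from this have m: "card (orbit w a) = ?m"
    using bij_betw_same_card by fastforce
  ultimately show "bij_betw (\<lambda>k. (w ^^ k) a) {..<card (orbit w a)} (orbit w a)"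
    by (simp add: atLeast0LessThan)
  show "(w ^^ card (orbit w a)) a = a"
    unfolding m by (rule funpow_dist1_prop[OF a])
qed

text \<open>Powers of w at a are matched with powers of v at b. The last point of the cycle is a
  separate case because both cycles close up there.\<close>

lemma orbit_isomorphism:
  assumes w: "permutation w" and v: "permutation v" and card: "card (orbit w a) = card (orbit v b)"
  obtains g where "bij_betw g (orbit w a) (orbit v b)" "\<And>x. x \<in> orbit w a \<Longrightarrow> g (w x) = v (g x)"
proof
  let ?m = "card (orbit w a)"
  let ?f = "\<lambda>k. (w ^^ k) a" and ?h = "\<lambda>k. (v ^^ k) b"
  define g where "g = ?h \<circ> the_inv_into {..<?m} ?f"
  note f = orbit_funpow_bij[OF w, of a]
  note h = orbit_funpow_bij[OF v, of b, folded card]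
  show "bij_betw g (orbit w a) (orbit v b)"
    unfolding g_def by (rule bij_betw_trans[OF bij_betw_the_inv_into[OF f(1)] h(1)])
  have g: "g (?f k) = ?h k" if "k < ?m" for k
    using that f(1) unfolding g_def bij_betw_def by (simp add: the_inv_into_f_f[where f = ?f])
  fix x assume "x \<in> orbit w a"
  then obtain k where k: "k < ?m" "x = ?f k"
    using f(1) unfolding bij_betw_def by blast
  show "g (w x) = v (g x)"
  proof (cases "Suc k < ?m")
    case True
    then show ?thesis
      using g[of "Suc k"] g[of k] k by simp
  next
    case False
    then have "Suc k = ?m"
      using k by simp
    then have "w x = a" "v (?h k) = b"
      using f(2) h(2) k by (metis comp_apply funpow.simps(2))+
    then show ?thesis
      using g[of 0] g[of k] k by simp
  qed
qed

lemma image_mset_eq_imp_bij_betw: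
  assumes "finite A" "finite B" "image_mset f (mset_set A) = image_mset g (mset_set B)"
  shows "\<exists>\<beta>. bij_betw \<beta> A B \<and> (\<forall>a\<in>A. g (\<beta> a) = f a)"
  using assms
proof (induction A arbitrary: B rule: finite_induct)
  case empty
  then have "B = {}"
    by (simp add: mset_set_empty_iff)
  then show ?case
    by (simp add: bij_betw_def)
next
  case (insert a A)
  have "f a \<in># image_mset g (mset_set B)"
    using insert by (simp flip: insert.prems(2))
  then obtain b where b: "b \<in> B" "g b = f a"
    using insert.prems(1) by auto
  have "mset_set B = add_mset b (mset_set (B - {b}))"
    using b insert.prems(1) by (simp add: mset_set.remove)
  then have "image_mset f (mset_set A) = image_mset g (mset_set (B - {b}))"
    using insert b by simp
  then obtain \<beta> where \<beta>: "bij_betw \<beta> A (B - {b})" "\<forall>x\<in>A. g (\<beta> x) = f x"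
    using insert.IH[of "B - {b}"] insert.prems(1) by auto
  have "bij_betw (\<beta>(a := b)) A (B - {b})"
    using \<beta>(1) insert.hyps by (subst bij_betw_cong[of A _ \<beta>]) auto
  moreover have "bij_betw (\<beta>(a := b)) {a} {b}"
    by (simp add: bij_betw_def)
  ultimately have "bij_betw (\<beta>(a := b)) (A \<union> {a}) (B - {b} \<union> {b})"
    using bij_betw_combine[of _ A "B - {b}" "{a}" "{b}"] by blast
  then have "bij_betw (\<beta>(a := b)) (insert a A) B"
    using b by (simp add: insert_absorb)
  then show ?case
    using \<beta>(2) b insert.hyps by (intro exI[of _ "\<beta>(a := b)"]) (auto simp del: fun_upd_apply, auto)
qed

lemma Sym_permutation: "w \<in> Sym n \<Longrightarrow> permutation w"
  using permutes_imp_permutation[of "{..<n}" w] by simp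

lemma orbit_eq_iff: "permutation w \<Longrightarrow> orbit w x = orbit w y \<longleftrightarrow> x \<in> orbit w y"
  by (metis orbit_cyclic_eq3 cyclic_on_orbit' permutation_self_in_orbit)

text \<open>Orbits are matched by length and matched orbits by equivariant bijections; glued
  together, these give the conjugating permutation.\<close>

lemma cycle_type_eq_imp_conjugate:
  assumes w: "w \<in> Sym n" and v: "v \<in> Sym n" and eq: "cycle_type n w = cycle_type n v"
  obtains g where "g \<in> Sym n" "v = g \<circ> w \<circ> inv g"
proof -
  note pw = Sym_permutation[OF w] and pv = Sym_permutation[OF v]
  obtain \<beta> where \<beta>: "bij_betw \<beta> (orbit w ` {..<n}) (orbit v ` {..<n})"
    "\<And>S. S \<in> orbit w ` {..<n} \<Longrightarrow> card (\<beta> S) = card S"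
    using image_mset_eq_imp_bij_betw[OF _ _ eq[unfolded cycle_type_def]] by auto
  have "\<exists>h. bij_betw h S (\<beta> S) \<and> (\<forall>x\<in>S. h (w x) = v (h x))" if S: "S \<in> orbit w ` {..<n}" for S
  proof -
    obtain a where a: "S = orbit w a"
      using S by blast
    obtain b where b: "\<beta> S = orbit v b"
      using bij_betwE[OF \<beta>(1)] S by blast
    show ?thesis
      using orbit_isomorphism[OF pw pv, of a b] \<beta>(2)[OF S] a b by metis
  qed
  then obtain h where h: "\<And>S. S \<in> orbit w ` {..<n} \<Longrightarrow> bij_betw (h S) S (\<beta> S)"
    "\<And>S x. S \<in> orbit w ` {..<n} \<Longrightarrow> x \<in> S \<Longrightarrow> h S (w x) = v (h S x)"
    by metis
  define g where "g x = (if x < n then h (orbit w x) x else x)" for x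
  have in_beta: "g x \<in> \<beta> (orbit w x)" if "x < n" for x
    using h(1)[of "orbit w x"] that permutation_self_in_orbit[OF pw, of x]
    by (auto simp: g_def bij_betw_def)
  have beta_orbit: "\<beta> (orbit w x) = orbit v (g x)" "g x < n" if x: "x < n" for x
  proof -
    obtain b where b: "b < n" "\<beta> (orbit w x) = orbit v b"
      using bij_betwE[OF \<beta>(1), rule_format, of "orbit w x"] x by auto
    have "g x \<in> orbit v b"
      using in_beta[OF x] b by simp
    then show "\<beta> (orbit w x) = orbit v (g x)"
      using b orbit_eq_iff[OF pv, of "g x" b] by simp
    show "g x < n"
      using permutes_orbit_subset[of v "{..<n}" b] v b \<open>g x \<in> orbit v b\<close> by auto
  qed
  have "inj_on g {..<n}"
  proof (rule inj_onI)
    fix x y assume xy: "x \<in> {..<n}" "y \<in> {..<n}" "g x = g y"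
    then have "\<beta> (orbit w x) = \<beta> (orbit w y)"
      using beta_orbit by simp
    then have o: "orbit w x = orbit w y"
      using \<beta>(1) xy unfolding bij_betw_def inj_on_def by blast
    have "inj_on (h (orbit w y)) (orbit w y)"
      using h(1)[of "orbit w y"] xy by (simp add: bij_betw_def)
    then show "x = y"
      using xy o permutation_self_in_orbit[OF pw] by (auto simp: g_def dest!: inj_onD)
  qed
  then have "g permutes {..<n}"
    by (intro inj_imp_permutes) (use beta_orbit(2) in \<open>auto simp: g_def\<close>)
  then have G: "g \<in> Sym n"
    by simp
  have "g (w x) = v (g x)" for x
  proof (cases "x < n")
    case True
    then show ?thesis
      using h(2)[of "orbit w x" x] permutation_orbit_step[OF pw, of x] Sym_lt[OF w, of x]
        permutation_self_in_orbit[OF pw, of x] by (simp add: g_def)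
  next
    case False
    then show ?thesis
      using w v by (simp add: g_def permutes_not_in)
  qed
  then have "v \<circ> g = g \<circ> w"
    by auto
  then have "v = g \<circ> w \<circ> inv g"
    by (metis Sym_cancel(5)[OF G])
  with G show ?thesis
    by (rule that)
qed

lemma cycle_type_partition:
  assumes w: "w \<in> Sym n"
  obtains xs where "xs \<in> partitions_of n" "cycle_type n w = mset xs"
proof
  let ?xs = "rev (sorted_list_of_multiset (cycle_type n w))"
  note pw = Sym_permutation[OF w]
  have sub: "S \<subseteq> {..<n}" if "S \<in> orbit w ` {..<n}" for S
    using permutes_orbit_subset[of w "{..<n}"] w that by auto
  have "sum_list ?xs = sum card (orbit w ` {..<n})"
    by (simp add: cycle_type_def sum_unfold_sum_mset flip: sum_mset_sum_list)
  also have "\<dots> = card (\<Union> (orbit w ` {..<n}))"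
  proof (rule card_Union_disjoint[symmetric])
    show "pairwise disjnt (orbit w ` {..<n})"
      using orbit_eq_iff[OF pw] by (auto simp: pairwise_def disjnt_def) metis+
  qed (use sub finite_subset in blast)
  also have "\<Union> (orbit w ` {..<n}) = {..<n}"
    using sub permutation_self_in_orbit[OF pw] by blast
  finally have "sum_list ?xs = n"
    by simp
  moreover have "0 \<notin># cycle_type n w"
  proof -
    have "card (orbit w x) \<noteq> 0" for x
      using finite_orbit[OF permutation_self_in_orbit[OF pw]] orbit_nonempty[of w x] by simp
    then show ?thesis
      by (auto simp: cycle_type_def) (metis less_nat_zero_code)
  qed
  ultimately show "?xs \<in> partitions_of n"
    by (simp add: partitions_of_def sorted_wrt_rev)
  show "cycle_type n w = mset ?xs"
    by simp
qed

section \<open>Completeness of the characters\<close>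

lemma finite_partitions_of: "finite (partitions_of n)"
proof (rule finite_subset)
  have "length xs \<le> sum_list xs" if "0 \<notin> set xs" for xs :: "nat list"
    using that by (induction xs) auto
  then show "partitions_of n \<subseteq> {xs. set xs \<subseteq> {..n} \<and> length xs \<le> n}"
    by (auto simp: partitions_of_def member_le_sum_list)
qed (rule finite_lists_length_le, simp)

lemma partitions_of_sum: "xs \<in> partitions_of n \<Longrightarrow> sum_list xs = n"
  by (simp add: partitions_of_def)

lemma class_fun_conjugate:
  assumes f: "class_fun n f" and g: "g \<in> Sym n"
  shows "f (g \<circ> w \<circ> inv g) = f w"
  using class_funD[OF f Sym_inv[OF g], of w] by (simp add: Sym_inv_inv[OF g])

text \<open>There are at most as many conjugacy classes as partitions, so the orthogonal family of the
  \<open>chi xs\<close> spans the class functions.\<close>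

lemma single_id_chi_expansion:
  obtains a where "\<And>w. single id w = (\<Sum>xs\<in>partitions_of n. a xs * chi xs w)"
proof -
  let ?P = "partitions_of n"
  define ind where "ind xs = (\<lambda>w. if w \<in> Sym n \<and> cycle_type n w = mset xs then 1 else 0 :: complex)" for xs
  have span: "f \<in> fspace.span (ind ` ?P)" if f: "class_fun n f" for f
  proof -
    have "\<exists>c. \<forall>w\<in>Sym n. cycle_type n w = mset xs \<longrightarrow> f w = c" for xs
    proof (cases "\<exists>v\<in>Sym n. cycle_type n v = mset xs")
      case True
      then obtain v where v: "v \<in> Sym n" "cycle_type n v = mset xs"
        by blast
      have "f w = f v" if w: "w \<in> Sym n" "cycle_type n w = mset xs" for w
      proof -
        obtain g where "g \<in> Sym n" "w = g \<circ> v \<circ> inv g"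
          using cycle_type_eq_imp_conjugate[OF v(1) w(1)] v(2) w(2) by metis
        then show ?thesis
          using class_fun_conjugate[OF f] by simp
      qed
      then show ?thesis
        by blast
    qed blast
    then obtain c where c: "\<And>xs w. w \<in> Sym n \<Longrightarrow> cycle_type n w = mset xs \<Longrightarrow> f w = c xs"
      by metis
    have "f = (\<Sum>xs\<in>?P. fscale (c xs) (ind xs))"
    proof
      fix w
      show "f w = (\<Sum>xs\<in>?P. fscale (c xs) (ind xs)) w"
      proof (cases "w \<in> Sym n")
        case w: True
        obtain ys where ys: "ys \<in> ?P" "cycle_type n w = mset ys"
          using cycle_type_partition[OF w] .
        have "ind xs w = (if xs = ys then 1 else 0)" if "xs \<in> ?P" for xs
        proof -
          have "xs = ys" if "mset xs = mset ys"
          proof -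
            have "sorted (rev xs)" "sorted (rev ys)"
              using \<open>xs \<in> ?P\<close> ys by (simp_all add: partitions_of_def sorted_wrt_rev)
            then have "rev xs = rev ys"
              using that by (metis mset_rev properties_for_sort)
            then show ?thesis
              by simp
          qed
          then show ?thesis
            using w ys by (auto simp: ind_def)
        qed
        then have "(\<Sum>xs\<in>?P. fscale (c xs) (ind xs)) w = (\<Sum>xs\<in>?P. if xs = ys then c ys else 0)"
          unfolding sum_apply fscale_def by (intro sum.cong) auto
        then show ?thesis
          using ys c[OF w ys(2)] finite_partitions_of by simp
      next
        case False
        then show ?thesis
          using f by (auto simp: sum_apply fscale_def ind_def class_fun_def group_algebra_def)
      qed
    qed
    also have "\<dots> \<in> fspace.span (ind ` ?P)"
      by (intro fspace.span_sum fspace.span_scale fspace.span_base imageI)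
    finally show ?thesis .
  qed
  have chi_cf: "class_fun n (chi xs)" if "xs \<in> ?P" for xs
    using chi_class_fun[of xs] partitions_of_sum[OF that] by simp
  have inj: "inj_on chi ?P"
  proof (rule inj_onI)
    fix xs ys assume *: "xs \<in> ?P" "ys \<in> ?P" "chi xs = chi ys"
    show "xs = ys"
      using chi_orthonormal[OF *(1,2)] chi_orthonormal[OF *(1,1)] *(3) by (auto split: if_splits)
  qed
  have indep: "fspace.independent (chi ` ?P)"
  proof (rule fspace.independent_if_scalars_zero)
    fix f x assume 0: "(\<Sum>x\<in>chi ` ?P. fscale (f x) x) = 0" and "x \<in> chi ` ?P"
    then obtain ys where ys: "ys \<in> ?P" "x = chi ys"
      by blast
    have "(\<Sum>xs\<in>?P. f (chi xs) * chi xs w) = 0" for w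
      using fun_cong[OF 0, of w] by (simp add: sum.reindex[OF inj] sum_apply fscale_def)
    then have "0 = (\<Sum>w\<in>Sym n. (\<Sum>xs\<in>?P. f (chi xs) * chi xs w) * chi ys w)"
      by simp
    also have "\<dots> = (\<Sum>xs\<in>?P. f (chi xs) * (\<Sum>w\<in>Sym n. chi xs w * chi ys w))"
      unfolding sum_distrib_right sum_distrib_left by (subst sum.swap) (simp add: mult.assoc)
    also have "\<dots> = (\<Sum>xs\<in>?P. if xs = ys then f x * fact n else 0)"
      by (rule sum.cong[OF refl]) (use chi_orthonormal[OF _ ys(1)] ys(2) in auto)
    finally show "f x = 0"
      using ys finite_partitions_of by simp
  qed (simp add: finite_partitions_of)
  have "single id \<in> fspace.span (chi ` ?P)"
  proof (rule ccontr)
    assume out: "single id \<notin> fspace.span (chi ` ?P)"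
    have "class_fun n (single id)"
    proof -
      have "inv g \<circ> w \<circ> g = id \<longleftrightarrow> w = id" if g: "g \<in> Sym n" for g w
        by (metis Sym_cancel(1,4,5)[OF g] id_o o_id o_assoc)
      then show ?thesis
        using single_in_GA[OF Sym_id] by (auto simp: class_fun_def single_def)
    qed
    then have "insert (single id) (chi ` ?P) \<subseteq> fspace.span (ind ` ?P)"
      using span chi_cf by auto
    then have "card (insert (single id) (chi ` ?P)) \<le> card (ind ` ?P)"
      using fspace.independent_span_bound[OF _ fspace.independent_insertI[OF out indep]]
        finite_partitions_of by blast
    also have "\<dots> \<le> card ?P"
      by (rule card_image_le[OF finite_partitions_of])
    finally show False
      using out fspace.span_base[of "single id" "chi ` ?P"] finite_partitions_of
      by (auto simp: card_image[OF inj] card_insert_if split: if_splits)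
  qed
  then obtain u where "single id = (\<Sum>x\<in>chi ` ?P. fscale (u x) x)"
    using fspace.span_finite[of "chi ` ?P"] finite_partitions_of by auto
  then have "single id w = (\<Sum>xs\<in>?P. u (chi xs) * chi xs w)" for w
    by (simp add: sum.reindex[OF inj] sum_apply fscale_def)
  then show ?thesis
    by (rule that)
qed

text \<open>The decomposition of f into isotypic components: the expansion of the unit element is
  multiplied by f.\<close>

lemma chi_expansion:
  assumes f: "f \<in> group_algebra n"
  obtains a where "\<And>w. f w = (\<Sum>xs\<in>partitions_of n. a xs * conv n f (chi xs) w)"
proof -
  obtain a where a: "\<And>w. single id w = (\<Sum>xs\<in>partitions_of n. a xs * chi xs w)"
    using single_id_chi_expansion by blast
  have "f w = (\<Sum>xs\<in>partitions_of n. a xs * conv n f (chi xs) w)" for w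
  proof -
    have "f w = conv n f (single id) w"
      by (simp add: conv_single_right[OF Sym_id f])
    also have "\<dots> = conv n f (\<lambda>w. \<Sum>xs\<in>partitions_of n. a xs * chi xs w) w"
      by (simp flip: a)
    finally show ?thesis
      by (simp add: conv_sum_right[OF finite_partitions_of] conv_scale_right)
  qed
  then show ?thesis
    by (rule that)
qed

section \<open>Integrality of the characters\<close>

lemma lattice_scale:
  assumes 0: "(0 :: (nat \<Rightarrow> nat) \<Rightarrow> complex) \<in> L" and minus: "\<And>f g. f \<in> L \<Longrightarrow> g \<in> L \<Longrightarrow> f - g \<in> L" and f: "f \<in> L"
  shows "fscale (of_int z) f \<in> L"
proof -
  have neg: "- g \<in> L" if "g \<in> L" for g
    using minus[OF 0 that] by simp
  have nat: "fscale (of_nat k) f \<in> L" for k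
  proof (induction k)
    case 0
    then show ?case
      using 0 by (simp add: fscale_def assms(1)[unfolded zero_fun_def])
  next
    case (Suc k)
    have "fscale (of_nat (Suc k)) f = fscale (of_nat k) f - (- f)"
      by (simp add: fscale_def fun_eq_iff algebra_simps)
    then show ?case
      using minus[OF Suc neg[OF f]] by (simp only:)
  qed
  show ?thesis
  proof (cases z rule: int_cases2)
    case (nonneg k)
    then show ?thesis
      using nat[of k] by simp
  next
    case (nonpos k)
    have "fscale (of_int z) f = - fscale (of_nat k) f"
      using nonpos by (simp add: fscale_def fun_eq_iff)
    then show ?thesis
      using neg[OF nat[of k]] by simp
  qed
qed

text \<open>Induction on the support: a basis of the functions vanishing at x is completed by an
  element with the least positive value at x. The new element is the only one not vanishing there,
  so independence holds over the complex numbers.\<close>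

lemma integer_lattice_basis:
  fixes L :: "((nat \<Rightarrow> nat) \<Rightarrow> complex) set"
  assumes "finite I" "0 \<in> L" "\<And>f g. f \<in> L \<Longrightarrow> g \<in> L \<Longrightarrow> f - g \<in> L"
    and "\<And>f w. f \<in> L \<Longrightarrow> f w \<in> \<int>" "\<And>f w. f \<in> L \<Longrightarrow> w \<notin> I \<Longrightarrow> f w = 0"
  shows "\<exists>B. finite B \<and> B \<subseteq> L \<and> fspace.independent B \<and>
    (\<forall>f\<in>L. \<exists>z. f = (\<Sum>b\<in>B. fscale (of_int (z b)) b))"
  using assms
proof (induction I arbitrary: L rule: finite_induct)
  case empty
  then have "f = 0" if "f \<in> L" for f
    using that by (simp add: fun_eq_iff)
  then show ?case
    by (intro exI[of _ "{}"]) (simp add: fspace.independent_empty zero_fun_def)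
next
  case (insert x I)
  let ?K = "{f \<in> L. f x = 0}"
  have "\<exists>B. finite B \<and> B \<subseteq> ?K \<and> fspace.independent B \<and>
    (\<forall>f\<in>?K. \<exists>z. f = (\<Sum>b\<in>B. fscale (of_int (z b)) b))"
  proof (rule insert.IH)
    show "f w = 0" if "f \<in> ?K" "w \<notin> I" for f w
      using that insert.prems(4)[of f w] by (cases "w = x") auto
  qed (use insert.prems in auto)
  then obtain B where B: "finite B" "B \<subseteq> ?K" "fspace.independent B"
    and ex: "\<And>f. f \<in> ?K \<Longrightarrow> \<exists>z. f = (\<Sum>b\<in>B. fscale (of_int (z b)) b)"
    by blast
  show ?case
  proof (cases "L = ?K")
    case True
    have "B \<subseteq> L" "\<forall>f\<in>L. \<exists>z. f = (\<Sum>b\<in>B. fscale (of_int (z b)) b)"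
      using B(2) ex True by blast+
    then show ?thesis
      using B by blast
  next
    case False
    define pos where "pos d \<longleftrightarrow> d > 0 \<and> (\<exists>f\<in>L. f x = of_nat d)" for d :: nat
    obtain f0 where f0: "f0 \<in> L" "f0 x \<noteq> 0"
      using False by blast
    obtain e0 where e0: "f0 x = of_int e0"
      using insert.prems(3)[OF f0(1), of x] by (auto elim: Ints_cases)
    have "pos (nat \<bar>e0\<bar>)"
    proof -
      have "fscale (of_int (sgn e0)) f0 \<in> L"
        by (rule lattice_scale[OF insert.prems(1,2) f0(1)])
      moreover have "fscale (of_int (sgn e0)) f0 x = of_nat (nat \<bar>e0\<bar>)"
        by (simp add: fscale_def e0 flip: of_int_mult) (simp add: sgn_mult_self_eq[symmetric] abs_sgn mult.commute)
      ultimately show ?thesis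
        using f0 e0 unfolding pos_def by (metis of_int_0 zero_less_nat_eq zero_less_abs_iff)
    qed
    define d where "d = (LEAST d. pos d)"
    have "pos d"
      unfolding d_def by (rule LeastI) fact
    then obtain b where b: "b \<in> L" "b x = of_nat d" and d: "d > 0"
      by (auto simp: pos_def)
    have least: "d \<le> d'" if "pos d'" for d'
      unfolding d_def by (rule Least_le) fact
    have "\<exists>z. f = (\<Sum>b\<in>insert b B. fscale (of_int (z b)) b)" if f: "f \<in> L" for f
    proof -
      obtain e where e: "f x = of_int e"
        using insert.prems(3)[OF f, of x] by (auto elim: Ints_cases)
      define q where "q = e div int d"
      define h where "h = f - fscale (of_int q) b"
      have hL: "h \<in> L"
        unfolding h_def by (intro insert.prems(2) f lattice_scale[OF insert.prems(1,2) b(1)])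
      have "e - q * int d = e mod int d"
        by (simp add: q_def minus_div_mult_eq_mod)
      moreover have "h x = of_int (e - q * int d)"
        by (simp add: h_def fscale_def e b)
      ultimately have hx: "h x = of_int (e mod int d)"
        by simp
      have "e mod int d = 0"
      proof (rule ccontr)
        assume "e mod int d \<noteq> 0"
        then have m: "0 < e mod int d" "e mod int d < int d"
          using d by (simp_all add: order.not_eq_order_implies_strict)
        have "pos (nat (e mod int d))"
          unfolding pos_def using m hL hx by (intro conjI bexI[of _ h]) (auto simp: of_nat_nat)
        from least[OF this] show False
          using m by linarith
      qed
      then have "h \<in> ?K"
        using hL hx by simp
      then obtain z where z: "h = (\<Sum>b\<in>B. fscale (of_int (z b)) b)"
        using ex by blast
      have "b \<notin> B"
        using B(2) b d by auto
      then have "(\<Sum>b'\<in>insert b B. fscale (of_int ((z(b := q)) b')) b') = fscale (of_int q) b + h"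
        using B(1) z by (simp, intro sum.cong) auto
      also have "\<dots> = f"
        by (simp add: h_def)
      finally show ?thesis
        by metis
    qed
    moreover have "fspace.independent (insert b B)"
    proof (rule fspace.independent_insertI[OF _ B(3)])
      have "fspace.subspace {f. f x = 0}"
        by (auto simp: fspace.subspace_def fscale_def)
      then have "fspace.span B \<subseteq> {f. f x = 0}"
        using B(2) by (intro fspace.span_minimal) auto
      then show "b \<notin> fspace.span B"
        using b d by auto
    qed
    ultimately show ?thesis
      using B b by (intro exI[of _ "insert b B"]) auto
  qed
qed

text \<open>The integer-valued functions in the Specht module form a lattice that is stable under
  the action and spans the module, because the Young symmetrizer is integral. In a lattice basis w
  has an integral matrix.\<close>

lemma chi_Ints:
  assumes w: "w \<in> Sym (sum_list xs)"
  shows "chi xs w \<in> \<int>"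
proof -
  let ?n = "sum_list xs" and ?c = "young_symmetrizer xs"
  let ?L = "{f \<in> specht xs. \<forall>w. f w \<in> \<int>}"
  note sp = subspace_specht[of xs]
  have "\<exists>B. finite B \<and> B \<subseteq> ?L \<and> fspace.independent B \<and>
    (\<forall>f\<in>?L. \<exists>z. f = (\<Sum>b\<in>B. fscale (of_int (z b)) b))"
  proof (rule integer_lattice_basis[OF finite_Sym[of ?n]])
    show "f w = 0" if "f \<in> ?L" "w \<notin> Sym ?n" for f w
      using that specht_subset_GA[of xs] by (auto simp: group_algebra_def)
  qed (use fspace.subspace_0[OF sp] fspace.subspace_diff[OF sp] in auto)
  then obtain B where B: "finite B" "B \<subseteq> ?L" "fspace.independent B"
    and ex: "\<forall>f\<in>?L. \<exists>z. f = (\<Sum>b\<in>B. fscale (of_int (z b)) b)"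
    by (elim exE conjE) (rule that)
  have LB: "?L \<subseteq> fspace.span B"
  proof
    fix f assume "f \<in> ?L"
    with ex obtain z where "f = (\<Sum>b\<in>B. fscale (of_int (z b)) b)"
      by (elim bspec[elim_format] exE)
    then show "f \<in> fspace.span B"
      by (simp add: fspace.span_sum fspace.span_scale fspace.span_base)
  qed
  have span: "fspace.span B = specht xs"
  proof
    show "fspace.span B \<subseteq> specht xs"
      using B(2) by (intro fspace.span_minimal sp) auto
    show "specht xs \<subseteq> fspace.span B"
    proof
      fix x assume "x \<in> specht xs"
      then obtain f where x: "x = conv ?n f ?c"
        by (auto simp: specht_def)
      have L: "conv ?n (single g) ?c \<in> ?L" if "g \<in> Sym ?n" for g
        using conv_in_specht[OF single_in_GA[OF that]] young_symmetrizer_Ints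
        by (simp add: conv_single_left[OF that])
      have "x = (\<Sum>g\<in>Sym ?n. fscale (f g) (conv ?n (single g) ?c))"
        unfolding x by (rule ext) (simp add: sum_apply fscale_def conv_single_left conv_def[of ?n f])
      also have "\<dots> \<in> fspace.span B"
        using L LB by (intro fspace.span_sum fspace.span_scale) blast
      finally show "x \<in> fspace.span B" .
    qed
  qed
  have "fspace.representation B (act w b) b \<in> \<int>" if b: "b \<in> B" for b
  proof -
    have "act w b = conv ?n (single w) b"
      by (simp add: fun_eq_iff act_def conv_single_left[OF w])
    moreover have "conv ?n (single w) b \<in> specht xs"
    proof -
      have "b \<in> specht xs"
        using b B(2) by blast
      then show ?thesis
        by (simp add: specht_iff conv_assoc conv_scale_right[abs_def] conv_in_GA)
    qed
    ultimately have "act w b \<in> ?L"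
      using b B(2) by (auto simp: conv_single_left[OF w])
    with ex obtain z where z: "act w b = (\<Sum>b\<in>B. fscale (of_int (z b)) b)"
      by (elim bspec[elim_format] exE)
    have "fspace.representation B (act w b) b = (\<Sum>b'\<in>B. of_int (z b') * (if b' = b then 1 else 0))"
      unfolding z
      by (subst fspace.representation_sum[OF B(3)])
        (auto intro!: sum.cong simp: fspace.span_scale fspace.span_base fspace.representation_scale[OF B(3) fspace.span_base] fspace.representation_basis[OF B(3)])
    then show ?thesis
      by (auto intro!: Ints_sum)
  qed
  then show ?thesis
    unfolding trace_act_eq_chi[OF B(3) span w, symmetric] by (intro Ints_sum)
qed

section \<open>Characters and centralizers\<close>

text \<open>Bessel's inequality for the class function counting the ways to write an element as a
  conjugate of \<open>w\<close>.\<close>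

lemma sum_chi_squares_le:
  assumes w: "w \<in> Sym n"
  shows "(\<Sum>xs\<in>partitions_of n. (Re (chi xs w))\<^sup>2) \<le> card {g \<in> Sym n. g \<circ> w = w \<circ> g}"
proof -
  let ?P = "partitions_of n" and ?C = "{g \<in> Sym n. g \<circ> w = w \<circ> g}"
  define r where "r xs x = Re (chi xs x)" for xs x
  define f where "f x = (\<Sum>g\<in>Sym n. if x = g \<circ> w \<circ> inv g then 1 else 0 :: real)" for x
  have chi: "chi xs x = of_real (r xs x)" for xs x
    using chi_Reals[of xs x] by (simp add: r_def)
  have orth: "(\<Sum>x\<in>Sym n. r xs x * r ys x) = (if xs = ys then fact n else 0)"
    if "xs \<in> ?P" "ys \<in> ?P" for xs ys
  proof -
    have "complex_of_real (\<Sum>x\<in>Sym n. r xs x * r ys x) = of_real (if xs = ys then fact n else 0)"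
      using chi_orthonormal[OF that] by (simp add: chi)
    then show ?thesis
      by (simp only: of_real_eq_iff)
  qed
  have conj: "g \<circ> w \<circ> inv g \<in> Sym n" if "g \<in> Sym n" for g
    by (intro Sym_comp Sym_inv that w)
  have sum_f: "(\<Sum>x\<in>Sym n. f x * h x) = (\<Sum>g\<in>Sym n. h (g \<circ> w \<circ> inv g))" for h
  proof -
    have "(\<Sum>x\<in>Sym n. f x * h x) = (\<Sum>g\<in>Sym n. \<Sum>x\<in>Sym n. if x = g \<circ> w \<circ> inv g then h x else 0)"
      unfolding f_def sum_distrib_right by (subst sum.swap) (simp add: if_distrib[of "\<lambda>a. a * _"] cong: if_cong)
    also have "\<dots> = (\<Sum>g\<in>Sym n. h (g \<circ> w \<circ> inv g))"
      by (rule sum.cong[OF refl]) (simp add: sum.delta[OF finite_Sym] conj[simplified])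
    finally show ?thesis .
  qed
  have fr: "(\<Sum>x\<in>Sym n. f x * r xs x) = fact n * r xs w" if "xs \<in> ?P" for xs
  proof -
    have "class_fun n (chi xs)"
      using chi_class_fun[of xs] partitions_of_sum[OF that] by simp
    then have "r xs (g \<circ> w \<circ> inv g) = r xs w" if "g \<in> Sym n" for g
      using class_fun_conjugate[of n "chi xs" g w] that by (simp add: r_def)
    then show ?thesis
      by (simp add: sum_f card_permutations)
  qed
  \<comment> \<open>Writing the second conjugator as \<open>g \<circ> k\<close> turns equality of
    the two conjugates into k commuting with w.\<close>
  have "(\<Sum>x\<in>Sym n. f x * f x) = (\<Sum>g\<in>Sym n. real (card ?C))"
    unfolding sum_f
  proof (rule sum.cong[OF refl])
    fix g assume g: "g \<in> Sym n"
    have "f (g \<circ> w \<circ> inv g) = (\<Sum>k\<in>Sym n. if g \<circ> w \<circ> inv g = (g \<circ> k) \<circ> w \<circ> inv (g \<circ> k) then 1 else 0)"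
      unfolding f_def by (rule sum_Sym_left[OF g, symmetric])
    also have "\<dots> = (\<Sum>k\<in>Sym n. if k \<in> ?C then 1 else 0)"
    proof (rule sum.cong[OF refl])
      fix k assume k: "k \<in> Sym n"
      have "g \<circ> w \<circ> inv g = (g \<circ> k) \<circ> w \<circ> inv (g \<circ> k) \<longleftrightarrow> w = k \<circ> w \<circ> inv k"
      proof
        assume "g \<circ> w \<circ> inv g = (g \<circ> k) \<circ> w \<circ> inv (g \<circ> k)"
        then have "inv g \<circ> (g \<circ> w \<circ> inv g) \<circ> g = inv g \<circ> ((g \<circ> k) \<circ> w \<circ> (inv k \<circ> inv g)) \<circ> g"
          by (simp add: Sym_inv_comp[OF g k])
        then show "w = k \<circ> w \<circ> inv k"
          by (simp add: o_assoc Sym_cancel[OF g])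
      qed (simp add: Sym_inv_comp[OF g k] o_assoc, metis o_assoc)
      also have "\<dots> \<longleftrightarrow> k \<circ> w = w \<circ> k"
        by (metis Sym_cancel(5,6)[OF k])
      finally show "(if g \<circ> w \<circ> inv g = (g \<circ> k) \<circ> w \<circ> inv (g \<circ> k) then 1 else 0)
          = (if k \<in> ?C then 1 else 0 :: real)"
        using k by simp
    qed
    also have "\<dots> = real (card ?C)"
      using finite_Sym[of n] by (simp add: sum.If_cases Int_def conj_commute)
    finally show "f (g \<circ> w \<circ> inv g) = real (card ?C)" .
  qed
  then have ff: "(\<Sum>x\<in>Sym n. f x * f x) = fact n * card ?C"
    by (simp add: card_permutations)
  \<comment> \<open>\<open>s\<close> is the orthogonal projection of \<open>f\<close> to the span of
    the characters: by \<open>fr\<close> and \<open>orth\<close> the coefficient of a character is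
    its value at w.\<close>
  define s where "s x = (\<Sum>xs\<in>?P. r xs w * r xs x)" for x
  define N where "N = (\<Sum>xs\<in>?P. (r xs w)\<^sup>2)"
  have fs: "(\<Sum>x\<in>Sym n. f x * s x) = fact n * N"
  proof -
    have "(\<Sum>x\<in>Sym n. f x * s x) = (\<Sum>xs\<in>?P. r xs w * (\<Sum>x\<in>Sym n. f x * r xs x))"
      unfolding s_def sum_distrib_left by (subst sum.swap) (simp add: mult_ac)
    also have "\<dots> = (\<Sum>xs\<in>?P. fact n * (r xs w)\<^sup>2)"
      by (rule sum.cong[OF refl]) (simp add: fr power2_eq_square)
    finally show ?thesis
      by (simp add: N_def sum_distrib_left)
  qed
  have ss: "(\<Sum>x\<in>Sym n. s x * s x) = fact n * N"
  proof -
    have "(\<Sum>x\<in>Sym n. s x * s x) = (\<Sum>x\<in>Sym n. \<Sum>xs\<in>?P. \<Sum>ys\<in>?P. r xs w * r ys w * (r xs x * r ys x))"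
      by (simp add: s_def sum_product mult_ac)
    also have "\<dots> = (\<Sum>xs\<in>?P. \<Sum>ys\<in>?P. r xs w * r ys w * (\<Sum>x\<in>Sym n. r xs x * r ys x))"
      unfolding sum_distrib_left by (subst sum.swap, rule sum.cong[OF refl], rule sum.swap)
    also have "\<dots> = (\<Sum>xs\<in>?P. \<Sum>ys\<in>?P. if ys = xs then fact n * (r xs w)\<^sup>2 else 0)"
      by (intro sum.cong refl) (auto simp: orth power2_eq_square)
    finally show ?thesis
      by (simp add: N_def finite_partitions_of sum_distrib_left)
  qed
  have "0 \<le> (\<Sum>x\<in>Sym n. (f x - s x)\<^sup>2)"
    by (intro sum_nonneg) simp
  also have "\<dots> = (\<Sum>x\<in>Sym n. f x * f x) - 2 * (\<Sum>x\<in>Sym n. f x * s x) + (\<Sum>x\<in>Sym n. s x * s x)"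
    by (simp add: power2_eq_square algebra_simps sum.distrib sum_subtractf sum_distrib_left)
  also have "\<dots> = fact n * (card ?C - N)"
    by (simp add: ff fs ss algebra_simps)
  finally have "0 \<le> card ?C - N"
    using mult_le_cancel_left_pos[of "fact n" 0 "card ?C - N"] by simp
  then show ?thesis
    by (simp add: N_def r_def)
qed

text \<open>A nonzero integer has square at least 1, so every nonvanishing character contributes at
  least 1 to the sum of squares.\<close>

lemma card_chi_nonzero_le:
  assumes w: "w \<in> Sym n"
  shows "card {xs \<in> partitions_of n. chi xs w \<noteq> 0} \<le> card {g \<in> Sym n. g \<circ> w = w \<circ> g}"
proof -
  let ?S = "{xs \<in> partitions_of n. chi xs w \<noteq> 0}"
  have "1 \<le> (Re (chi xs w))\<^sup>2" if "xs \<in> ?S" for xs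
  proof -
    have "chi xs w \<in> \<int>"
      using chi_Ints[of w xs] w partitions_of_sum[of xs n] that by simp
    then obtain z where z: "chi xs w = of_int z"
      by (auto elim: Ints_cases)
    then have "1 \<le> z\<^sup>2"
      using that by (simp add: int_one_le_iff_zero_less)
    then have "real_of_int 1 \<le> real_of_int (z\<^sup>2)"
      by (simp only: of_int_le_iff)
    then show ?thesis
      using z by simp
  qed
  then have "(\<Sum>xs\<in>?S. 1) \<le> (\<Sum>xs\<in>?S. (Re (chi xs w))\<^sup>2)"
    by (rule sum_mono)
  also have "\<dots> \<le> (\<Sum>xs\<in>partitions_of n. (Re (chi xs w))\<^sup>2)"
    by (rule sum_mono2) (auto simp: finite_partitions_of)
  also note sum_chi_squares_le[OF w]
  finally show ?thesis
    by simp
qed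

text \<open>A permutation commuting with w is determined on the orbit by the image of x, and the at
  most one remaining point leaves no choice.\<close>

lemma card_centralizer_le:
  assumes w: "w \<in> Sym n" and x: "x < n" and long: "n \<le> card (orbit w x) + 1"
  shows "card {g \<in> Sym n. g \<circ> w = w \<circ> g} \<le> n"
proof -
  let ?C = "{g \<in> Sym n. g \<circ> w = w \<circ> g}"
  have "inj_on (\<lambda>g. g x) ?C"
  proof (rule inj_onI)
    fix g h assume gh: "g \<in> ?C" "h \<in> ?C" "g x = h x"
    then have g: "g \<in> Sym n" and h: "h \<in> Sym n"
      by auto
    have pow: "k ((w ^^ i) x) = (w ^^ i) (k x)" if "k \<in> ?C" for k i
      using that by (induction i) (auto simp: fun_eq_iff)
    define p where "p = inv h \<circ> g"
    have p: "p \<in> Sym n"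
      unfolding p_def by (intro Sym_comp Sym_inv g h)
    have fixed: "p y = y" if "y \<in> orbit w x" for y
    proof -
      obtain i where "y = (w ^^ i) x"
        using \<open>y \<in> orbit w x\<close> by (auto simp: orbit_altdef)
      then have "g y = h y"
        using pow[OF gh(1), of i] pow[OF gh(2), of i] gh(3) by simp
      then show ?thesis
        by (simp add: p_def Sym_cancel(7)[OF h])
    qed
    have orb: "orbit w x \<subseteq> {..<n}"
      using permutes_orbit_subset[of w "{..<n}" x] w x by auto
    have "p y = y" for y
    proof (rule ccontr)
      assume y: "p y \<noteq> y"
      \<comment> \<open>A permutation moving y also moves \<open>p y\<close>, so two points would
        have to lie outside the orbit.\<close>
      then have "p (p y) \<noteq> p y"
        using Sym_cancel(7)[OF p] by metis
      then have out: "y \<notin> orbit w x" "p y \<notin> orbit w x"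
        using y fixed by blast+
      have "y < n"
        using y p permutes_not_in[of p "{..<n}" y] by auto
      then have "insert y (insert (p y) (orbit w x)) \<subseteq> {..<n}"
        using orb Sym_lt[OF p] by auto
      then have "card (insert y (insert (p y) (orbit w x))) \<le> card {..<n}"
        by (intro card_mono) auto
      moreover have "finite (orbit w x)"
        using orb finite_subset by blast
      ultimately show False
        using out y long by simp
    qed
    then have "p = id"
      by auto
    then show "g = h"
      using Sym_cancel(4)[OF h, of g] by (simp add: p_def)
  qed
  then have "card ?C \<le> card {..<n}"
    by (rule card_inj_on_le) (use x Sym_lt in auto)
  then show ?thesis
    by simp
qed

text \<open>The existence hypothesis gives the choice in \<open>irr_char_at\<close> its intended
  meaning, and the part m supplies an orbit that misses at most one point.\<close>

lemma card_irr_char_at_nonzero_le: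
  assumes ex: "\<exists>w\<in>Sym n. cycle_type n w = mset ys" and m: "m \<in> set ys" "n \<le> m + 1"
  shows "card {xs \<in> partitions_of n. irr_char_at xs ys \<noteq> 0} \<le> n"
proof -
  define W where "W = (SOME w. w \<in> Sym n \<and> cycle_type n w = mset ys)"
  have W: "W \<in> Sym n" "cycle_type n W = mset ys"
    using someI_ex[of "\<lambda>w. w \<in> Sym n \<and> cycle_type n w = mset ys"] ex unfolding W_def by blast+
  have "irr_char_at xs ys = chi xs W" if "xs \<in> partitions_of n" for xs
    using irr_char_eq_chi[of W xs] W(1) partitions_of_sum[OF that] by (simp add: irr_char_at_def W_def)
  then have "{xs \<in> partitions_of n. irr_char_at xs ys \<noteq> 0} = {xs \<in> partitions_of n. chi xs W \<noteq> 0}"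
    by auto
  moreover have "m \<in># cycle_type n W"
    using m by (simp add: W)
  then obtain x where "x < n" "m = card (orbit W x)"
    by (auto simp: cycle_type_def)
  ultimately show ?thesis
    using card_chi_nonzero_le[OF W(1)] card_centralizer_le[OF W(1)] m by fastforce
qed

section \<open>Permutations realizing the principal hook partitions\<close>

definition long_cycle :: "nat \<Rightarrow> nat \<Rightarrow> nat" where
  "long_cycle m i = (if i + 1 < m then i + 1 else if i + 1 = m then 0 else i)"

lemma long_cycle_permutes: "long_cycle m permutes {..<m}"
  by (rule inj_imp_permutes) (auto simp: long_cycle_def inj_on_def)

lemma orbit_long_cycle:
  shows "i < m \<Longrightarrow> orbit (long_cycle m) i = {..<m}" "m \<le> i \<Longrightarrow> orbit (long_cycle m) i = {i}"
proof -
  have perm: "permutation (long_cycle m)"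
    using permutes_imp_permutation[OF _ long_cycle_permutes] by simp
  have pow: "i < m \<Longrightarrow> (long_cycle m ^^ i) 0 = i" for i
    by (induction i) (auto simp: long_cycle_def)
  have 0: "orbit (long_cycle m) 0 = {..<m}" if "m > 0"
  proof
    show "orbit (long_cycle m) 0 \<subseteq> {..<m}"
      using that by (intro permutes_orbit_subset[OF long_cycle_permutes]) simp
    show "{..<m} \<subseteq> orbit (long_cycle m) 0"
      unfolding orbit_altdef_permutation[OF perm] using pow by (metis (mono_tags, lifting) lessThan_iff mem_Collect_eq subsetI)
  qed
  show "orbit (long_cycle m) i = {..<m}" if "i < m"
    using orbit_eq_iff[OF perm, of i 0] 0 that by auto
  show "orbit (long_cycle m) i = {i}" if "m \<le> i"
    using that by (simp add: orbit_eq_singleton_iff long_cycle_def)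
qed

text \<open>With m = 2k + 1 these are the principal hook partitions of the two families; the second
  arises by adjoining a fixed point to the same cycle.\<close>

lemma cycle_type_long_cycle:
  assumes "m > 0"
  shows "\<exists>w\<in>Sym m. cycle_type m w = mset [m]" "\<exists>w\<in>Sym (Suc m). cycle_type (Suc m) w = mset [m, 1]"
proof -
  have 1: "orbit (long_cycle m) ` {..<m} = {{..<m}}"
    using assms orbit_long_cycle(1)[of _ m] by auto
  have "cycle_type m (long_cycle m) = mset [m]"
    by (simp add: cycle_type_def 1)
  then show "\<exists>w\<in>Sym m. cycle_type m w = mset [m]"
    using long_cycle_permutes[of m] by blast
  have 2: "orbit (long_cycle m) ` {..<Suc m} = {{..<m}, {m}}"
    by (simp add: lessThan_Suc 1 orbit_long_cycle(2) insert_commute)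
  have "{..<m} \<noteq> {m}"
    by auto
  then have "cycle_type (Suc m) (long_cycle m) = mset [m, 1]"
    by (simp add: cycle_type_def 2)
  moreover have "long_cycle m \<in> Sym (Suc m)"
    using permutes_subset[OF long_cycle_permutes[of m], of "{..<Suc m}"] by auto
  ultimately show "\<exists>w\<in>Sym (Suc m). cycle_type (Suc m) w = mset [m, 1]"
    by blast
qed

section \<open>Positivity of Kronecker coefficients\<close>

lemma kronecker_eq_sum:
  assumes "sum_list xs = n" "sum_list ys = n"
  shows "kronecker xs xs ys = (\<Sum>w\<in>Sym n. chi xs w * chi xs w * chi ys w) / fact n"
  using assms Reals_cnj_iff[THEN iffD1, OF chi_Reals]
  by (simp add: kronecker_def char_inner_def irr_char_eq_chi mult.assoc)

text \<open>\<open>conv_chi_self\<close> and invariance under inversion exhibit the matrix with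
  entries chi(x^-1 y) as a Gram matrix, up to the positive factor \<open>kappa\<close>.\<close>

lemma chi_kernel:
  assumes n: "sum_list xs = n" and x: "x \<in> Sym n"
  shows "kappa xs * chi xs (inv x \<circ> y) = (\<Sum>u\<in>Sym n. chi xs (inv u \<circ> x) * chi xs (inv u \<circ> y))"
proof -
  have "kappa xs * chi xs (inv x \<circ> y) = (\<Sum>u\<in>Sym n. chi xs u * chi xs (inv u \<circ> (inv x \<circ> y)))"
    using fun_cong[OF conv_chi_self[of xs], of "inv x \<circ> y"] by (simp add: n conv_def)
  also have "\<dots> = (\<Sum>u\<in>Sym n. chi xs (inv x \<circ> u) * chi xs (inv (inv x \<circ> u) \<circ> (inv x \<circ> y)))"
    by (rule sum_Sym_left[OF Sym_inv[OF x], symmetric])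
  also have "\<dots> = (\<Sum>u\<in>Sym n. chi xs (inv u \<circ> x) * chi xs (inv u \<circ> y))"
  proof (rule sum.cong[OF refl])
    fix u assume u: "u \<in> Sym n"
    have "inv (inv x \<circ> u) = inv u \<circ> x"
      by (simp add: Sym_inv_comp[OF Sym_inv[OF x] u] Sym_inv_inv[OF x])
    moreover have "chi xs (inv (inv x \<circ> u)) = chi xs (inv x \<circ> u)"
      by (rule chi_inv) (use Sym_comp[OF Sym_inv[OF x] u] n in simp)
    ultimately show "chi xs (inv x \<circ> u) * chi xs (inv (inv x \<circ> u) \<circ> (inv x \<circ> y))
        = chi xs (inv u \<circ> x) * chi xs (inv u \<circ> y)"
      by (simp add: o_assoc Sym_cancel[OF x])
  qed
  finally show ?thesis .
qed

text \<open>Each \<open>chi\<close> is a positive definite kernel, hence so is a product of three of them: up to a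
  positive factor the Kronecker coefficient is a sum of squares.\<close>

lemma kronecker_pos:
  assumes n: "sum_list xs = n" "sum_list ys = n"
    and uvt: "u \<in> Sym n" "v \<in> Sym n" "t \<in> Sym n"
    and nz: "(\<Sum>w\<in>Sym n. chi xs (inv u \<circ> w) * chi xs (inv v \<circ> w) * chi ys (inv t \<circ> w)) \<noteq> 0"
  shows "kronecker xs xs ys > 0"
proof -
  let ?G = "Sym n" and ?T = "Sym n \<times> Sym n \<times> Sym n"
  \<comment> \<open>Products of the Gram vectors of the three factors, which are Gram vectors for
    the product kernel \<open>F\<close>.\<close>
  define A where "A = (\<lambda>(u, v, t) (w :: nat \<Rightarrow> nat). chi xs (inv u \<circ> w) * chi xs (inv v \<circ> w) * chi ys (inv t \<circ> w))"
  define F where "F w = chi xs w * chi xs w * chi ys w" for w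
  define K where "K = kappa xs * kappa xs * kappa ys"
  have A_real: "A \<tau> w \<in> \<real>" for \<tau> w
    by (auto simp: A_def chi_Reals split: prod.split)
  have kernel: "K * F (inv x \<circ> y) = (\<Sum>\<tau>\<in>?T. A \<tau> x * A \<tau> y)" if x: "x \<in> ?G" for x y
  proof -
    have "K * F (inv x \<circ> y) = (kappa xs * chi xs (inv x \<circ> y)) * ((kappa xs * chi xs (inv x \<circ> y)) * (kappa ys * chi ys (inv x \<circ> y)))"
      by (simp add: K_def F_def mult_ac)
    also have "\<dots> = (\<Sum>\<tau>\<in>?T. A \<tau> x * A \<tau> y)"
      unfolding chi_kernel[OF n(1) x] chi_kernel[OF n(2) x] sum_product sum.cartesian_product
      by (rule sum.cong[OF refl]) (auto simp: A_def mult_ac)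
    finally show ?thesis .
  qed
  \<comment> \<open>Summed over all x and y, the kernel gives n! times the sum of \<open>F\<close>
    by translation invariance, and a sum of squares by the Gram form.\<close>
  have "fact n * (K * (\<Sum>w\<in>?G. F w)) = (\<Sum>x\<in>?G. \<Sum>y\<in>?G. K * F (inv x \<circ> y))"
    by (simp add: sum_Sym_left[OF Sym_inv] card_permutations flip: sum_distrib_left)
  also have "\<dots> = (\<Sum>\<tau>\<in>?T. (\<Sum>x\<in>?G. A \<tau> x) * (\<Sum>x\<in>?G. A \<tau> x))"
  proof -
    have "(\<Sum>x\<in>?G. \<Sum>y\<in>?G. K * F (inv x \<circ> y)) = (\<Sum>x\<in>?G. \<Sum>y\<in>?G. \<Sum>\<tau>\<in>?T. A \<tau> x * A \<tau> y)"
      by (intro sum.cong refl kernel)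
    also have "\<dots> = (\<Sum>\<tau>\<in>?T. \<Sum>x\<in>?G. \<Sum>y\<in>?G. A \<tau> x * A \<tau> y)"
      by (rule trans[OF sum.cong[OF refl sum.swap] sum.swap])
    finally show ?thesis
      by (simp add: sum_product)
  qed
  also have "\<dots> = of_real (\<Sum>\<tau>\<in>?T. (Re (\<Sum>x\<in>?G. A \<tau> x))\<^sup>2)"
    by (intro sum_real_squares sum_in_Reals A_real)
  finally have eq: "fact n * (K * (\<Sum>w\<in>?G. F w)) = of_real (\<Sum>\<tau>\<in>?T. (Re (\<Sum>x\<in>?G. A \<tau> x))\<^sup>2)" .
  have "(\<Sum>x\<in>?G. A (u, v, t) x) \<noteq> 0"
    using nz by (simp add: A_def)
  moreover have "(\<Sum>x\<in>?G. A (u, v, t) x) \<in> \<real>"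
    by (intro sum_in_Reals A_real)
  ultimately have "Re (\<Sum>x\<in>?G. A (u, v, t) x) \<noteq> 0"
    by (metis of_real_0 of_real_Re)
  then have pos: "(\<Sum>\<tau>\<in>?T. (Re (\<Sum>x\<in>?G. A \<tau> x))\<^sup>2) > 0"
    by (intro sum_pos2[of _ "(u, v, t)"]) (use uvt finite_Sym[of n] in \<open>auto simp: zero_less_power2\<close>)
  obtain k l where kl: "kappa xs = of_real k" "kappa ys = of_real l" "k > 0" "l > 0"
    using kappa_pos[of xs] kappa_pos[of ys] by (auto elim!: Reals_cases)
  have "kronecker xs xs ys = (\<Sum>w\<in>?G. F w) / fact n"
    unfolding F_def by (rule kronecker_eq_sum[OF n])
  also have "\<dots> = of_real ((\<Sum>\<tau>\<in>?T. (Re (\<Sum>x\<in>?G. A \<tau> x))\<^sup>2) / (fact n * fact n * (k * k * l)))"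
    using eq kl by (simp add: K_def field_simps)
  finally have "kronecker xs xs ys = of_real ((\<Sum>\<tau>\<in>?T. (Re (\<Sum>x\<in>?G. A \<tau> x))\<^sup>2) / (fact n * fact n * (k * k * l)))" .
  moreover have "(\<Sum>\<tau>\<in>?T. (Re (\<Sum>x\<in>?G. A \<tau> x))\<^sup>2) / (fact n * fact n * (k * k * l)) > 0"
    using pos kl by simp
  ultimately show ?thesis
    by (simp only: less_complex_def Re_complex_of_real Im_complex_of_real zero_complex.sel simp_thms)
qed

text \<open>Since \<open>chi\<close> reproduces the Young symmetrizer up to \<open>kappa\<close>,
  conjugates of the latter are combinations of translates of \<open>chi\<close>, the functions that
  occur in \<open>kronecker_pos\<close>.\<close>

lemma young_symmetrizer_conjugate_expansion:
  assumes n: "sum_list xs = n" and g: "g \<in> Sym n" and w: "w \<in> Sym n"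
  shows "kappa xs * young_symmetrizer xs (g \<circ> w \<circ> inv g)
    = (\<Sum>u\<in>Sym n. young_symmetrizer xs u * chi xs (inv (inv g \<circ> u \<circ> g) \<circ> w))"
proof -
  have cf: "class_fun n (chi xs)"
    using chi_class_fun[of xs] n by simp
  have "kappa xs * young_symmetrizer xs (g \<circ> w \<circ> inv g)
      = (\<Sum>u\<in>Sym n. chi xs (g \<circ> w \<circ> inv g \<circ> inv u) * young_symmetrizer xs u)"
    using fun_cong[OF conv_chi_young_symmetrizer[of xs], of "g \<circ> w \<circ> inv g"]
      conv_alt[OF Sym_comp[OF Sym_comp[OF g w] Sym_inv[OF g]]] by (simp add: n)
  also have "\<dots> = (\<Sum>u\<in>Sym n. young_symmetrizer xs u * chi xs (inv (inv g \<circ> u \<circ> g) \<circ> w))"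
  proof (rule sum.cong[OF refl])
    fix u assume u: "u \<in> Sym n"
    have inv: "inv (inv g \<circ> u \<circ> g) = inv g \<circ> inv u \<circ> g"
      by (simp add: Sym_inv_comp[OF Sym_comp[OF Sym_inv[OF g] u] g] Sym_inv_comp[OF Sym_inv[OF g] u]
          Sym_inv_inv[OF g] o_assoc)
    have "chi xs ((g \<circ> w) \<circ> (inv g \<circ> inv u)) = chi xs ((inv g \<circ> inv u) \<circ> (g \<circ> w))"
      by (rule class_fun_rotate[OF cf Sym_comp[OF Sym_inv[OF g] Sym_inv[OF u]]])
    then show "chi xs (g \<circ> w \<circ> inv g \<circ> inv u) * young_symmetrizer xs u
        = young_symmetrizer xs u * chi xs (inv (inv g \<circ> u \<circ> g) \<circ> w)"
      by (simp add: inv o_assoc mult.commute)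
  qed
  finally show ?thesis .
qed

text \<open>Some isotypic component of c still pairs nontrivially. If its Kronecker coefficient were
  not positive, all sums over products of three translated characters would vanish by
  \<open>kronecker_pos\<close>, and the pairing is a combination of such sums.\<close>

lemma ex_kronecker_pos:
  assumes n: "sum_list xs = n" and c: "c \<in> group_algebra n" and g: "g \<in> Sym n" "h \<in> Sym n"
    and nz: "(\<Sum>w\<in>Sym n. c w * (young_symmetrizer xs (g \<circ> w \<circ> inv g) * young_symmetrizer xs (h \<circ> w \<circ> inv h))) \<noteq> 0"
  obtains ys where "ys \<in> partitions_of n" "kronecker xs xs ys > 0" "conv n c (chi ys) \<noteq> (\<lambda>w. 0)"
proof -
  let ?G = "Sym n" and ?y = "young_symmetrizer xs"
  define \<phi> where "\<phi> w = ?y (g \<circ> w \<circ> inv g) * ?y (h \<circ> w \<circ> inv h)" for w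
  obtain a where a: "\<And>w. c w = (\<Sum>ys\<in>partitions_of n. a ys * conv n c (chi ys) w)"
    using chi_expansion[OF c] by blast
  have "(\<Sum>w\<in>?G. c w * \<phi> w) = (\<Sum>ys\<in>partitions_of n. a ys * (\<Sum>w\<in>?G. conv n c (chi ys) w * \<phi> w))"
    by (subst a) (simp add: sum_distrib_right sum_distrib_left mult.assoc sum.swap[of _ ?G])
  then obtain ys where ys: "ys \<in> partitions_of n" and nz': "(\<Sum>w\<in>?G. conv n c (chi ys) w * \<phi> w) \<noteq> 0"
    using nz unfolding \<phi>_def by (metis (no_types, lifting) mult_zero_right sum.not_neutral_contains_not_neutral)
  have n': "sum_list ys = n"
    using partitions_of_sum[OF ys] .
  have "kronecker xs xs ys > 0"
  proof (rule ccontr)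
    assume no: "\<not> kronecker xs xs ys > 0"
    define B where "B u v t w = chi xs (inv u \<circ> w) * chi xs (inv v \<circ> w) * chi ys (inv t \<circ> w)" for u v t w :: "nat \<Rightarrow> nat"
    have zero: "(\<Sum>w\<in>?G. B u v t w) = 0" if "u \<in> ?G" "v \<in> ?G" "t \<in> ?G" for u v t
      using kronecker_pos[OF n n' that] no by (auto simp: B_def)
    define b where "b g u = inv g \<circ> u \<circ> g" for g u :: "nat \<Rightarrow> nat"
    have b: "b k u \<in> ?G" if "k \<in> ?G" "u \<in> ?G" for k u
      unfolding b_def by (intro Sym_comp Sym_inv that)
    have "kappa xs * kappa xs * (\<Sum>w\<in>?G. conv n c (chi ys) w * \<phi> w)
      = (\<Sum>w\<in>?G. conv n c (chi ys) w * ((kappa xs * ?y (g \<circ> w \<circ> inv g)) * (kappa xs * ?y (h \<circ> w \<circ> inv h))))"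
      by (simp add: \<phi>_def sum_distrib_left mult_ac)
    also have "\<dots> = (\<Sum>w\<in>?G. \<Sum>(t, u, v)\<in>?G \<times> ?G \<times> ?G. c t * ?y u * ?y v * B (b g u) (b h v) t w)"
    proof (rule sum.cong[OF refl])
      fix w assume w: "w \<in> ?G"
      show "conv n c (chi ys) w * ((kappa xs * ?y (g \<circ> w \<circ> inv g)) * (kappa xs * ?y (h \<circ> w \<circ> inv h)))
        = (\<Sum>(t, u, v)\<in>?G \<times> ?G \<times> ?G. c t * ?y u * ?y v * B (b g u) (b h v) t w)"
        unfolding young_symmetrizer_conjugate_expansion[OF n g(1) w]
          young_symmetrizer_conjugate_expansion[OF n g(2) w] conv_def sum_product sum.cartesian_product
        by (rule sum.cong[OF refl]) (auto simp: B_def b_def mult_ac)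
    qed
    also have "\<dots> = (\<Sum>(t, u, v)\<in>?G \<times> ?G \<times> ?G. c t * ?y u * ?y v * (\<Sum>w\<in>?G. B (b g u) (b h v) t w))"
      by (subst sum.swap) (simp add: case_prod_unfold sum_distrib_left)
    also have "\<dots> = 0"
      by (rule sum.neutral) (use zero b g in auto)
    finally show False
      using nz' kappa_nonzero[of xs] by simp
  qed
  moreover have "conv n c (chi ys) \<noteq> (\<lambda>w. 0)"
    using nz' by auto
  ultimately show ?thesis
    using that ys by blast
qed

section \<open>Bounds on the first row and the first column\<close>

text \<open>Here \<open>chi ys\<close> is an average of column times row factors, which puts the row
  factor next to the antisymmetrizer. The companion lemma uses the other order to put the column
  factor next to the symmetrizer.\<close>

lemma chi_conv_young_alt_nonzero:
  assumes n: "sum_list ys = n" and nz: "conv n (chi ys) (young_alt n \<theta>) \<noteq> (\<lambda>w. 0)"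
  obtains y where "y \<in> Sym n" "inj_on (\<lambda>i. (row ys i, \<theta> (inv y i))) {..<n}"
proof -
  let ?R = "young_sum n (row ys)" and ?C = "young_alt n (col ys)"
  have "average n (young_symmetrizer ys) = average n (conv n ?C ?R)"
    unfolding young_symmetrizer_eq n by (rule average_conv_commute[OF young_sum_in_GA young_alt_in_GA])
  then have "chi ys = (\<lambda>w. inverse (kappa ys) * average n (conv n ?C ?R) w)"
    by (simp add: chi_def n fun_eq_iff divide_inverse mult.commute)
  then have "conv n (average n (conv n ?C ?R)) (young_alt n \<theta>) \<noteq> (\<lambda>w. 0)"
    using nz by (auto simp: conv_scale_left)
  then obtain w where "conv n (average n (conv n ?C ?R)) (young_alt n \<theta>) w \<noteq> 0"
    by blast
  then obtain g where "conv n (conv n ?C ?R) (conv n (single (inv g)) (young_alt n \<theta>)) (inv g \<circ> w) \<noteq> 0"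
    unfolding conv_average_left using sum.not_neutral_contains_not_neutral by blast
  then have "conv n ?R (conv n (single (inv g)) (young_alt n \<theta>)) \<noteq> (\<lambda>w. 0)"
    by (auto simp: conv_assoc conv_zero_right)
  then show ?thesis
    using conv_sum_alt_nonzero that by blast
qed

lemma chi_conv_young_sum_nonzero:
  assumes n: "sum_list ys = n" and nz: "conv n (chi ys) (young_sum n \<rho>) \<noteq> (\<lambda>w. 0)"
  obtains y where "y \<in> Sym n" "inj_on (\<lambda>i. (\<rho> i, col ys (inv y i))) {..<n}"
proof -
  let ?R = "young_sum n (row ys)" and ?C = "young_alt n (col ys)"
  have "chi ys = (\<lambda>w. inverse (kappa ys) * average n (conv n ?R ?C) w)"
    by (simp add: chi_def n fun_eq_iff divide_inverse mult.commute young_symmetrizer_eq)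
  then have "conv n (average n (conv n ?R ?C)) (young_sum n \<rho>) \<noteq> (\<lambda>w. 0)"
    using nz by (auto simp: conv_scale_left)
  then obtain w where "conv n (average n (conv n ?R ?C)) (young_sum n \<rho>) w \<noteq> 0"
    by blast
  then obtain g where g: "g \<in> Sym n"
    and "conv n (conv n ?R ?C) (conv n (single (inv g)) (young_sum n \<rho>)) (inv g \<circ> w) \<noteq> 0"
    unfolding conv_average_left using sum.not_neutral_contains_not_neutral by blast
  then have "conv n ?C (conv n (single (inv g)) (young_sum n \<rho>)) \<noteq> (\<lambda>w. 0)"
    by (auto simp: conv_assoc conv_zero_right)
  then show ?thesis
    using conv_alt_sum_nonzero[OF single_in_GA[OF Sym_inv[OF g]]] that by blast
qed

lemma col_lt_hd:
  assumes "ys \<in> partitions_of n" "i < n"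
  shows "col ys i < ys ! 0"
proof -
  have n: "sum_list ys = n" "sorted_wrt (\<ge>) ys"
    using assms by (auto simp: partitions_of_def)
  have "ys ! row ys i \<le> ys ! 0"
    using n row_lt[of i ys] assms(2) sorted_wrt_nth_less[OF n(2), of 0 "row ys i"]
    by (cases "row ys i = 0") auto
  then show ?thesis
    using col_lt[of i ys] assms(2) n by simp
qed

lemma card_block_le:
  assumes "inj_on (\<lambda>i. (f i, g i)) {..<n::nat}" "\<And>i. i < n \<Longrightarrow> g i < (m::nat)"
  shows "card {i. i < n \<and> f i = r} \<le> m"
proof -
  have "card {i. i < n \<and> f i = r} \<le> card {..<m}"
    by (rule card_inj_on_le[of g]) (use assms in \<open>auto simp: inj_on_def\<close>)
  then show ?thesis
    by simp
qed

lemma card_block_le_image: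
  assumes "inj_on (\<lambda>i. (f i, g i)) {..<n::nat}"
  shows "card {i. i < n \<and> g i = r} \<le> card (f ` {..<n})"
  by (rule card_inj_on_le[of f]) (use assms in \<open>auto simp: inj_on_def\<close>)

text \<open>As \<open>chi ys\<close> is central, its product with each of the two factors is
  nonzero. This makes the pairs of block and column index, and of block and row index, injective up
  to a permutation; fixing either component gives the bounds.\<close>

lemma shape_bounds:
  assumes ys: "ys \<in> partitions_of n" and n: "n > 0"
    and nz: "conv n (conv n (young_sum n \<rho>) (young_alt n \<theta>)) (chi ys) \<noteq> (\<lambda>w. 0)"
  shows "card {i. i < n \<and> \<rho> i = r} \<le> ys ! 0" "length ys \<le> card (\<rho> ` {..<n})"
    "card {i. i < n \<and> \<theta> i = r'} \<le> length ys" "ys ! 0 \<le> card (\<theta> ` {..<n})"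
proof -
  have sum: "sum_list ys = n"
    by (rule partitions_of_sum[OF ys])
  have cf: "class_fun n (chi ys)"
    using chi_class_fun[of ys] sum by simp
  let ?S = "young_sum n \<rho>" and ?A = "young_alt n \<theta>"
  have A: "conv n (chi ys) ?A = conv n ?A (chi ys)" and S: "conv n (chi ys) ?S = conv n ?S (chi ys)"
    by (rule class_fun_conv_commute[OF cf young_alt_in_GA], rule class_fun_conv_commute[OF cf young_sum_in_GA])
  have "conv n (chi ys) ?A \<noteq> (\<lambda>w. 0)"
    using nz unfolding A by (auto simp: conv_assoc conv_zero_right)
  then obtain y where y: "y \<in> Sym n" "inj_on (\<lambda>i. (row ys i, \<theta> (inv y i))) {..<n}"
    by (rule chi_conv_young_alt_nonzero[OF sum])
  have "conv n (conv n ?S ?A) (chi ys) = conv n (conv n ?S (chi ys)) ?A"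
    by (simp add: conv_assoc flip: A)
  then have "conv n (chi ys) ?S \<noteq> (\<lambda>w. 0)"
    using nz unfolding S by (auto simp: conv_zero_left)
  then obtain z where z: "z \<in> Sym n" "inj_on (\<lambda>i. (\<rho> i, col ys (inv z i))) {..<n}"
    by (rule chi_conv_young_sum_nonzero[OF sum])
  show "card {i. i < n \<and> \<rho> i = r} \<le> ys ! 0"
    by (rule card_block_le[OF z(2)]) (use Sym_lt[OF Sym_inv[OF z(1)]] col_lt_hd[OF ys] in simp)
  have "length ys = card {i. i < n \<and> col ys i = 0}"
  proof -
    have "0 < a" if "a \<in> set ys" for a
      using that ys by (intro gr0I) (auto simp: partitions_of_def)
    then have "filter (\<lambda>a. 0 < a) ys = ys"
      by (simp add: filter_id_conv)
    then show ?thesis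
      using card_col[of ys 0] sum by simp
  qed
  also have "\<dots> = card {i. i < n \<and> col ys (inv z i) = 0}"
    using card_inv_label[OF z(1), of "\<lambda>i. col ys i = 0"] by simp
  also have "\<dots> \<le> card (\<rho> ` {..<n})"
    by (rule card_block_le_image[OF z(2)])
  finally show "length ys \<le> card (\<rho> ` {..<n})" .
  have "card {i. i < n \<and> \<theta> i = r'} = card {i. i < n \<and> \<theta> (inv y i) = r'}"
    using card_inv_label[OF y(1), of "\<lambda>i. \<theta> i = r'"] by simp
  also have "\<dots> \<le> length ys"
    by (rule card_block_le[where g = "row ys"])
      (use y(2) row_lt[of _ ys] sum in \<open>auto simp: inj_on_def\<close>)
  finally show "card {i. i < n \<and> \<theta> i = r'} \<le> length ys" .
  have "ys \<noteq> []"
    using sum n by auto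
  then have "{(r, c) \<in> diagram ys. r = 0} = {0} \<times> {..<ys ! 0}"
    by (auto simp: diagram_def)
  then have "ys ! 0 = card {i. i < n \<and> row ys i = 0}"
    using card_row_col[of ys "\<lambda>r c. r = 0"] sum by simp
  also have "\<dots> \<le> card ((\<lambda>i. \<theta> (inv y i)) ` {..<n})"
    by (rule card_block_le_image) (use y(2) in \<open>auto simp: inj_on_def\<close>)
  also have "(\<lambda>i. \<theta> (inv y i)) ` {..<n} = \<theta> ` {..<n}"
    using permutes_image[of "inv y" "{..<n}"] Sym_inv[OF y(1)] by (simp flip: image_image)
  finally show "ys ! 0 \<le> card (\<theta> ` {..<n})" .
qed

section \<open>Young symmetrizers of near-hooks\<close>

text \<open>The corner is left out of arm and leg: it is one of the at most two points kept fixed,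
  and 2k movable points remain.\<close>

definition arm :: "nat \<Rightarrow> nat list \<Rightarrow> nat set" where
  "arm k xs = tableau xs ` ({0} \<times> {1..k})"

definition leg :: "nat \<Rightarrow> nat list \<Rightarrow> nat set" where
  "leg k xs = tableau xs ` ({1..k} \<times> {0})"

text \<open>Both families at once: the box (1, 1) may be present or absent.\<close>

definition near_hook :: "nat \<Rightarrow> nat list \<Rightarrow> bool" where
  "near_hook k xs \<longleftrightarrow> {0} \<times> {..k} \<union> {..k} \<times> {0} \<subseteq> diagram xs \<and>
     diagram xs \<subseteq> insert (1, 1) ({0} \<times> {..k} \<union> {..k} \<times> {0})"

lemma near_hook_gamma1: "near_hook k (gamma1 k)"
  by (auto simp: near_hook_def diagram_gamma1)

lemma near_hook_gamma2: "1 \<le> k \<Longrightarrow> near_hook k (gamma2 k)"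
  by (auto simp: near_hook_def diagram_gamma2)

lemma arm_leg:
  assumes "near_hook k xs"
  shows "arm k xs \<subseteq> {..<sum_list xs}" "leg k xs \<subseteq> {..<sum_list xs}" "arm k xs \<inter> leg k xs = {}"
    "card (arm k xs) = k" "card (leg k xs) = k"
proof -
  have sub: "{0} \<times> {1..k} \<subseteq> diagram xs" "{1..k} \<times> {0} \<subseteq> diagram xs"
    using assms by (auto simp: near_hook_def)
  have inj: "inj_on (tableau xs) (diagram xs)"
    using bij_betw_tableau[of xs] by (simp add: bij_betw_def)
  show "arm k xs \<subseteq> {..<sum_list xs}" "leg k xs \<subseteq> {..<sum_list xs}"
    using sub tableau_lt[of _ xs] by (auto simp: arm_def leg_def)
  show "arm k xs \<inter> leg k xs = {}"
    unfolding arm_def leg_def inj_on_image_Int[OF inj sub, symmetric] by auto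
  show "card (arm k xs) = k" "card (leg k xs) = k"
    unfolding arm_def leg_def using sub
    by (simp_all add: card_image[OF inj_on_subset[OF inj]] card_cartesian_product)
qed

lemma in_arm_iff:
  assumes "near_hook k xs" "i < sum_list xs"
  shows "i \<in> arm k xs \<longleftrightarrow> row xs i = 0 \<and> col xs i \<noteq> 0" "i \<in> leg k xs \<longleftrightarrow> row xs i \<noteq> 0 \<and> col xs i = 0"
proof -
  note D = tableau_row_col[OF assms(2)]
  have sub: "{0} \<times> {1..k} \<subseteq> diagram xs" "{1..k} \<times> {0} \<subseteq> diagram xs"
    using assms(1) by (auto simp: near_hook_def)
  have D': "(row xs i, col xs i) \<in> insert (1, 1) ({0} \<times> {..k} \<union> {..k} \<times> {0})"
    using D(1) assms(1) unfolding near_hook_def by blast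
  show "i \<in> arm k xs \<longleftrightarrow> row xs i = 0 \<and> col xs i \<noteq> 0"
  proof
    assume "row xs i = 0 \<and> col xs i \<noteq> 0"
    then have "(row xs i, col xs i) \<in> {0} \<times> {1..k}"
      using D' by auto
    then show "i \<in> arm k xs"
      unfolding arm_def using D(2) by (metis image_eqI)
  qed (use sub row_col_tableau[of _ xs] in \<open>auto simp: arm_def\<close>)
  show "i \<in> leg k xs \<longleftrightarrow> row xs i \<noteq> 0 \<and> col xs i = 0"
  proof
    assume "row xs i \<noteq> 0 \<and> col xs i = 0"
    then have "(row xs i, col xs i) \<in> {1..k} \<times> {0}"
      using D' by auto
    then show "i \<in> leg k xs"
      unfolding leg_def using D(2) by (metis image_eqI)
  qed (use sub row_col_tableau[of _ xs] in \<open>auto simp: leg_def\<close>)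
qed

lemma Sym_image_eq_iff: "v \<in> Sym n \<Longrightarrow> finite T \<Longrightarrow> v ` T = T \<longleftrightarrow> v ` T \<subseteq> T"
  using endo_inj_surj[of T v] permutes_inj_on[of v "{..<n}" T] by auto

lemma restrict_id_Sym:
  assumes "v \<in> Sym n" "v ` T = T" "T \<subseteq> {..<n}"
  shows "restrict_id v T \<in> Sym n"
proof -
  have "bij_betw v T T"
    using assms permutes_inj_on[of v "{..<n}" T] by (simp add: bij_betw_def)
  then show ?thesis
    using permutes_subset[OF permutes_restrict_id assms(3)] by simp
qed

text \<open>On the permutations that move only arm and leg, the Young symmetrizer of a near-hook is the
  diagonal matrix coefficient, at the leg, of the \<open>k\<close>-th exterior power of the permutation
  representation on arm and leg.\<close>

lemma young_symmetrizer_near_hook: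
  assumes nh: "near_hook k xs" and v: "v \<in> Sym (sum_list xs)"
    and fixed: "\<And>i. i \<notin> arm k xs \<union> leg k xs \<Longrightarrow> v i = i"
  shows "young_symmetrizer xs v =
    (if v ` leg k xs = leg k xs then of_int (sign (restrict_id v (leg k xs))) else 0)"
proof -
  let ?n = "sum_list xs" and ?S = "arm k xs" and ?T = "leg k xs"
  note al = arm_leg[OF nh] and iff = in_arm_iff[OF nh]
  have finT: "finite ?T" and finS: "finite ?S"
    using al(1,2) finite_subset by blast+
  have inj: "inj v"
    using v permutes_inj by blast
  have zero: "v ` ?T = ?T" if nz: "young_symmetrizer xs v \<noteq> 0"
  proof -
    obtain p q where p: "p \<in> young ?n (row xs)" and q: "q \<in> young ?n (col xs)" and vpq: "v = p \<circ> q"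
      using nz by (rule young_symmetrizer_nonzero_imp)
    note pS = young_Sym[OF p] and qS = young_Sym[OF q]
    have row_p: "row xs (p i) = row xs i" if "i < ?n" for i
      using p that by (simp add: young_def)
    have col_q: "col xs (q i) = col xs i" if "i < ?n" for i
      using q that by (simp add: young_def)
    have lt: "q i < ?n" "p i < ?n" "v i < ?n" if "i < ?n" for i
      using that Sym_lt[OF qS] Sym_lt[OF pS] Sym_lt[OF v] by auto
    define \<alpha> where "\<alpha> = tableau xs (0, 0)"
    have D0: "(0, 0) \<in> diagram xs"
      using nh by (auto simp: near_hook_def)
    have \<alpha>: "\<alpha> < ?n" "row xs \<alpha> = 0" "col xs \<alpha> = 0"
      using tableau_lt[OF D0] row_col_tableau[OF D0] by (auto simp: \<alpha>_def)
    \<comment> \<open>As v fixes the corner, q keeps the corner in the first row and therefore fixes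
      it. So q sends no leg entry to the corner.\<close>
    have "v \<alpha> = \<alpha>"
      using fixed iff[OF \<alpha>(1)] \<alpha> by blast
    then have "row xs (q \<alpha>) = 0"
      using row_p[OF lt(1)[OF \<alpha>(1)]] \<alpha> by (simp add: vpq)
    then have q\<alpha>: "q \<alpha> = \<alpha>"
      using col_q[OF \<alpha>(1)] \<alpha> lt(1)[OF \<alpha>(1)] row_col_inj[of "q \<alpha>" xs \<alpha>] by simp
    have "v t \<in> ?T" if t: "t \<in> ?T" for t
    proof -
      have tn: "t < ?n"
        using t al(2) by blast
      have t': "row xs t \<noteq> 0" "col xs t = 0"
        using iff(2)[OF tn] t by auto
      have "q t \<noteq> \<alpha>"
        using q\<alpha> t' \<alpha> Sym_cancel(7)[OF qS] by metis
      then have "row xs (q t) \<noteq> 0"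
        using row_col_inj[of "q t" xs \<alpha>] lt(1)[OF tn] \<alpha> col_q[OF tn] t' by auto
      then have r: "row xs (v t) \<noteq> 0"
        using row_p[OF lt(1)[OF tn]] by (simp add: vpq)
      have "col xs (v t) = 0"
      proof (rule ccontr)
        \<comment> \<open>An entry outside the first row and the first column is fixed by v, so
          injectivity would give \<open>v t = t\<close>.\<close>
        assume c: "col xs (v t) \<noteq> 0"
        then have "v t \<notin> ?S \<union> ?T"
          using r iff[OF lt(3)[OF tn]] by simp
        then have "v (v t) = v t"
          by (rule fixed)
        then have "v t = t"
          using inj by (simp add: inj_eq)
        then show False
          using c t' by simp
      qed
      then show ?thesis
        using r iff(2)[OF lt(3)[OF tn]] by simp
    qed
    then show ?thesis
      using Sym_image_eq_iff[OF v finT] by blast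
  qed
  show ?thesis
  proof (cases "v ` ?T = ?T")
    case True
    have "v ` ?S \<subseteq> ?S"
    proof
      fix j assume "j \<in> v ` ?S"
      then obtain i where i: "i \<in> ?S" "j = v i"
        by blast
      have "j \<notin> ?T"
        using True i al(3) inj by (metis disjoint_iff imageE inj_eq)
      moreover have "j \<in> ?S \<union> ?T"
      proof (rule ccontr)
        assume "j \<notin> ?S \<union> ?T"
        then have "v j = v i"
          using fixed i by simp
        then show False
          using inj i \<open>j \<notin> ?S \<union> ?T\<close> by (simp add: inj_eq)
      qed
      ultimately show "j \<in> ?S"
        by blast
    qed
    then have S: "v ` ?S = ?S"
      using Sym_image_eq_iff[OF v finS] by blast
    have "restrict_id v ?S \<in> young ?n (row xs)"
    proof -
      have "row xs (v i) = row xs i" if "i \<in> ?S" for i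
        using that S al(1) iff(1)[of i] iff(1)[of "v i"] Sym_lt[OF v, of i] by auto
      then show ?thesis
        using restrict_id_Sym[OF v S al(1)] by (auto simp: young_def restrict_id_def)
    qed
    moreover have "restrict_id v ?T \<in> young ?n (col xs)"
    proof -
      have "col xs (v i) = col xs i" if "i \<in> ?T" for i
        using that True al(2) iff(2)[of i] iff(2)[of "v i"] Sym_lt[OF v, of i] by auto
      then show ?thesis
        using restrict_id_Sym[OF v True al(2)] by (auto simp: young_def restrict_id_def)
    qed
    \<comment> \<open>The arm part is a row permutation and the leg part a column permutation, so
      only the leg contributes its sign.\<close>
    moreover have "v = restrict_id v ?S \<circ> restrict_id v ?T"
    proof
      fix i
      have "v i \<notin> ?S" if "i \<in> ?T"
        using that True al(3) by blast
      then show "v i = (restrict_id v ?S \<circ> restrict_id v ?T) i"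
        using fixed[of i] by (auto simp: restrict_id_def)
    qed
    ultimately show ?thesis
      using young_symmetrizer_product True by metis
  qed (use zero in auto)
qed

lemma ex_Sym_images:
  assumes A: "A \<subseteq> {..<n}" "A' \<subseteq> {..<n}" "A \<inter> A' = {}" and B: "B \<subseteq> {..<n}" "B' \<subseteq> {..<n}" "B \<inter> B' = {}"
    and card: "card A = card B" "card A' = card B'"
  obtains u where "u \<in> Sym n" "u ` A = B" "u ` A' = B'"
proof -
  have fin: "finite A" "finite A'" "finite B" "finite B'"
    using A B finite_subset by blast+
  let ?A = "{..<n} - A - A'" and ?B = "{..<n} - B - B'"
  have "{..<n} - C - C' = {..<n} - (C \<union> C')" for C C'
    by blast
  then have "card ?A = card ?B"
    using A B fin card by (simp add: card_Diff_subset card_Un_disjoint)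
  then obtain h where h: "bij_betw h ?A ?B"
    using finite_same_card_bij[of ?A ?B] by auto
  obtain f g where f: "bij_betw f A B" and g: "bij_betw g A' B'"
    using finite_same_card_bij fin card by metis
  define u where "u i = (if i \<in> A then f i else if i \<in> A' then g i else if i < n then h i else i)" for i
  have 1: "bij_betw u A B"
    using f by (subst bij_betw_cong[of A u f]) (auto simp: u_def)
  have 2: "bij_betw u A' B'"
    using g A(3) by (subst bij_betw_cong[of A' u g]) (auto simp: u_def)
  have 3: "bij_betw u ?A ?B"
    using h by (subst bij_betw_cong[of ?A u h]) (auto simp: u_def)
  have "bij_betw u (A \<union> A' \<union> ?A) (B \<union> B' \<union> ?B)"
    using bij_betw_combine[OF bij_betw_combine[OF 1 2 B(3)] 3] by blast
  moreover have "A \<union> A' \<union> ?A = {..<n}" "B \<union> B' \<union> ?B = {..<n}"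
    using A B by auto
  ultimately have "u permutes {..<n}"
    using A by (intro bij_imp_permutes) (auto simp: u_def)
  then show ?thesis
    using that 1 2 by (auto simp: bij_betw_def)
qed

lemma restrict_id_conjugate:
  assumes u: "u \<in> Sym n" and w: "w \<in> Sym n" "w ` A = A" "A \<subseteq> {..<n}"
  shows "sign (restrict_id (u \<circ> w \<circ> inv u) (u ` A)) = sign (restrict_id w A)"
proof -
  have "restrict_id (u \<circ> w \<circ> inv u) (u ` A) = u \<circ> restrict_id w A \<circ> inv u"
  proof
    fix i
    have "i \<in> u ` A \<longleftrightarrow> inv u i \<in> A"
      using Sym_cancel(7,8)[OF u] by (metis image_iff)
    then show "restrict_id (u \<circ> w \<circ> inv u) (u ` A) i = (u \<circ> restrict_id w A \<circ> inv u) i"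
      using Sym_cancel(8)[OF u] by (simp add: restrict_id_def)
  qed
  moreover have "restrict_id w A \<in> Sym n"
    by (rule restrict_id_Sym[OF w])
  ultimately show ?thesis
    by (simp only: sign_comp[OF Sym_comp[OF u] Sym_inv[OF u]] sign_comp[OF u] sign_inv[OF u])
      (simp add: mult.commute)
qed

text \<open>Conjugation by a permutation that sends A to the leg and the rest of
  \<open>{..<2 * k}\<close> to the arm.\<close>

lemma near_hook_exterior_coefficient:
  assumes nh: "near_hook k xs" and n: "sum_list xs = n" and k: "2 * k \<le> n"
    and A: "A \<subseteq> {..<2 * k}" "card A = k"
  obtains u where "u \<in> Sym n"
    "\<And>w. w \<in> Sym n \<Longrightarrow> (\<And>i. 2 * k \<le> i \<Longrightarrow> w i = i) \<Longrightarrow>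
      young_symmetrizer xs (u \<circ> w \<circ> inv u) = (if w ` A = A then of_int (sign (restrict_id w A)) else 0)"
proof -
  let ?S = "arm k xs" and ?T = "leg k xs"
  note al = arm_leg[OF nh, unfolded n]
  have sub: "A \<subseteq> {..<n}" "{..<2 * k} - A \<subseteq> {..<n}" and disj: "A \<inter> ({..<2 * k} - A) = {}" "?T \<inter> ?S = {}"
    using A k al(3) by auto
  have "card ({..<2 * k} - A) = card ?S" "card A = card ?T"
    using A al by (simp_all add: card_Diff_subset finite_subset)
  then obtain u where u: "u \<in> Sym n" "u ` A = ?T" "u ` ({..<2 * k} - A) = ?S"
    using ex_Sym_images[OF sub disj(1) al(2,1) disj(2)] by blast
  show ?thesis
  proof (rule that[OF u(1)])
    fix w assume w: "w \<in> Sym n" and fixed: "\<And>i. 2 * k \<le> i \<Longrightarrow> w i = i"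
    let ?v = "u \<circ> w \<circ> inv u"
    have v: "?v \<in> Sym n"
      by (intro Sym_comp Sym_inv u w)
    have "?v i = i" if "i \<notin> ?S \<union> ?T" for i
    proof -
      have "i \<notin> u ` {..<2 * k}"
        using that u A by blast
      then have "inv u i \<notin> {..<2 * k}"
        using Sym_cancel(8)[OF u(1)] by (metis imageI)
      then show ?thesis
        using fixed[of "inv u i"] Sym_cancel(8)[OF u(1)] by simp
    qed
    then have "young_symmetrizer xs ?v = (if ?v ` ?T = ?T then of_int (sign (restrict_id ?v ?T)) else 0)"
      by (intro young_symmetrizer_near_hook[OF nh]) (use v n in auto)
    moreover have "?v ` ?T = u ` (w ` A)"
      using u(2) Sym_cancel(7)[OF u(1)] by (auto simp: image_image simp flip: u(2))
    moreover have "u ` (w ` A) = u ` A \<longleftrightarrow> w ` A = A"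
      using permutes_inj[of u "{..<n}"] u(1) by (simp add: inj_image_eq_iff)
    ultimately show "young_symmetrizer xs ?v = (if w ` A = A then of_int (sign (restrict_id w A)) else 0)"
      using restrict_id_conjugate[OF u(1) w _ sub(1)] u(2) by auto
  qed
qed

section \<open>Kronecker constituents with prescribed first row and column\<close>

text \<open>The two \<open>k\<close>-subsets of \<open>{..<2 * k}\<close> used below are \<open>{..<h} \<union> {2 * h..<k + h}\<close> and
  \<open>{..<h} \<union> {k + h..<2 * k}\<close>, so \<open>{h..<2 * h}\<close> is the complement of their union. For \<open>h \<le> a\<close>, the nontrivial
  blocks of \<open>row_label\<close> are \<open>{..<a}\<close>, which misses the symmetric difference of the two sets, and the
  pairs \<open>{z, z + (2 * h - a)}\<close>; those of \<open>col_label\<close> are the symmetric difference \<open>{2 * h..<2 * k}\<close> and the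
  pairs \<open>{z - a, z}\<close>. Here \<open>a \<le> z < 2 * h\<close>, and the label \<open>n\<close> is not the label of any other block.\<close>

definition row_label :: "nat \<Rightarrow> nat \<Rightarrow> nat \<Rightarrow> nat" where
  "row_label h a i = (if i < a then 0 else if i < 2 * h then i + (2 * h - a) else i)"

definition col_label :: "nat \<Rightarrow> nat \<Rightarrow> nat \<Rightarrow> nat \<Rightarrow> nat \<Rightarrow> nat" where
  "col_label n k h a i =
    (if i < a then i else if i < 2 * h then i - a else if i < 2 * k then n else i)"

text \<open>p is supported in \<open>{..<a}\<close> and q in \<open>{2 * h..<2 * k}\<close>. The
  sign of p on \<open>{..<h}\<close> occurs in both coefficients and cancels, while the signs of q
  on the two differences of A and B multiply to \<open>sign q\<close>.\<close>

lemma signed_pairing_term: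
  fixes n k h a :: nat
  defines "A \<equiv> {..<h} \<union> {2 * h..<k + h}" and "B \<equiv> {..<h} \<union> {k + h..<2 * k}"
  assumes bounds: "0 < a" "h \<le> k" "h \<le> a" "a \<le> 2 * h" "4 * h \<le> 2 * k + a" "2 * k \<le> n"
    and p: "p \<in> young n (row_label h a)" and q: "q \<in> young n (col_label n k h a)"
    and wA: "(p \<circ> q) ` A = A" and wB: "(p \<circ> q) ` B = B"
  shows "sign q * sign (restrict_id (p \<circ> q) A) * sign (restrict_id (p \<circ> q) B) = 1"
proof -
  let ?Y = "{2 * h..<2 * k}" and ?w = "p \<circ> q"
  let ?L = "{2 * h..<k + h}" and ?R = "{k + h..<2 * k}"
  note pS = young_Sym[OF p] and qS = young_Sym[OF q]
  have w: "?w \<in> Sym n"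
    by (intro Sym_comp pS qS)
  have injp: "inj p" and injq: "inj q" and injw: "inj ?w"
    using pS qS w permutes_inj by blast+
  have \<rho>: "row_label h a (p i) = row_label h a i" if "i < n" for i
    using p that by (simp add: young_def)
  have \<theta>: "col_label n k h a (q i) = col_label n k h a i" if "i < n" for i
    using q that by (simp add: young_def)
  have lt: "p i < n" "q i < n" if "i < n" for i
    using that Sym_lt[OF pS] Sym_lt[OF qS] by auto
  have out: "p i = i" "q i = i" if "n \<le> i" for i
    using that pS qS permutes_not_in[of _ "{..<n}" i] by auto
  have AB: "A \<inter> B = {..<h}" "A - B = ?L" "B - A = ?R" "?L \<union> ?R = ?Y"
    using bounds by (auto simp: A_def B_def)
  have w3: "?w ` {..<h} = {..<h}" and wL: "?w ` ?L = ?L" and wR: "?w ` ?R = ?R"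
    using image_Int[OF injw, of A B] image_set_diff[OF injw, of A B] image_set_diff[OF injw, of B A]
    unfolding wA wB AB by simp_all
  have wY: "?w ` ?Y = ?Y"
    unfolding AB(4)[symmetric] image_Un wL wR ..
  have "q ` ?Y \<subseteq> ?Y"
  proof
    fix j assume "j \<in> q ` ?Y"
    then obtain i where i: "i \<in> ?Y" "j = q i"
      by blast
    then have "i < n"
      using bounds by auto
    then have "col_label n k h a j = n" "j < n"
      using \<theta>[of i] lt(2)[of i] i bounds by (auto simp: col_label_def)
    then show "j \<in> ?Y"
      by (auto simp: col_label_def split: if_splits)
  qed
  then have qY: "q ` ?Y = ?Y"
    using Sym_image_eq_iff[OF qS finite_atLeastLessThan] by blast
  \<comment> \<open>p preserves \<open>?Y\<close> because q and \<open>?w\<close> do, and no two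
    points of \<open>?Y\<close> have the same row label.\<close>
  have pY: "p i = i" if i: "i \<in> ?Y" for i
  proof -
    obtain j where j: "j \<in> ?Y" "i = q j"
      using qY i by blast
    then have "p i \<in> ?Y"
      using wY by auto
    moreover have "i < n"
      using i bounds by auto
    ultimately show ?thesis
      using \<rho>[of i] i bounds by (auto simp: row_label_def)
  qed
  have p_fix: "p i = i" if i: "a \<le> i" for i
  proof (cases "i < n")
    case True
    show ?thesis
    proof (cases "i < 2 * h")
      case z: True
      \<comment> \<open>The partner of i in its two-element block. The bound
        \<open>4 * h \<le> 2 * k + a\<close> places it in \<open>?Y\<close>, where p is already the
        identity.\<close>
      let ?y = "i + (2 * h - a)"
      have y: "?y \<in> ?Y" "row_label h a (p i) = ?y"
        using i z \<rho>[OF True] bounds by (auto simp: row_label_def)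
      have "p i \<noteq> ?y"
      proof
        assume "p i = ?y"
        then have "p i = p ?y"
          using pY[OF y(1)] by simp
        then have "i = ?y"
          using injp by (simp only: inj_eq)
        then show False
          using y(1) z by (metis atLeastLessThan_iff not_le)
      qed
      then show ?thesis
        using y(2) bounds(1) i by (simp add: row_label_def split: if_splits)
    next
      case z: False
      show ?thesis
      proof (cases "i < 2 * k")
        case True
        then show ?thesis
          using pY z by simp
      next
        case False
        then show ?thesis
          using \<rho>[OF True] z i bounds by (auto simp: row_label_def split: if_splits)
      qed
    qed
  qed (use out in simp)
  \<comment> \<open>A moved i would be exchanged with \<open>i - a\<close>, which lies in
    \<open>{..<h}\<close>. Then \<open>?w\<close> would send that point to i, which is at least h,
    contrary to \<open>w3\<close>.\<close>
  have q_mid: "q i = i" if i: "a \<le> i" "i < 2 * h" for i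
  proof (rule ccontr)
    assume ne: "q i \<noteq> i"
    have "i < n"
      using i bounds by simp
    then have x: "q i = i - a"
      using \<theta>[of i] lt[of i] ne i bounds by (auto simp: col_label_def split: if_splits)
    have xn: "i - a < n" "i - a < a" "i - a < h"
      using i bounds by auto
    have "q (i - a) \<noteq> i - a"
    proof
      assume "q (i - a) = i - a"
      then have "q (i - a) = q i"
        using x by simp
      then have "i - a = i"
        using injq by (simp only: inj_eq)
      then show False
        using bounds i by simp
    qed
    then have "q (i - a) = i"
      using \<theta>[OF xn(1)] lt(2)[OF xn(1)] xn i bounds by (auto simp: col_label_def split: if_splits)
    then have "?w (i - a) = i"
      using p_fix[OF i(1)] by simp
    moreover have "?w (i - a) \<in> ?w ` {..<h}"
      using xn(3) by (intro imageI) simp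
    ultimately have "i < h"
      unfolding w3 by simp
    then show False
      using i(1) bounds(3) by linarith
  qed
  have q_fix: "q i = i" if i: "i \<notin> ?Y" for i
  proof (cases "i < n")
    case n: True
    consider "i < a" | "a \<le> i" "i < 2 * h" | "2 * k \<le> i"
      using i by (metis atLeastLessThan_iff not_le)
    then show ?thesis
    proof cases
      case 1
      show ?thesis
      proof (rule ccontr)
        assume "q i \<noteq> i"
        then have j: "a \<le> q i" "q i < 2 * h"
          using \<theta>[OF n] lt(2)[OF n] 1 n bounds by (auto simp: col_label_def split: if_splits)
        then have "q (q i) = q i"
          by (rule q_mid)
        then have "q i = i"
          using injq by (simp only: inj_eq)
        then show False
          using \<open>q i \<noteq> i\<close> by simp
      qed
    next
      case 3
      then show ?thesis
        using \<theta>[OF n] lt(2)[OF n] n bounds by (auto simp: col_label_def split: if_splits)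
    qed (rule q_mid)
  qed (use out in simp)
  have sub: "{..<h} \<subseteq> {..<n}" "?L \<subseteq> {..<n}" "?R \<subseteq> {..<n}"
    using bounds by auto
  have pqY: "p (q i) = q i" if "i \<in> ?Y" for i
    using that qY pY by blast
  have "p ` {..<h} = {..<h}" and qL: "q ` ?L = ?L" and qR: "q ` ?R = ?R"
  proof -
    have "?w ` {..<h} = p ` {..<h}"
      by (rule image_cong[OF refl]) (use q_fix bounds in auto)
    then show "p ` {..<h} = {..<h}"
      using w3 by simp
    have im: "?w ` C = q ` C" if "C \<subseteq> ?Y" for C
      using that pqY by (intro image_cong refl) auto
    have "?L \<subseteq> ?Y" "?R \<subseteq> ?Y"
      using bounds by auto
    then show "q ` ?L = ?L" "q ` ?R = ?R"
      using im[of ?L] im[of ?R] wL wR by simp_all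
  qed
  then have S: "restrict_id p {..<h} \<in> Sym n" "restrict_id q ?L \<in> Sym n" "restrict_id q ?R \<in> Sym n"
    using restrict_id_Sym[OF pS _ sub(1)] restrict_id_Sym[OF qS _ sub(2)] restrict_id_Sym[OF qS _ sub(3)]
    by blast+
  have wi: "?w i = (if i \<in> ?Y then q i else p i)" for i
    using q_fix[of i] pqY[of i] by (cases "i \<in> ?Y") auto
  have Lq: "q i \<in> ?L" if "i \<in> ?L" for i
    using qL that by blast
  have Rq: "q i \<in> ?R" if "i \<in> ?R" for i
    using qR that by blast
  have rA: "restrict_id ?w A = restrict_id p {..<h} \<circ> restrict_id q ?L"
  proof
    fix i
    show "restrict_id ?w A i = (restrict_id p {..<h} \<circ> restrict_id q ?L) i"
      using wi[of i] Lq[of i] bounds by (auto simp: restrict_id_def A_def)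
  qed
  have rB: "restrict_id ?w B = restrict_id p {..<h} \<circ> restrict_id q ?R"
  proof
    fix i
    show "restrict_id ?w B i = (restrict_id p {..<h} \<circ> restrict_id q ?R) i"
      using wi[of i] Rq[of i] bounds by (auto simp: restrict_id_def B_def)
  qed
  have "q = restrict_id q ?L \<circ> restrict_id q ?R"
  proof
    fix i
    show "q i = (restrict_id q ?L \<circ> restrict_id q ?R) i"
      using q_fix[of i] Rq[of i] by (auto simp: restrict_id_def)
  qed
  then have sq: "sign q = sign (restrict_id q ?L) * sign (restrict_id q ?R)"
    using sign_comp[OF S(2,3)] by simp
  show ?thesis
    unfolding rA rB sq sign_comp[OF S(1,2)] sign_comp[OF S(1,3)] by (simp add: mult_ac)
qed

lemma sum_conv:
  "(\<Sum>w\<in>Sym n. conv n f g w * \<phi> w) = (\<Sum>p\<in>Sym n. \<Sum>q\<in>Sym n. f p * g q * \<phi> (p \<circ> q))"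
proof -
  have "(\<Sum>w\<in>Sym n. conv n f g w * \<phi> w) = (\<Sum>p\<in>Sym n. \<Sum>w\<in>Sym n. f p * g (inv p \<circ> w) * \<phi> w)"
    unfolding conv_def sum_distrib_right by (rule sum.swap)
  also have "\<dots> = (\<Sum>p\<in>Sym n. \<Sum>q\<in>Sym n. f p * g q * \<phi> (p \<circ> q))"
  proof (rule sum.cong[OF refl])
    fix p assume p: "p \<in> Sym n"
    show "(\<Sum>w\<in>Sym n. f p * g (inv p \<circ> w) * \<phi> w) = (\<Sum>q\<in>Sym n. f p * g q * \<phi> (p \<circ> q))"
      by (subst sum_Sym_left[OF p, symmetric]) (simp only: Sym_cancel[OF p])
  qed
  finally show ?thesis .
qed

text \<open>The points of \<open>{2 * k..<n}\<close> are singleton blocks of both set partitions,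
  and the points from n on are fixed in any case.\<close>

lemma label_fixes:
  assumes "0 < a" "a \<le> 2 * h" "h \<le> k" "2 * k \<le> i" "4 * h \<le> 2 * k + a" "2 * k \<le> n"
  shows "p \<in> young n (row_label h a) \<Longrightarrow> p i = i" "q \<in> young n (col_label n k h a) \<Longrightarrow> q i = i"
proof -
  show "p i = i" if p: "p \<in> young n (row_label h a)"
  proof (cases "i < n")
    case True
    then have "row_label h a (p i) = row_label h a i"
      using p by (simp add: young_def)
    then show ?thesis
      using assms by (auto simp: row_label_def split: if_splits)
  next
    case False
    then show ?thesis
      using young_Sym[OF p] permutes_not_in[of p "{..<n}" i] by simp
  qed
  show "q i = i" if q: "q \<in> young n (col_label n k h a)"
  proof (cases "i < n")
    case True
    then have "col_label n k h a (q i) = col_label n k h a i" "q i < n"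
      using q Sym_lt[OF young_Sym[OF q]] by (auto simp: young_def)
    then show ?thesis
      using assms True by (auto simp: col_label_def split: if_splits)
  next
    case False
    then show ?thesis
      using young_Sym[OF q] permutes_not_in[of q "{..<n}" i] by simp
  qed
qed

text \<open>The pairing counts the pairs (p, q) that survive, and (\<open>id\<close>,
  \<open>id\<close>) survives. In both upper bounds the slack 3 is one large block plus at most two
  points from 2k on.\<close>

lemma ex_constituent:
  assumes nh: "near_hook k xs" and n: "sum_list xs = n" "2 * k \<le> n" "n \<le> 2 * k + 2"
    and bounds: "0 < a" "h \<le> k" "h \<le> a" "a \<le> 2 * h" "4 * h \<le> 2 * k + a"
  obtains ys where "ys \<in> partitions_of n" "kronecker xs xs ys > 0"
    "a \<le> ys ! 0" "ys ! 0 \<le> a + 3" "2 * (k - h) \<le> length ys" "length ys \<le> 2 * (k - h) + 3"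
proof -
  define A where "A = {..<h} \<union> {2 * h..<k + h}"
  define B where "B = {..<h} \<union> {k + h..<2 * k}"
  let ?S = "young_sum n (row_label h a)" and ?A = "young_alt n (col_label n k h a)"
  let ?y = "young_symmetrizer xs"
  have AB: "A \<subseteq> {..<2 * k}" "B \<subseteq> {..<2 * k}"
    using bounds by (auto simp: A_def B_def)
  have disj: "{..<h} \<inter> {2 * h..<k + h} = {}" "{..<h} \<inter> {k + h..<2 * k} = {}"
    using bounds by auto
  then have card: "card A = k" "card B = k"
    using bounds by (simp_all add: A_def B_def card_Un_disjoint)
  obtain u where u: "u \<in> Sym n"
    "\<And>w. w \<in> Sym n \<Longrightarrow> (\<And>i. 2 * k \<le> i \<Longrightarrow> w i = i) \<Longrightarrow>
      ?y (u \<circ> w \<circ> inv u) = (if w ` A = A then of_int (sign (restrict_id w A)) else 0)"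
    using near_hook_exterior_coefficient[OF nh n(1,2) AB(1) card(1)] by blast
  obtain v where v: "v \<in> Sym n"
    "\<And>w. w \<in> Sym n \<Longrightarrow> (\<And>i. 2 * k \<le> i \<Longrightarrow> w i = i) \<Longrightarrow>
      ?y (v \<circ> w \<circ> inv v) = (if w ` B = B then of_int (sign (restrict_id w B)) else 0)"
    using near_hook_exterior_coefficient[OF nh n(1,2) AB(2) card(2)] by blast
  define \<tau> where "\<tau> p q = (if p \<in> young n (row_label h a) \<and> q \<in> young n (col_label n k h a) \<and>
    (p \<circ> q) ` A = A \<and> (p \<circ> q) ` B = B then 1 else 0 :: nat)" for p q
  have summand: "?S p * ?A q * (?y (u \<circ> (p \<circ> q) \<circ> inv u) * ?y (v \<circ> (p \<circ> q) \<circ> inv v)) = of_nat (\<tau> p q)" for p q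
  proof (cases "p \<in> young n (row_label h a) \<and> q \<in> young n (col_label n k h a)")
    case True
    then have p: "p \<in> young n (row_label h a)" and q: "q \<in> young n (col_label n k h a)"
      by auto
    have w: "p \<circ> q \<in> Sym n"
      by (intro Sym_comp young_Sym[OF p] young_Sym[OF q])
    have fixed: "(p \<circ> q) i = i" if "2 * k \<le> i" for i
      using label_fixes(1)[of a h k i n p] label_fixes(2)[of a h k i n q] p q bounds n that by simp
    have yu: "?y (u \<circ> (p \<circ> q) \<circ> inv u) = (if (p \<circ> q) ` A = A then of_int (sign (restrict_id (p \<circ> q) A)) else 0)"
      by (rule u(2)[OF w fixed])
    have yv: "?y (v \<circ> (p \<circ> q) \<circ> inv v) = (if (p \<circ> q) ` B = B then of_int (sign (restrict_id (p \<circ> q) B)) else 0)"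
      by (rule v(2)[OF w fixed])
    show ?thesis
    proof (cases "(p \<circ> q) ` A = A \<and> (p \<circ> q) ` B = B")
      case both: True
      have "sign q * sign (restrict_id (p \<circ> q) A) * sign (restrict_id (p \<circ> q) B) = 1"
        unfolding A_def B_def
        by (rule signed_pairing_term[OF bounds n(2) p q])
          (use both in \<open>simp_all add: A_def B_def\<close>)
      then have "of_int (sign q) * (of_int (sign (restrict_id (p \<circ> q) A)) * of_int (sign (restrict_id (p \<circ> q) B))) = (1 :: complex)"
        by (simp only: mult.assoc of_int_1 flip: of_int_mult)
      then show ?thesis
        using p q both unfolding yu yv
        by (simp add: \<tau>_def young_sum_def young_alt_def)
    next
      case False
      then show ?thesis
        unfolding yu yv by (auto simp: \<tau>_def)
    qed
  qed (auto simp: \<tau>_def young_sum_def young_alt_def)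
  have "(\<Sum>w\<in>Sym n. conv n ?S ?A w * (?y (u \<circ> w \<circ> inv u) * ?y (v \<circ> w \<circ> inv v)))
      = of_nat (\<Sum>p\<in>Sym n. \<Sum>q\<in>Sym n. \<tau> p q)"
    unfolding sum_conv summand by simp
  moreover have "(\<Sum>p\<in>Sym n. \<Sum>q\<in>Sym n. \<tau> p q) \<noteq> 0"
  proof -
    have "\<tau> id id = 1"
      by (simp add: \<tau>_def young_id)
    moreover have "\<tau> id id \<le> (\<Sum>q\<in>Sym n. \<tau> id q)"
      by (rule member_le_sum[OF Sym_id _ finite_Sym]) simp
    moreover have "\<dots> \<le> (\<Sum>p\<in>Sym n. \<Sum>q\<in>Sym n. \<tau> p q)"
      by (rule member_le_sum[OF Sym_id _ finite_Sym]) simp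
    ultimately show ?thesis
      by linarith
  qed
  ultimately have "(\<Sum>w\<in>Sym n. conv n ?S ?A w * (?y (u \<circ> w \<circ> inv u) * ?y (v \<circ> w \<circ> inv v))) \<noteq> 0"
    by (simp only: of_nat_eq_0_iff not_False_eq_True)
  then obtain ys where ys: "ys \<in> partitions_of n" "kronecker xs xs ys > 0"
    "conv n (conv n ?S ?A) (chi ys) \<noteq> (\<lambda>w. 0)"
    by (rule ex_kronecker_pos[OF n(1) conv_in_GA[OF young_alt_in_GA] u(1) v(1)])
  have "0 < n"
    using bounds n by simp
  note sh = shape_bounds[OF ys(1) this ys(3)]
  have "{i. i < n \<and> row_label h a i = 0} = {..<a}"
    using bounds n by (auto simp: row_label_def)
  then have "a \<le> ys ! 0"
    using sh(1)[of 0] by simp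
  moreover have "{i. i < n \<and> col_label n k h a i = n} = {2 * h..<2 * k}"
    using bounds n by (auto simp: col_label_def)
  then have "2 * (k - h) \<le> length ys"
    using sh(3)[of n] by (simp add: diff_mult_distrib2)
  moreover have "row_label h a ` {..<n} \<subseteq> insert 0 {2 * h..<n}"
    using bounds n by (auto simp: row_label_def)
  then have "card (row_label h a ` {..<n}) \<le> card (insert 0 {2 * h..<n})"
    by (intro card_mono) auto
  then have "length ys \<le> 2 * (k - h) + 3"
    using sh(2) n bounds by (auto simp: card_insert_if diff_mult_distrib2 split: if_splits)
  moreover have "col_label n k h a ` {..<n} \<subseteq> {..<a} \<union> insert n {2 * k..<n}"
    using bounds n by (auto simp: col_label_def)
  then have "card (col_label n k h a ` {..<n}) \<le> card ({..<a} \<union> insert n {2 * k..<n})"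
    by (intro card_mono) auto
  then have "card (col_label n k h a ` {..<n}) \<le> card {..<a} + card (insert n {2 * k..<n})"
    using card_Un_le[of "{..<a}" "insert n {2 * k..<n}"] by linarith
  then have "ys ! 0 \<le> a + 3"
    using sh(4) n by (auto simp: card_insert_if split: if_splits)
  ultimately show ?thesis
    using that ys by blast
qed

section \<open>Counting\<close>

lemma card_constituents_ge:
  assumes nh: "near_hook k xs" and n: "sum_list xs = n" "2 * k \<le> n" "n \<le> 2 * k + 2"
  shows "(k div 12 - 1)\<^sup>2 \<le> card {ys \<in> partitions_of n. kronecker xs xs ys > 0}"
proof -
  let ?s = "k div 12"
  \<comment> \<open>With \<open>a = 4 * i\<close> and \<open>h = k - 2 * j\<close> the windows for
    row and column have length 4 and are disjoint for different i or j. The lower end gives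
    \<open>k \<le> 4 * i + 2 * j\<close> and the same with i and j exchanged; the upper end gives
    \<open>4 * i + 4 * j \<le> 2 * k\<close>. These are the main inequalities of
    \<open>ex_constituent\<close>.\<close>
  let ?I = "{2 * ?s + 2..3 * ?s}"
  let ?A = "{ys \<in> partitions_of n. kronecker xs xs ys > 0}"
  have "(i, j) \<in> (\<lambda>ys. (ys ! 0 div 4, length ys div 4)) ` ?A" if ij: "i \<in> ?I" "j \<in> ?I" for i j
  proof -
    have "12 * ?s \<le> k" "k < 12 * ?s + 12"
      by simp_all
    then have b: "0 < 4 * i" "k - 2 * j \<le> k" "k - 2 * j \<le> 4 * i" "4 * i \<le> 2 * (k - 2 * j)"
      "4 * (k - 2 * j) \<le> 2 * k + 4 * i" "2 * (k - (k - 2 * j)) = 4 * j"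
      using ij by auto
    obtain ys where ys: "ys \<in> ?A" "4 * i \<le> ys ! 0" "ys ! 0 \<le> 4 * i + 3"
      "4 * j \<le> length ys" "length ys \<le> 4 * j + 3"
      using ex_constituent[OF nh n b(1-5)] unfolding b(6) by blast
    have "ys ! 0 div 4 = i" "length ys div 4 = j"
      using ys by simp_all
    then show ?thesis
      using ys(1) by (auto intro: image_eqI)
  qed
  then have "?I \<times> ?I \<subseteq> (\<lambda>ys. (ys ! 0 div 4, length ys div 4)) ` ?A"
    by auto
  then have "card (?I \<times> ?I) \<le> card ?A"
    by (rule surj_card_le[rotated]) (simp add: finite_partitions_of)
  moreover have "card (?I \<times> ?I) = (?s - 1)\<^sup>2"
    by (simp add: card_cartesian_product power2_eq_square)
  ultimately show ?thesis
    by simp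
qed

lemma ratio_tendsto_0:
  fixes b a :: "nat \<Rightarrow> nat"
  assumes b: "\<And>k. 1 \<le> k \<Longrightarrow> b k \<le> 2 * k + 2" and a: "\<And>k. 1 \<le> k \<Longrightarrow> (k div 12 - 1)\<^sup>2 \<le> a k"
  shows "(\<lambda>k. real (b k) / real (a k)) \<longlonglongrightarrow> 0"
proof (rule tendsto_sandwich[where f = "\<lambda>_. 0"])
  show "\<forall>\<^sub>F k in sequentially. real (b k) / real (a k) \<le> 2304 / real k"
    \<comment> \<open>From 48 on, \<open>k div 12 - 1\<close> is at least k / 24. The numerator is
      at most 4k, whence 2304 = 4 * 24 * 24.\<close>
    using eventually_ge_at_top[of 48]
  proof eventually_elim
    case (elim k)
    have "k \<le> 24 * (k div 12 - 1)"
      using elim by simp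
    then have "real k / 24 \<le> real (k div 12 - 1)"
      by (simp add: field_simps flip: of_nat_mult)
    then have "(real k / 24)\<^sup>2 \<le> (real (k div 12 - 1))\<^sup>2"
      by (intro power_mono) auto
    also have "\<dots> = real ((k div 12 - 1)\<^sup>2)"
      by simp
    also have "\<dots> \<le> real (a k)"
      using a[of k] elim by (simp only: of_nat_le_iff)
    finally have "(real k / 24)\<^sup>2 \<le> real (a k)" .
    moreover have "real (b k) \<le> 4 * real k"
      using b[of k] elim by linarith
    ultimately have "real (b k) / real (a k) \<le> 4 * real k / (real k / 24)\<^sup>2"
      using elim by (intro frac_le) auto
    also have "\<dots> = 2304 / real k"
      using elim by (simp add: power2_eq_square)
    finally show ?case .
  qed
  show "(\<lambda>k. 2304 / real k) \<longlonglongrightarrow> 0"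
    by (rule lim_const_over_n)
qed auto

theorem theorem4p10:
  shows
    "((\<lambda>k. real (card {xs \<in> partitions_of (2 * k + 1).
                     irr_char_at xs (principal_hooks (gamma1 k)) \<noteq> 0})
         / real (card {xs \<in> partitions_of (2 * k + 1).
                     kronecker (gamma1 k) (gamma1 k) xs > 0})) \<longlonglongrightarrow> 0) \<and>
     ((\<lambda>k. real (card {xs \<in> partitions_of (2 * k + 2).
                     irr_char_at xs (principal_hooks (gamma2 k)) \<noteq> 0})
         / real (card {xs \<in> partitions_of (2 * k + 2).
                     kronecker (gamma2 k) (gamma2 k) xs > 0})) \<longlonglongrightarrow> 0)"
proof (intro conjI ratio_tendsto_0)
  fix k :: nat assume k: "1 \<le> k"
  have "card {xs \<in> partitions_of (2 * k + 1). irr_char_at xs (principal_hooks (gamma1 k)) \<noteq> 0} \<le> 2 * k + 1"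
    unfolding principal_hooks_gamma1[OF k]
    by (rule card_irr_char_at_nonzero_le[OF cycle_type_long_cycle(1)]) auto
  then show "card {xs \<in> partitions_of (2 * k + 1). irr_char_at xs (principal_hooks (gamma1 k)) \<noteq> 0} \<le> 2 * k + 2"
    by simp
  show "card {xs \<in> partitions_of (2 * k + 2). irr_char_at xs (principal_hooks (gamma2 k)) \<noteq> 0} \<le> 2 * k + 2"
    unfolding principal_hooks_gamma2[OF k]
    by (rule card_irr_char_at_nonzero_le) (use cycle_type_long_cycle(2)[of "2 * k + 1"] in auto)
  show "(k div 12 - 1)\<^sup>2 \<le> card {xs \<in> partitions_of (2 * k + 1). kronecker (gamma1 k) (gamma1 k) xs > 0}"
    using gamma1_partition[of k]
    by (intro card_constituents_ge near_hook_gamma1) (auto simp: partitions_of_def)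
  show "(k div 12 - 1)\<^sup>2 \<le> card {xs \<in> partitions_of (2 * k + 2). kronecker (gamma2 k) (gamma2 k) xs > 0}"
    using gamma2_partition[OF k]
    by (intro card_constituents_ge near_hook_gamma2 k) (auto simp: partitions_of_def)
qed

end
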